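(* Let $G$ be a compact Hausdorff topological group acting continuously (from the right) on a compact Hausdorff space $X$. Then the action is free if and only if the canonical map $$\mathrm{can}\colon \mathcal{P}_{C(G)}(C(X))\otimes_{C(X/G)}\mathcal{P}_{C(G)}(C(X))\longrightarrow\mathcal{P}_{C(G)}(C(X))\otimes\mathcal{O}(C(G)),\qquad x\otimes y\longmapsto(x\otimes 1)\delta(y),$$ is an isomorphism.
   Context: $C(Y)$ denotes the $C^*$-algebra of continuous complex-valued functions on a compact Hausdorff space $Y$. The action is free if $xg=x$ implies $g=e$ for all $x\in X$, $g\in G$. $\delta\colon C(X)\to C(X)\otimes_{\min}C(G)=C(X\times G)$ is given by $\delta(f)(x,g)=f(xg)$. $\mathcal{O}(C(G))\subseteq C(G)$ is the subalgebra generated by (equivalently, spanned by) the matrix coefficients of irreducible finite-dimensional unitary representations of $G$. The Peter-Weyl algebra is $\mathcal{P}_{C(G)}(C(X)):=\{f\in C(X)\mid\delta(f)\in C(X)\otimes\mathcal{O}(C(G))\}$, where $\otimes$ is the purely algebraic tensor product over $\mathbb{C}$; the tensor product over $C(X/G)$ is also purely algebraic. $C(X/G)$ is identified with the subalgebra of $G$-invariant functions in $C(X)$, i.e. $\{f\in C(X)\mid\delta(f)=f\otimes 1\}$. *)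

theory Defs
  imports "HOL-Analysis.Analysis" "HOL-Algebra.Free_Abelian_Groups" "Jordan_Normal_Form.Matrix"
begin

section \<open>Compact groups and their actions\<close>

locale topological_group = group G for G :: "'g monoid" (structure) +
  fixes T :: "'g topology"
  assumes topspace_eq: "topspace T = carrier G"
    and continuous_mult: "continuous_map (prod_topology T T) T (\<lambda>(g, h). g \<otimes> h)"
    and continuous_inv: "continuous_map T T (\<lambda>g. inv g)"

locale continuous_right_action = topological_group G T
  for G :: "'g monoid" (structure) and T :: "'g topology" +
  fixes X :: "'x topology" and act :: "'x \<Rightarrow> 'g \<Rightarrow> 'x"
  assumes continuous_act: "continuous_map (prod_topology X T) X (\<lambda>(x, g). act x g)"
    and act_one: "x \<in> topspace X \<Longrightarrow> act x \<one> = x"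
    and act_mult: "\<lbrakk>x \<in> topspace X; g \<in> carrier G; h \<in> carrier G\<rbrakk>
      \<Longrightarrow> act x (g \<otimes> h) = act (act x g) h"

definition free_action :: "'g monoid \<Rightarrow> 'x topology \<Rightarrow> ('x \<Rightarrow> 'g \<Rightarrow> 'x) \<Rightarrow> bool" where
  "free_action G X act \<longleftrightarrow>
     (\<forall>x\<in>topspace X. \<forall>g\<in>carrier G. act x g = x \<longrightarrow> g = \<one>\<^bsub>G\<^esub>)"

section \<open>Algebras of functions\<close>

text \<open>Functions on a subset of a type are represented by their extension by \<open>0\<close>, so that equality
  of functions is equality on the subset, the pointwise operations need no restriction, and the
  unit is the indicator function of the subset.\<close>

definition cfun :: "'a topology \<Rightarrow> ('a \<Rightarrow> complex) set" where
  "cfun Y = {f. continuous_map Y euclidean f \<and> (\<forall>y. y \<notin> topspace Y \<longrightarrow> f y = 0)}"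

text \<open>\<open>fun_module S sc A\<close> is the set \<open>A\<close> of functions on \<open>S\<close> with pointwise operations, where a
  scalar \<open>r\<close> acts as multiplication by the function \<open>sc r\<close>.\<close>

definition fun_module ::
    "'a set \<Rightarrow> ('r \<Rightarrow> 'a \<Rightarrow> complex) \<Rightarrow> ('a \<Rightarrow> complex) set \<Rightarrow> ('r, 'a \<Rightarrow> complex) module" where
  "fun_module S sc A =
     \<lparr>carrier = A, mult = (\<lambda>f h y. f y * h y), one = indicator S,
      zero = (\<lambda>_. 0), add = (\<lambda>f h y. f y + h y), smult = (\<lambda>r f y. sc r y * f y)\<rparr>"

definition complex_ring :: "complex ring" where
  "complex_ring = \<lparr>carrier = UNIV, mult = (*), one = 1, zero = 0, add = (+)\<rparr>"

abbreviation fun_vs :: "'a set \<Rightarrow> ('a \<Rightarrow> complex) set \<Rightarrow> (complex, 'a \<Rightarrow> complex) module" where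
  "fun_vs S A \<equiv> fun_module S (\<lambda>c _. c) A"

section \<open>Matrix coefficients\<close>

text \<open>Finite-dimensional Hilbert spaces are taken to be complex coordinate spaces with the standard inner
  product; coefficients with respect to all orthonormal bases arise by conjugating \<open>\<pi>\<close> with
  unitary matrices. The values of \<open>\<pi>\<close> outside the carrier of \<open>G\<close> are irrelevant.\<close>

definition unitary_rep :: "'g monoid \<Rightarrow> 'g topology \<Rightarrow> nat \<Rightarrow> ('g \<Rightarrow> complex mat) \<Rightarrow> bool" where
  "unitary_rep G T n \<pi> \<longleftrightarrow>
     (\<forall>g\<in>carrier G. \<pi> g \<in> carrier_mat n n \<and> \<pi> g * map_mat cnj (transpose_mat (\<pi> g)) = 1\<^sub>m n) \<and>
     (\<forall>g\<in>carrier G. \<forall>h\<in>carrier G. \<pi> (g \<otimes>\<^bsub>G\<^esub> h) = \<pi> g * \<pi> h) \<and>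
     (\<forall>i<n. \<forall>j<n. continuous_map T euclidean (\<lambda>g. \<pi> g $$ (i, j)))"

definition irreducible_rep :: "'g monoid \<Rightarrow> nat \<Rightarrow> ('g \<Rightarrow> complex mat) \<Rightarrow> bool" where
  "irreducible_rep G n \<pi> \<longleftrightarrow> 0 < n \<and>
     (\<forall>W. submodule W complex_ring (module_vec TYPE(complex) n) \<longrightarrow>
          (\<forall>g\<in>carrier G. \<forall>w\<in>W. \<pi> g *\<^sub>v w \<in> W) \<longrightarrow>
          W = {0\<^sub>v n} \<or> W = carrier_vec n)"

definition matrix_coefficients :: "'g monoid \<Rightarrow> 'g topology \<Rightarrow> ('g \<Rightarrow> complex) set" where
  "matrix_coefficients G T =
     {(\<lambda>g. if g \<in> carrier G then \<pi> g $$ (i, j) else 0) | n \<pi> i j.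
        unitary_rep G T n \<pi> \<and> irreducible_rep G n \<pi> \<and> i < n \<and> j < n}"

definition function_subalgebra :: "'a set \<Rightarrow> ('a \<Rightarrow> complex) set \<Rightarrow> bool" where
  "function_subalgebra S A \<longleftrightarrow>
     indicator S \<in> A \<and>
     (\<forall>f\<in>A. \<forall>h\<in>A. (\<lambda>y. f y + h y) \<in> A \<and> (\<lambda>y. f y * h y) \<in> A) \<and>
     (\<forall>c. \<forall>f\<in>A. (\<lambda>y. c * f y) \<in> A)"

definition coeff_algebra :: "'g monoid \<Rightarrow> 'g topology \<Rightarrow> ('g \<Rightarrow> complex) set" where
  "coeff_algebra G T = function_subalgebra (carrier G) hull matrix_coefficients G T"

section \<open>Algebraic tensor products\<close>

definition tensor_relations ::
    "('r, 'b) ring_scheme \<Rightarrow> ('r, 'm) module \<Rightarrow> ('r, 'n) module \<Rightarrow> (('m \<times> 'n) \<Rightarrow>\<^sub>0 int) set" where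
  "tensor_relations R M N =
     {frag_of (m \<oplus>\<^bsub>M\<^esub> m', n) - frag_of (m, n) - frag_of (m', n) | m m' n.
        m \<in> carrier M \<and> m' \<in> carrier M \<and> n \<in> carrier N} \<union>
     {frag_of (m, n \<oplus>\<^bsub>N\<^esub> n') - frag_of (m, n) - frag_of (m, n') | m n n'.
        m \<in> carrier M \<and> n \<in> carrier N \<and> n' \<in> carrier N} \<union>
     {frag_of (r \<odot>\<^bsub>M\<^esub> m, n) - frag_of (m, r \<odot>\<^bsub>N\<^esub> n) | r m n.
        r \<in> carrier R \<and> m \<in> carrier M \<and> n \<in> carrier N}"

definition tensor_kernel ::
    "('r, 'b) ring_scheme \<Rightarrow> ('r, 'm) module \<Rightarrow> ('r, 'n) module \<Rightarrow> (('m \<times> 'n) \<Rightarrow>\<^sub>0 int) set" where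
  "tensor_kernel R M N =
     generate (free_Abelian_group (carrier M \<times> carrier N)) (tensor_relations R M N)"

text \<open>Only the module structure of the tensor product is meaningful: \<open>mult\<close> and \<open>one\<close> are
  unspecified. A scalar acts on a coset by acting on the left tensor factors of a
  representative.\<close>

definition tensor_product ::
    "('r, 'b) ring_scheme \<Rightarrow> ('r, 'm) module \<Rightarrow> ('r, 'n) module
      \<Rightarrow> ('r, (('m \<times> 'n) \<Rightarrow>\<^sub>0 int) set) module" where
  "tensor_product R M N =
     (let F = free_Abelian_group (carrier M \<times> carrier N); Q = F Mod tensor_kernel R M N
      in \<lparr>carrier = carrier Q, mult = undefined, one = undefined,
          zero = \<one>\<^bsub>Q\<^esub>, add = (\<otimes>\<^bsub>Q\<^esub>),
          smult = (\<lambda>r K. \<Union>k\<in>K. tensor_kernel R M N #>\<^bsub>F\<^esub>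
                              frag_extend (\<lambda>(m, n). frag_of (r \<odot>\<^bsub>M\<^esub> m, n)) k)\<rparr>)"

definition pure_tensor ::
    "('r, 'b) ring_scheme \<Rightarrow> ('r, 'm) module \<Rightarrow> ('r, 'n) module \<Rightarrow> 'm \<Rightarrow> 'n
      \<Rightarrow> (('m \<times> 'n) \<Rightarrow>\<^sub>0 int) set" where
  "pure_tensor R M N m n =
     tensor_kernel R M N #>\<^bsub>free_Abelian_group (carrier M \<times> carrier N)\<^esub> frag_of (m, n)"

text \<open>The additive map on a tensor product that is induced by a balanced biadditive map \<open>\<phi>\<close> with
  values in functions: by lemma \<open>tensor_lift_pure\<close> below it sends the class of \<open>m \<otimes> n\<close> to
  \<open>\<phi> (m, n)\<close>.\<close>

definition frag_eval :: "('p \<Rightarrow> 'z \<Rightarrow> complex) \<Rightarrow> ('p \<Rightarrow>\<^sub>0 int) \<Rightarrow> 'z \<Rightarrow> complex" where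
  "frag_eval \<phi> c = (\<lambda>z. \<Sum>p\<in>Poly_Mapping.keys c. of_int (Poly_Mapping.lookup c p) * \<phi> p z)"

definition tensor_lift ::
    "('p \<Rightarrow> 'z \<Rightarrow> complex) \<Rightarrow> ('p \<Rightarrow>\<^sub>0 int) set \<Rightarrow> 'z \<Rightarrow> complex" where
  "tensor_lift \<phi> K = the_elem (frag_eval \<phi> ` K)"

text \<open>The canonical embedding of \<open>C(X) \<otimes> C(G)\<close>, and of tensor products of subspaces, into
  \<open>C(X \<times> G)\<close>.\<close>

definition tensor_fun ::
    "((('x \<Rightarrow> complex) \<times> ('g \<Rightarrow> complex)) \<Rightarrow>\<^sub>0 int) set \<Rightarrow> 'x \<times> 'g \<Rightarrow> complex" where
  "tensor_fun = tensor_lift (\<lambda>(f, h) (x, g). f x * h g)"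

section \<open>The Peter--Weyl algebra and the canonical map\<close>

definition coaction ::
    "'g monoid \<Rightarrow> 'x topology \<Rightarrow> ('x \<Rightarrow> 'g \<Rightarrow> 'x) \<Rightarrow> ('x \<Rightarrow> complex) \<Rightarrow> 'x \<times> 'g \<Rightarrow> complex" where
  "coaction G X act f =
     (\<lambda>(x, g). if x \<in> topspace X \<and> g \<in> carrier G then f (act x g) else 0)"

definition peter_weyl ::
    "'g monoid \<Rightarrow> 'g topology \<Rightarrow> 'x topology \<Rightarrow> ('x \<Rightarrow> 'g \<Rightarrow> 'x) \<Rightarrow> ('x \<Rightarrow> complex) set" where
  "peter_weyl G T X act =
     {f \<in> cfun X. coaction G X act f \<in>
        tensor_fun ` carrier (tensor_product complex_ring
                               (fun_vs (topspace X) (cfun X))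
                               (fun_vs (carrier G) (coeff_algebra G T)))}"

definition invariant_functions ::
    "'g monoid \<Rightarrow> 'x topology \<Rightarrow> ('x \<Rightarrow> 'g \<Rightarrow> 'x) \<Rightarrow> ('x \<Rightarrow> complex) set" where
  "invariant_functions G X act =
     {f \<in> cfun X. coaction G X act f = (\<lambda>(x, g). f x * indicator (carrier G) g)}"

definition can_domain ::
    "'g monoid \<Rightarrow> 'g topology \<Rightarrow> 'x topology \<Rightarrow> ('x \<Rightarrow> 'g \<Rightarrow> 'x)
      \<Rightarrow> ('x \<Rightarrow> complex, ((('x \<Rightarrow> complex) \<times> ('x \<Rightarrow> complex)) \<Rightarrow>\<^sub>0 int) set) module" where
  "can_domain G T X act =
     (let B = fun_module (topspace X) (\<lambda>b. b) (invariant_functions G X act);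
          P = fun_module (topspace X) (\<lambda>b. b) (peter_weyl G T X act)
      in tensor_product B P P)"

definition can_codomain ::
    "'g monoid \<Rightarrow> 'g topology \<Rightarrow> 'x topology \<Rightarrow> ('x \<Rightarrow> 'g \<Rightarrow> 'x)
      \<Rightarrow> (complex, ((('x \<Rightarrow> complex) \<times> ('g \<Rightarrow> complex)) \<Rightarrow>\<^sub>0 int) set) module" where
  "can_codomain G T X act =
     tensor_product complex_ring (fun_vs (topspace X) (peter_weyl G T X act))
                                 (fun_vs (carrier G) (coeff_algebra G T))"

text \<open>The product \<open>(p \<otimes> 1) \<delta>(q)\<close> is formed in \<open>C(X \<times> G)\<close>; as it lies in the image of the
  algebraic tensor product \<open>can_codomain\<close> under the injective map \<open>tensor_fun\<close>, it is pulled back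
  along that map.\<close>

definition canonical_map ::
    "'g monoid \<Rightarrow> 'g topology \<Rightarrow> 'x topology \<Rightarrow> ('x \<Rightarrow> 'g \<Rightarrow> 'x)
      \<Rightarrow> ((('x \<Rightarrow> complex) \<times> ('x \<Rightarrow> complex)) \<Rightarrow>\<^sub>0 int) set
      \<Rightarrow> ((('x \<Rightarrow> complex) \<times> ('g \<Rightarrow> complex)) \<Rightarrow>\<^sub>0 int) set" where
  "canonical_map G T X act t =
     inv_into (carrier (can_codomain G T X act)) tensor_fun
       (tensor_lift (\<lambda>(p, q) (x, g). p x * indicator (carrier G) g * coaction G X act q (x, g)) t)"

section \<open>Well-definedness\<close>

lemma frag_eval_superset:
  assumes "finite S" "Poly_Mapping.keys c \<subseteq> S"
  shows "frag_eval \<phi> c z = (\<Sum>p\<in>S. of_int (Poly_Mapping.lookup c p) * \<phi> p z)"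
  unfolding frag_eval_def using assms
  by (intro sum.mono_neutral_left) (auto simp: in_keys_iff)

lemma frag_eval_add: "frag_eval \<phi> (c + d) z = frag_eval \<phi> c z + frag_eval \<phi> d z"
proof -
  let ?S = "Poly_Mapping.keys c \<union> Poly_Mapping.keys d"
  have "frag_eval \<phi> (c + d) z = (\<Sum>p\<in>?S. of_int (Poly_Mapping.lookup (c + d) p) * \<phi> p z)"
    by (rule frag_eval_superset) (auto dest: subsetD[OF Poly_Mapping.keys_add])
  also have "\<dots> = frag_eval \<phi> c z + frag_eval \<phi> d z"
    by (simp add: frag_eval_superset[of ?S] lookup_add sum.distrib algebra_simps)
  finally show ?thesis .
qed

lemma frag_eval_uminus: "frag_eval \<phi> (- c) z = - frag_eval \<phi> c z"
  by (simp add: frag_eval_def sum_negf)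

lemma frag_eval_diff: "frag_eval \<phi> (c - d) z = frag_eval \<phi> c z - frag_eval \<phi> d z"
  using frag_eval_add[of \<phi> c "- d" z] by (simp add: frag_eval_uminus)

lemma frag_eval_of: "frag_eval \<phi> (frag_of p) z = \<phi> p z"
  by (simp add: frag_eval_def)

definition balanced ::
    "('r, 'b) ring_scheme \<Rightarrow> ('r, 'm) module \<Rightarrow> ('r, 'n) module
      \<Rightarrow> ('m \<times> 'n \<Rightarrow> 'z \<Rightarrow> complex) \<Rightarrow> bool" where
  "balanced R M N \<phi> \<longleftrightarrow>
     (\<forall>m\<in>carrier M. \<forall>m'\<in>carrier M. \<forall>n\<in>carrier N. \<forall>z.
        \<phi> (m \<oplus>\<^bsub>M\<^esub> m', n) z = \<phi> (m, n) z + \<phi> (m', n) z) \<and>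
     (\<forall>m\<in>carrier M. \<forall>n\<in>carrier N. \<forall>n'\<in>carrier N. \<forall>z.
        \<phi> (m, n \<oplus>\<^bsub>N\<^esub> n') z = \<phi> (m, n) z + \<phi> (m, n') z) \<and>
     (\<forall>r\<in>carrier R. \<forall>m\<in>carrier M. \<forall>n\<in>carrier N. \<forall>z.
        \<phi> (r \<odot>\<^bsub>M\<^esub> m, n) z = \<phi> (m, r \<odot>\<^bsub>N\<^esub> n) z)"

lemma frag_eval_tensor_relations:
  assumes "balanced R M N \<phi>" "c \<in> tensor_relations R M N"
  shows "frag_eval \<phi> c z = 0"
  using assms unfolding balanced_def tensor_relations_def
  by (auto simp: frag_eval_diff frag_eval_of)

lemma frag_eval_tensor_kernel:
  assumes "balanced R M N \<phi>" "module R M" "module R N" "c \<in> tensor_kernel R M N"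
  shows "frag_eval \<phi> c z = 0"
proof -
  interpret M: module R M by fact
  interpret N: module R N by fact
  let ?F = "free_Abelian_group (carrier M \<times> carrier N)"
  have keys: "Poly_Mapping.keys h \<subseteq> carrier M \<times> carrier N" if "h \<in> tensor_relations R M N" for h
    using that unfolding tensor_relations_def
    by (auto split: if_splits dest!: subsetD[OF keys_diff])
  show ?thesis
    using assms(4) unfolding tensor_kernel_def
  proof (induction c rule: generate.induct)
    case one
    then show ?case by (simp add: free_Abelian_group_def frag_eval_def)
  next
    case (incl h)
    then show ?case by (rule frag_eval_tensor_relations[OF assms(1)])
  next
    case (inv h)
    then show ?case
      using frag_eval_tensor_relations[OF assms(1) inv] keys[OF inv] by (simp add: frag_eval_uminus)
  next
    case (eng h1 h2)
    then show ?case by (simp add: free_Abelian_group_def frag_eval_add)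
  qed
qed

lemma tensor_lift_coset:
  assumes "balanced R M N \<phi>" "module R M" "module R N"
  shows "tensor_lift \<phi> (tensor_kernel R M N #>\<^bsub>free_Abelian_group (carrier M \<times> carrier N)\<^esub> c)
           = frag_eval \<phi> c"
proof -
  let ?K = "tensor_kernel R M N #>\<^bsub>free_Abelian_group (carrier M \<times> carrier N)\<^esub> c"
  have "frag_eval \<phi> d = frag_eval \<phi> c" if "d \<in> ?K" for d
  proof -
    from that obtain k where "k \<in> tensor_kernel R M N" "d = k + c"
      by (auto simp: r_coset_def free_Abelian_group_def)
    then show ?thesis
      using frag_eval_tensor_kernel[OF assms] by (auto simp: frag_eval_add)
  qed
  moreover have "?K \<noteq> {}"
    unfolding tensor_kernel_def r_coset_def by (auto intro: generate.one)
  ultimately have "frag_eval \<phi> ` ?K = {frag_eval \<phi> c}" by auto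
  then show ?thesis by (simp add: tensor_lift_def)
qed

lemma tensor_lift_pure:
  assumes "balanced R M N \<phi>" "module R M" "module R N"
  shows "tensor_lift \<phi> (pure_tensor R M N m n) = \<phi> (m, n)"
  unfolding pure_tensor_def tensor_lift_coset[OF assms] by (rule ext) (rule frag_eval_of)

end

theory Submission
  imports Defs "Jordan_Normal_Form.Determinant" "HOL-Library.Complex_Order"
begin

text \<open>Let \<open>\<O>\<close> be the algebra of matrix coefficients. If the action is free, every coefficient
  \<open>\<pi>\<^sub>i\<^sub>j (g)\<close> of an irreducible representation is a finite sum of products \<open>p (x) q (x g)\<close>
  with \<open>p\<close> and \<open>q\<close> in the Peter--Weyl algebra. A function that is prescribed on one orbit extends
  to the space by Tietze's theorem and becomes equivariant by averaging, so near each point there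
  is an invertible matrix \<open>\<Phi>\<close> of functions with \<open>\<Phi> (x g) = \<Phi> (x) \<pi> (g)\<close>. Cramer's rule
  solves this for \<open>\<pi> (g)\<close> up to the invariant factor \<open>|det \<Phi>|\<^sup>2\<close> (\<open>locally_reached\<close>); by
  compactness finitely many of these factors have a positive sum, and dividing by it gives the
  claim (\<open>reached_matrix_coefficient\<close>). Sums and products of functions of \<open>g\<close> with this property
  have it again, hence all of \<open>\<O>\<close> does, and the canonical map is surjective. Injectivity follows
  from surjectivity (\<open>lift_can_inj\<close>): the right factors \<open>q\<close> of a tensor satisfy
  \<open>q (x) = \<integral> q (x g) e (g) dg\<close> for some \<open>e\<close> in \<open>\<O>\<close>, and writing \<open>e (g)\<close> as a sum of
  products \<open>z (x) w (x g)\<close> expresses all of them by the same finitely many \<open>z\<close> with invariant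
  coefficients. These coefficients move to the left of the tensor sign, where they add up to
  integrals of the image of the tensor.

  Conversely, if \<open>x g = x\<close>, then the functions in the image of the canonical map do not
  distinguish \<open>(x, g)\<close> from \<open>(x, \<one>)\<close>. If \<open>1 \<otimes> h\<close> is in the image for every coefficient \<open>h\<close>,
  then \<open>h (g) = h (\<one>)\<close>, and \<open>g = \<one>\<close> because the coefficients separate the points of the
  group (\<open>matrix_coefficients_separate\<close>).

  Integration is by the invariant mean on the continuous functions, obtained as the common limit
  of finite averages of left and of right translates (\<open>mean_exists\<close>). The separation of points is
  the theorem of Peter and Weyl. Its analytic core is the existence of a nonzero continuous
  idempotent for convolution (\<open>idempotent_exists\<close>), found by the power method; the functions fixed
  by it form a finite-dimensional invariant space.\<close>

section \<open>Continuous functions on abstract topological spaces\<close>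

lemma continuous_map_algebra_mult:
  fixes f g :: "'a \<Rightarrow> 'b::real_normed_algebra"
  shows "continuous_map X euclidean f \<Longrightarrow> continuous_map X euclidean g
    \<Longrightarrow> continuous_map X euclidean (\<lambda>x. f x * g x)"
  by (simp add: continuous_map_atin tendsto_mult)

lemma continuous_map_cnj:
  "continuous_map X euclidean f \<Longrightarrow> continuous_map X euclidean (\<lambda>x. cnj (f x))"
  by (simp add: continuous_map_atin tendsto_cnj)

lemma continuous_map_Re:
  "continuous_map X euclidean f \<Longrightarrow> continuous_map X euclidean (\<lambda>x. Re (f x))"
  by (simp add: continuous_map_atin tendsto_Re)

lemma continuous_map_Im:
  "continuous_map X euclidean f \<Longrightarrow> continuous_map X euclidean (\<lambda>x. Im (f x))"
  by (simp add: continuous_map_atin tendsto_Im)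

lemma continuous_map_of_real:
  "continuous_map X euclideanreal f \<Longrightarrow> continuous_map X euclidean (\<lambda>x. complex_of_real (f x))"
  by (simp add: continuous_map_atin tendsto_of_real)

lemma continuous_map_complex_inverse:
  fixes f :: "'a \<Rightarrow> complex"
  shows "continuous_map X euclidean f \<Longrightarrow> (\<And>x. x \<in> topspace X \<Longrightarrow> f x \<noteq> 0)
    \<Longrightarrow> continuous_map X euclidean (\<lambda>x. inverse (f x))"
  by (simp add: continuous_map_atin tendsto_inverse)

lemma continuous_map_comp:
  "continuous_map X Y a \<Longrightarrow> continuous_map Y Z f \<Longrightarrow> continuous_map X Z (\<lambda>x. f (a x))"
  using continuous_map_compose[of X Y a Z f] by (simp add: o_def)

lemmas cont_intros =
  continuous_map_algebra_mult continuous_map_cnj continuous_map_add continuous_map_diff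
  continuous_map_minus continuous_map_canonical_const continuous_map_sum

lemma continuous_map_euclidean_iff:
  fixes f :: "'a \<Rightarrow> 'b::metric_space"
  shows "continuous_map X euclidean f \<longleftrightarrow>
    (\<forall>x\<in>topspace X. \<forall>\<epsilon>>0. \<exists>U. openin X U \<and> x \<in> U \<and> (\<forall>y\<in>U. dist (f x) (f y) < \<epsilon>))"
  using Met_TC.continuous_map_to_metric[of X f] by (simp add: mtopology_is_euclidean)

lemma compact_space_bounded:
  fixes f :: "'a \<Rightarrow> 'b::real_normed_vector"
  assumes "compact_space X" "continuous_map X euclidean f"
  obtains c where "c > 0" "\<And>x. x \<in> topspace X \<Longrightarrow> norm (f x) \<le> c"
proof -
  have "compactin euclidean (f ` topspace X)"
    using assms image_compactin compact_space_def by blast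
  then have "bounded (f ` topspace X)"
    by (simp add: compact_imp_bounded)
  then show ?thesis
    using that unfolding bounded_pos by auto
qed

text \<open>A continuous function of two variables depends on the first one uniformly in the second one when
  the second one ranges over a compact space. This is the tube lemma, and it replaces uniform
  continuity throughout.\<close>

lemma uniformly_close_on_compact:
  fixes F :: "'y \<Rightarrow> 'k \<Rightarrow> 'b::real_normed_vector"
  assumes "compact_space K" "continuous_map (prod_topology Y K) euclidean (\<lambda>(y, k). F y k)"
    and y0: "y0 \<in> topspace Y" and "\<epsilon> > 0"
  obtains U where "openin Y U" "y0 \<in> U"
    "\<And>y k. y \<in> U \<Longrightarrow> k \<in> topspace K \<Longrightarrow> norm (F y k - F y0 k) < \<epsilon>"
proof -
  let ?P = "prod_topology Y K"
  have "continuous_map ?P ?P (\<lambda>p. (y0, snd p))"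
    using y0 by (intro continuous_intros) auto
  from continuous_map_comp[OF this assms(2)]
  have "continuous_map ?P euclidean (\<lambda>p. norm ((\<lambda>(y, k). F y k) p - (\<lambda>(y, k). F y k) (y0, snd p)))"
    by (intro continuous_map_norm continuous_map_diff assms(2))
  then have W: "openin ?P {p \<in> topspace ?P. norm ((\<lambda>(y, k). F y k) p - (\<lambda>(y, k). F y k) (y0, snd p)) \<in> {..<\<epsilon>}}"
    by (rule openin_continuous_map_preimage) simp
  have K: "compactin K (topspace K)" using assms(1) by (simp add: compact_space_def)
  have "{y0} \<times> topspace K
      \<subseteq> {p \<in> topspace ?P. norm ((\<lambda>(y, k). F y k) p - (\<lambda>(y, k). F y k) (y0, snd p)) \<in> {..<\<epsilon>}}"
    using y0 assms(4) by auto
  then have "\<exists>U V. openin Y U \<and> openin K V \<and> y0 \<in> U \<and> topspace K \<subseteq> V \<and> U \<times> V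
      \<subseteq> {p \<in> topspace ?P. norm ((\<lambda>(y, k). F y k) p - (\<lambda>(y, k). F y k) (y0, snd p)) \<in> {..<\<epsilon>}}"
    by (rule tube_lemma_right[OF W K y0])
  then obtain U V where U: "openin Y U" "y0 \<in> U" and V: "topspace K \<subseteq> V"
    and UV: "U \<times> V \<subseteq> {p \<in> topspace ?P. norm ((\<lambda>(y, k). F y k) p - (\<lambda>(y, k). F y k) (y0, snd p)) \<in> {..<\<epsilon>}}"
    by (elim exE conjE)
  show ?thesis
  proof (rule that[OF U])
    fix y k assume "y \<in> U" "k \<in> topspace K"
    with V UV have "(y, k) \<in> {p \<in> topspace ?P. norm ((\<lambda>(y, k). F y k) p - (\<lambda>(y, k). F y k) (y0, snd p)) \<in> {..<\<epsilon>}}"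
      by blast
    then show "norm (F y k - F y0 k) < \<epsilon>" by simp
  qed
qed

section \<open>Finite averages\<close>

text \<open>Averages are taken over lists, so that repetitions act as weights and averages of averages are
  averages again.\<close>

definition avg :: "'a list \<Rightarrow> ('a \<Rightarrow> 'b::real_normed_field) \<Rightarrow> 'b" where
  "avg A \<phi> = (\<Sum>a\<leftarrow>A. \<phi> a) / of_nat (length A)"

lemma avg_cong: "(\<And>a. a \<in> set A \<Longrightarrow> \<phi> a = \<psi> a) \<Longrightarrow> avg A \<phi> = avg A \<psi>"
  unfolding avg_def by (metis (mono_tags, lifting) map_eq_conv)

lemma avg_add: "avg A (\<lambda>a. \<phi> a + \<psi> a) = avg A \<phi> + avg A \<psi>"
  unfolding avg_def by (simp add: sum_list_addf add_divide_distrib)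

lemma avg_cmult: "avg A (\<lambda>a. c * \<phi> a) = c * avg A \<phi>"
  unfolding avg_def by (simp add: sum_list_const_mult)

lemma avg_diff: "avg A (\<lambda>a. \<phi> a - \<psi> a) = avg A \<phi> - avg A \<psi>"
  using avg_add[of A \<phi> "\<lambda>a. (-1) * \<psi> a"] avg_cmult[of A "-1" \<psi>] by simp

lemma avg_const: "A \<noteq> [] \<Longrightarrow> avg A (\<lambda>_. c) = c"
  unfolding avg_def by (simp add: sum_list_triv)

lemma sum_list_divide: "(\<Sum>a\<leftarrow>A. \<phi> a / c) = (\<Sum>a\<leftarrow>A. \<phi> a) / (c :: 'b::field)"
  by (simp add: divide_inverse sum_list_mult_const)

lemma avg_swap: "avg A (\<lambda>a. avg B (\<lambda>b. \<phi> a b)) = avg B (\<lambda>b. avg A (\<lambda>a. \<phi> a b))"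
proof -
  have 1: "(\<Sum>a\<leftarrow>A. \<Sum>b\<leftarrow>B. \<phi> a b) = (\<Sum>b\<leftarrow>B. \<Sum>a\<leftarrow>A. \<phi> a b)"
    by (induction A) (simp_all add: sum_list_addf)
  show ?thesis
    unfolding avg_def sum_list_divide 1 by (simp add: mult.commute)
qed

lemma avg_map: "avg (map h A) \<phi> = avg A (\<lambda>a. \<phi> (h a))"
  unfolding avg_def by (simp add: o_def)

lemma avg_avg:
  "avg A (\<lambda>a. avg B (\<lambda>b. \<phi> (op a b))) = avg [op a b. a \<leftarrow> A, b \<leftarrow> B] \<phi>"
proof -
  have 1: "(\<Sum>a\<leftarrow>A. \<Sum>b\<leftarrow>B. \<phi> (op a b)) = (\<Sum>c\<leftarrow>[op a b. a \<leftarrow> A, b \<leftarrow> B]. \<phi> c)"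
    by (induction A) (simp_all add: o_def)
  have 2: "length [op a b. a \<leftarrow> A, b \<leftarrow> B] = length A * length B"
    by (induction A) simp_all
  show ?thesis
    unfolding avg_def sum_list_divide 1 2 by simp
qed

lemma norm_avg_le:
  assumes "A \<noteq> []" "\<And>a. a \<in> set A \<Longrightarrow> norm (\<phi> a) \<le> c"
  shows "norm (avg A \<phi>) \<le> c"
proof -
  have "norm (\<Sum>a\<leftarrow>A. \<phi> a) \<le> (\<Sum>a\<leftarrow>A. c)" if "\<And>a. a \<in> set A \<Longrightarrow> norm (\<phi> a) \<le> c" for A
    using that
  proof (induction A)
    case (Cons a A)
    then have "norm (\<phi> a) \<le> c" "norm (\<Sum>a\<leftarrow>A. \<phi> a) \<le> (\<Sum>a\<leftarrow>A. c)" by auto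
    then show ?case
      using norm_triangle_ineq[of "\<phi> a" "\<Sum>a\<leftarrow>A. \<phi> a"] by simp
  qed simp
  from this[of A] assms show ?thesis
    unfolding avg_def by (simp add: norm_divide sum_list_triv field_simps)
qed

lemma avg_mono_real:
  fixes \<phi> \<psi> :: "'a \<Rightarrow> real"
  assumes "\<And>a. a \<in> set A \<Longrightarrow> \<phi> a \<le> \<psi> a"
  shows "avg A \<phi> \<le> avg A \<psi>"
  unfolding avg_def using assms by (intro divide_right_mono sum_list_mono) auto

lemma avg_le_with_small_value:
  fixes \<phi> :: "'a \<Rightarrow> real"
  assumes "\<And>a. a \<in> set A \<Longrightarrow> \<phi> a \<le> c" "p \<in> set A" "\<phi> p \<le> c - d"
  shows "avg A \<phi> \<le> c - d / length A"
proof -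
  obtain xs ys where A: "A = xs @ p # ys" using assms(2) by (meson split_list)
  have "(\<Sum>a\<leftarrow>xs. \<phi> a) \<le> (\<Sum>a\<leftarrow>xs. c)" "(\<Sum>a\<leftarrow>ys. \<phi> a) \<le> (\<Sum>a\<leftarrow>ys. c)"
    using assms(1) A by (intro sum_list_mono; simp)+
  with assms(3) have "(\<Sum>a\<leftarrow>A. \<phi> a) \<le> length A * c - d"
    unfolding A by (simp add: sum_list_triv algebra_simps)
  moreover have "length A > 0" using A by simp
  ultimately show ?thesis
    unfolding avg_def by (simp add: field_simps)
qed

lemma Re_avg: "Re (avg A \<phi>) = avg A (\<lambda>a. Re (\<phi> a))"
proof -
  have "Re (\<Sum>a\<leftarrow>A. \<phi> a) = (\<Sum>a\<leftarrow>A. Re (\<phi> a))" by (induction A) simp_all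
  then show ?thesis unfolding avg_def by simp
qed

lemma Im_avg: "Im (avg A \<phi>) = avg A (\<lambda>a. Im (\<phi> a))"
proof -
  have "Im (\<Sum>a\<leftarrow>A. \<phi> a) = (\<Sum>a\<leftarrow>A. Im (\<phi> a))" by (induction A) simp_all
  then show ?thesis unfolding avg_def by simp
qed

lemma cnj_avg: "cnj (avg A \<phi>) = avg A (\<lambda>a. cnj (\<phi> a))"
proof -
  have "cnj (\<Sum>a\<leftarrow>A. \<phi> a) = (\<Sum>a\<leftarrow>A. cnj (\<phi> a))" by (induction A) simp_all
  then show ?thesis unfolding avg_def by simp
qed

section \<open>The invariant mean of a compact group\<close>

locale compact_group = topological_group G T for G :: "'g monoid" (structure) and T :: "'g topology" +
  assumes compact: "compact_space T" and Hausdorff: "Hausdorff_space T"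
begin

lemma cont_mult:
  "continuous_map Y T a \<Longrightarrow> continuous_map Y T b \<Longrightarrow> continuous_map Y T (\<lambda>y. a y \<otimes> b y)"
  using continuous_map_comp[OF _ continuous_mult, of Y "\<lambda>y. (a y, b y)"]
  by (simp add: continuous_map_pairedI)

lemma cont_inv: "continuous_map Y T a \<Longrightarrow> continuous_map Y T (\<lambda>y. inv (a y))"
  using continuous_map_comp[OF _ continuous_inv] .

lemma cont_const: "c \<in> carrier G \<Longrightarrow> continuous_map Y T (\<lambda>_. c)"
  by (simp add: topspace_eq)

lemma cont_id: "continuous_map T T (\<lambda>x. x)"
  by simp

lemmas cont_group = cont_mult cont_inv cont_const cont_id continuous_map_fst continuous_map_snd

text \<open>Functions on the group may take any values outside the carrier: continuity and all means below
  see only their values on the carrier, and identities between functions are stated there.\<close>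

abbreviation "cont f \<equiv> continuous_map T euclidean f"

lemma cont_ltrans: "cont f \<Longrightarrow> c \<in> carrier G \<Longrightarrow> cont (\<lambda>x. f (c \<otimes> x))"
  by (rule continuous_map_comp[where Y = T]) (intro cont_group; assumption)

lemma cont_rtrans: "cont f \<Longrightarrow> c \<in> carrier G \<Longrightarrow> cont (\<lambda>x. f (x \<otimes> c))"
  by (rule continuous_map_comp[where Y = T]) (intro cont_group; assumption)

lemma cont_finv: "cont f \<Longrightarrow> cont (\<lambda>x. f (inv x))"
  by (rule continuous_map_comp[where Y = T]) (intro cont_group; assumption)

lemma uniform_continuity:
  fixes f :: "'g \<Rightarrow> 'b::real_normed_vector"
  assumes "cont f" "\<epsilon> > 0"
  obtains U where "openin T U" "\<one> \<in> U"
    "\<And>x u. x \<in> carrier G \<Longrightarrow> u \<in> U \<Longrightarrow> norm (f (x \<otimes> u) - f x) < \<epsilon>"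
proof -
  have "continuous_map (prod_topology T T) euclidean (\<lambda>p. f (snd p \<otimes> fst p))"
    by (rule continuous_map_comp[where Y = T, OF _ assms(1)]) (intro cont_group)
  then have "continuous_map (prod_topology T T) euclidean (\<lambda>(u, x). f (x \<otimes> u))"
    by (simp add: case_prod_unfold)
  from uniformly_close_on_compact[OF compact this, of \<one> \<epsilon>] assms(2)
  obtain U where "openin T U" "\<one> \<in> U"
    "\<And>u x. u \<in> U \<Longrightarrow> x \<in> topspace T \<Longrightarrow> norm (f (x \<otimes> u) - f (x \<otimes> \<one>)) < \<epsilon>"
    by (auto simp: topspace_eq)
  then show ?thesis
    by (intro that[of U]) (simp_all add: topspace_eq)
qed

text \<open>The sets \<open>b\<^sup>-\<^sup>1 U\<close> are open and cover the group, so finitely many suffice. The list depends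
  only on \<open>U\<close>, which is what makes the contraction factor below uniform.\<close>

lemma finite_translates_cover:
  assumes "openin T U" "x0 \<in> U"
  obtains B where "B \<noteq> []" "set B \<subseteq> carrier G" "\<And>x. x \<in> carrier G \<Longrightarrow> \<exists>b\<in>set B. b \<otimes> x \<in> U"
proof -
  have x0: "x0 \<in> carrier G" using assms openin_subset topspace_eq by blast
  let ?V = "\<lambda>b. {x \<in> topspace T. b \<otimes> x \<in> U}"
  have "openin T (?V b)" if "b \<in> carrier G" for b
    using that assms(1) by (intro openin_continuous_map_preimage[where Y = T] cont_group)
  moreover have "topspace T \<subseteq> (\<Union>b\<in>carrier G. ?V b)"
  proof
    fix x assume x: "x \<in> topspace T"
    then have "x0 \<otimes> inv x \<in> carrier G" "(x0 \<otimes> inv x) \<otimes> x = x0"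
      using x0 by (auto simp: topspace_eq m_assoc)
    with x assms(2) show "x \<in> (\<Union>b\<in>carrier G. ?V b)" by force
  qed
  ultimately have "\<exists>\<F>. finite \<F> \<and> \<F> \<subseteq> ?V ` carrier G \<and> topspace T \<subseteq> \<Union>\<F>"
    using compact unfolding compact_space_def by (intro compactinD) auto
  then obtain \<F> where F: "finite \<F>" "\<F> \<subseteq> ?V ` carrier G" "topspace T \<subseteq> \<Union>\<F>"
    by blast
  obtain D where D: "D \<subseteq> carrier G" "finite D" "\<F> = ?V ` D"
    using finite_subset_image[OF F(1,2)] by blast
  have D3: "topspace T \<subseteq> (\<Union>b\<in>D. ?V b)" using F(3) D(3) by simp
  obtain B where B: "set B = D" using finite_list[OF D(2)] by blast
  have "D \<noteq> {}" using D3 x0 topspace_eq by auto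
  moreover have "\<exists>b\<in>D. b \<otimes> x \<in> U" if "x \<in> carrier G" for x
    using D3 that unfolding topspace_eq by blast
  ultimately show ?thesis
    using D(1) B by (intro that[of B]) auto
qed

text \<open>The oscillation of the averages contracts by a factor that depends only on the modulus of
  continuity of \<open>f\<close>, which all averages of translates share: if a value in the lower half of the
  range is attained at \<open>x0\<close>, there are finitely many translations such that each point is brought
  near \<open>x0\<close> by one of them, and averaging over these lowers the upper bound.\<close>

lemma small_oscillation_real:
  fixes f :: "'g \<Rightarrow> real"
  assumes f: "cont f" and "\<epsilon> > 0"
  obtains A where "A \<noteq> []" "set A \<subseteq> carrier G"
    "\<And>x y. x \<in> carrier G \<Longrightarrow> y \<in> carrier G
      \<Longrightarrow> \<bar>avg A (\<lambda>a. f (a \<otimes> x)) - avg A (\<lambda>a. f (a \<otimes> y))\<bar> \<le> \<epsilon>"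
proof -
  define e where "e = \<epsilon> / 4"
  have e: "e > 0" using assms(2) by (simp add: e_def)
  obtain U where U: "openin T U" "\<one> \<in> U"
    "\<And>x u. x \<in> carrier G \<Longrightarrow> u \<in> U \<Longrightarrow> norm (f (x \<otimes> u) - f x) < e"
    using uniform_continuity[OF f e] by blast
  obtain B where B: "B \<noteq> []" "set B \<subseteq> carrier G" "\<And>x. x \<in> carrier G \<Longrightarrow> \<exists>b\<in>set B. b \<otimes> x \<in> U"
    using finite_translates_cover[OF U(1,2)] by blast
  obtain c where c: "c > 0" "\<And>x. x \<in> topspace T \<Longrightarrow> norm (f x) \<le> c"
    using compact_space_bounded[OF compact f] by blast
  (* As long as the range D exceeds \<epsilon> = 4 e, one point of each average lies at least D / 4 below the
     upper bound, which lowers the bound by the fraction 1 / (4 * length B) of D. *)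
  define q where "q = 1 - 1 / (4 * real (length B))"
  have N: "real (length B) \<ge> 1" using B(1) by (cases B) auto
  have "1 / (4 * real (length B)) \<le> 1 / (4 * 1)" using N by (intro divide_left_mono) auto
  with N have q: "0 \<le> q" "q < 1" "1/2 \<le> q" by (auto simp: q_def)
  have "\<exists>A m. A \<noteq> [] \<and> set A \<subseteq> carrier G \<and>
      (\<forall>x\<in>carrier G. m \<le> avg A (\<lambda>a. f (a \<otimes> x)) \<and> avg A (\<lambda>a. f (a \<otimes> x)) \<le> m + max \<epsilon> (2 * c * q ^ n))" for n
  proof (induction n)
    case 0
    have "-c \<le> f x \<and> f x \<le> -c + max \<epsilon> (2 * c * q ^ 0)" if "x \<in> carrier G" for x
      using c(2)[of x] that by (auto simp: topspace_eq abs_le_iff)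
    then show ?case
      by (intro exI[of _ "[\<one>]"] exI[of _ "-c"]) (auto simp: avg_def)
  next
    case (Suc n)
    then obtain A m where A: "A \<noteq> []" "set A \<subseteq> carrier G" and
      m: "\<And>x. x \<in> carrier G \<Longrightarrow> m \<le> avg A (\<lambda>a. f (a \<otimes> x))"
         "\<And>x. x \<in> carrier G \<Longrightarrow> avg A (\<lambda>a. f (a \<otimes> x)) \<le> m + max \<epsilon> (2 * c * q ^ n)" by blast
    define D where "D = 2 * c * q ^ n"
    define g where "g x = avg A (\<lambda>a. f (a \<otimes> x))" for x
    have D0: "D \<ge> 0" using c q by (simp add: D_def)
    have Dq: "2 * c * q ^ Suc n = D * q" by (simp add: D_def)
    (* Either all values lie in the upper half of the range, which is then halved, or some value g x0 lies in
       the lower half and the translates by x0 b carry every point close to x0. *)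
    show ?case
    proof (cases "D \<le> \<epsilon> \<or> (\<forall>x\<in>carrier G. m + D / 2 \<le> g x)")
      case True
      then show ?thesis
      proof
        assume "D \<le> \<epsilon>"
        then have "max \<epsilon> (2 * c * q ^ n) = \<epsilon>" by (simp add: D_def)
        then have "avg A (\<lambda>a. f (a \<otimes> x)) \<le> m + max \<epsilon> (2 * c * q ^ Suc n)" if "x \<in> carrier G" for x
          using m(2)[OF that] max.cobounded1[of \<epsilon> "2 * c * q ^ Suc n"] by linarith
        then show ?thesis
          using A m(1) by (intro exI[of _ A] exI[of _ m]) auto
      next
        assume lo: "\<forall>x\<in>carrier G. m + D / 2 \<le> g x"
        have "m + max \<epsilon> D \<le> m + D / 2 + max \<epsilon> (D * q)"
          using q(3) D0 mult_left_mono[OF q(3) D0] by (auto simp: max_def)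
        then have "avg A (\<lambda>a. f (a \<otimes> x)) \<le> m + D / 2 + max \<epsilon> (D * q)" if "x \<in> carrier G" for x
          using m(2)[OF that, folded D_def] \<open>m + max \<epsilon> D \<le> m + D / 2 + max \<epsilon> (D * q)\<close> by linarith
        then show ?thesis
          using A lo unfolding Dq g_def by (intro exI[of _ A] exI[of _ "m + D / 2"]) auto
      qed
    next
      case False
      then obtain x0 where x0: "x0 \<in> carrier G" "g x0 < m + D / 2" and De: "D > \<epsilon>" by force
      define B' where "B' = map (\<lambda>b. x0 \<otimes> b) B"
      have B': "B' \<noteq> []" "set B' \<subseteq> carrier G" "length B' = length B" using B x0 by (auto simp: B'_def)
      have gU: "\<bar>g (x \<otimes> u) - g x\<bar> \<le> e" if "x \<in> carrier G" "u \<in> U" for x u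
      proof -
        have "u \<in> carrier G" using that(2) U(1) openin_subset topspace_eq by blast
        then have "g (x \<otimes> u) - g x = avg A (\<lambda>a. f ((a \<otimes> x) \<otimes> u) - f (a \<otimes> x))"
          unfolding g_def avg_diff using A that by (auto simp: m_assoc intro!: avg_cong)
        moreover have "norm \<dots> \<le> e"
          using A that by (intro norm_avg_le A less_imp_le[OF U(3)]) auto
        ultimately show ?thesis by simp
      qed
      have gm: "m \<le> g x" "g x \<le> m + D" if "x \<in> carrier G" for x
        using m that De by (auto simp: g_def D_def)
      have "avg B' (\<lambda>b. g (b \<otimes> x)) \<le> m + D * q \<and> m \<le> avg B' (\<lambda>b. g (b \<otimes> x))"
        if x: "x \<in> carrier G" for x
      proof
        obtain b where b: "b \<in> set B" "b \<otimes> x \<in> U" using B(3)[OF x] by blast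
        then have bG: "b \<in> carrier G" using B by auto
        have "g (x0 \<otimes> b \<otimes> x) \<le> (m + D) - D / 4"
          using abs_le_D1[OF gU[OF x0(1) b(2)]] x0 De bG x e_def by (simp add: m_assoc)
        then have "avg B' (\<lambda>b. g (b \<otimes> x)) \<le> (m + D) - (D / 4) / length B'"
          using b B' x gm(2) by (intro avg_le_with_small_value[where p = "x0 \<otimes> b"]) (auto simp: B'_def)
        also have "\<dots> = m + D * q" using N B' by (simp add: q_def field_simps)
        finally show "avg B' (\<lambda>b. g (b \<otimes> x)) \<le> m + D * q" .
        have "avg B' (\<lambda>b. m) \<le> avg B' (\<lambda>b. g (b \<otimes> x))"
          using B' x by (intro avg_mono_real gm(1)) auto
        then show "m \<le> avg B' (\<lambda>b. g (b \<otimes> x))" using B' by (simp add: avg_const)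
      qed
      moreover have "avg [a \<otimes> b. b \<leftarrow> B', a \<leftarrow> A] (\<lambda>a. f (a \<otimes> x)) = avg B' (\<lambda>b. g (b \<otimes> x))"
        if x: "x \<in> carrier G" for x
      proof -
        have "avg B' (\<lambda>b. g (b \<otimes> x)) = avg B' (\<lambda>b. avg A (\<lambda>a. f ((a \<otimes> b) \<otimes> x)))"
          unfolding g_def using A B' x by (intro avg_cong) (auto simp: m_assoc subset_iff)
        then show ?thesis
          using avg_avg[of B' A "\<lambda>c. f (c \<otimes> x)" "\<lambda>b a. a \<otimes> b"] by simp
      qed
      moreover have "[a \<otimes> b. b \<leftarrow> B', a \<leftarrow> A] \<noteq> []" "set [a \<otimes> b. b \<leftarrow> B', a \<leftarrow> A] \<subseteq> carrier G"
        using A B' by (auto simp: neq_Nil_conv)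
      ultimately have C: "\<exists>C. C \<noteq> [] \<and> set C \<subseteq> carrier G \<and>
          (\<forall>x\<in>carrier G. avg C (\<lambda>a. f (a \<otimes> x)) \<le> m + D * q \<and> m \<le> avg C (\<lambda>a. f (a \<otimes> x)))"
        by (intro exI[of _ "[a \<otimes> b. b \<leftarrow> B', a \<leftarrow> A]"]) simp
      have "m + D * q \<le> m + max \<epsilon> (D * q)" by simp
      with C show ?thesis
        unfolding Dq by (meson order_trans)
    qed
  qed
  moreover have "\<exists>n. 2 * c * q ^ n \<le> \<epsilon>"
  proof -
    have "(\<lambda>n. 2 * c * q ^ n) \<longlonglongrightarrow> 2 * c * 0"
      using q by (intro tendsto_mult tendsto_const LIMSEQ_power_zero) auto
    then have "eventually (\<lambda>n. 2 * c * q ^ n < \<epsilon>) sequentially"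
      using \<open>\<epsilon> > 0\<close> by (intro order_tendstoD) auto
    then obtain n where "2 * c * q ^ n < \<epsilon>"
      using eventually_happens'[OF sequentially_bot] by blast
    then show ?thesis by (intro exI[of _ n]) simp
  qed
  ultimately obtain A m where "A \<noteq> []" "set A \<subseteq> carrier G"
    and m: "\<And>x. x \<in> carrier G \<Longrightarrow> m \<le> avg A (\<lambda>a. f (a \<otimes> x)) \<and> avg A (\<lambda>a. f (a \<otimes> x)) \<le> m + \<epsilon>"
    by (metis max.absorb1)
  moreover have "\<bar>avg A (\<lambda>a. f (a \<otimes> x)) - avg A (\<lambda>a. f (a \<otimes> y))\<bar> \<le> \<epsilon>"
    if "x \<in> carrier G" "y \<in> carrier G" for x y
    using m[OF that(1)] m[OF that(2)] by linarith
  ultimately show ?thesis using that by blast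
qed

text \<open>A complex function is treated one part at a time; averaging again does not increase the
  oscillation that has been reached.\<close>

lemma small_oscillation_left:
  fixes f :: "'g \<Rightarrow> complex"
  assumes f: "cont f" and "\<epsilon> > 0"
  obtains A where "A \<noteq> []" "set A \<subseteq> carrier G"
    "\<And>x y. x \<in> carrier G \<Longrightarrow> y \<in> carrier G
      \<Longrightarrow> norm (avg A (\<lambda>a. f (a \<otimes> x)) - avg A (\<lambda>a. f (a \<otimes> y))) \<le> \<epsilon>"
proof -
  have e: "\<epsilon> / 2 > 0" using assms by simp
  obtain A where A: "A \<noteq> []" "set A \<subseteq> carrier G" and oA: "\<And>x y. x \<in> carrier G \<Longrightarrow> y \<in> carrier G
      \<Longrightarrow> \<bar>avg A (\<lambda>a. Re (f (a \<otimes> x))) - avg A (\<lambda>a. Re (f (a \<otimes> y)))\<bar> \<le> \<epsilon> / 2"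
    using small_oscillation_real[OF continuous_map_Re[OF f] e] by metis
  define g where "g x = avg A (\<lambda>a. f (a \<otimes> x))" for x
  have "cont (\<lambda>x. \<Sum>a\<leftarrow>A. f (a \<otimes> x))"
    using A(2) by (induction A) (auto intro!: cont_intros cont_ltrans f)
  then have g: "cont g"
    unfolding g_def avg_def divide_inverse by (intro cont_intros)
  obtain B where B: "B \<noteq> []" "set B \<subseteq> carrier G" and oB: "\<And>x y. x \<in> carrier G \<Longrightarrow> y \<in> carrier G
      \<Longrightarrow> \<bar>avg B (\<lambda>b. Im (g (b \<otimes> x))) - avg B (\<lambda>b. Im (g (b \<otimes> y)))\<bar> \<le> \<epsilon> / 2"
    using small_oscillation_real[OF continuous_map_Im[OF g] e] by metis
  define C where "C = [a \<otimes> b. b \<leftarrow> B, a \<leftarrow> A]"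
  have C: "C \<noteq> []" "set C \<subseteq> carrier G"
    using A B by (auto simp: C_def neq_Nil_conv)
  have gC: "avg C (\<lambda>a. f (a \<otimes> x)) = avg B (\<lambda>b. g (b \<otimes> x))" if "x \<in> carrier G" for x
  proof -
    have "avg B (\<lambda>b. g (b \<otimes> x)) = avg B (\<lambda>b. avg A (\<lambda>a. f ((a \<otimes> b) \<otimes> x)))"
      unfolding g_def using A B that by (intro avg_cong) (auto simp: m_assoc subset_iff)
    then show ?thesis
      unfolding C_def using avg_avg[of B A "\<lambda>c. f (c \<otimes> x)" "\<lambda>b a. a \<otimes> b"] by simp
  qed
  have "norm (avg C (\<lambda>a. f (a \<otimes> x)) - avg C (\<lambda>a. f (a \<otimes> y))) \<le> \<epsilon>"
    if xy: "x \<in> carrier G" "y \<in> carrier G" for x y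
  proof -
    have "norm (avg B (\<lambda>b. Re (g (b \<otimes> x)) - Re (g (b \<otimes> y)))) \<le> \<epsilon> / 2"
      using B xy oA unfolding g_def Re_avg by (intro norm_avg_le) auto
    then have "\<bar>Re (avg B (\<lambda>b. g (b \<otimes> x)) - avg B (\<lambda>b. g (b \<otimes> y)))\<bar> \<le> \<epsilon> / 2"
      by (simp add: Re_avg avg_diff)
    moreover have "\<bar>Im (avg B (\<lambda>b. g (b \<otimes> x)) - avg B (\<lambda>b. g (b \<otimes> y)))\<bar> \<le> \<epsilon> / 2"
      using oB[OF xy] by (simp add: Im_avg)
    ultimately show ?thesis
      unfolding gC[OF xy(1)] gC[OF xy(2)] using cmod_le by (smt (verit) field_sum_of_halves)
  qed
  with C show ?thesis using that by blast
qed

text \<open>Inversion exchanges left and right translates.\<close>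

lemma small_oscillation_right:
  fixes f :: "'g \<Rightarrow> complex"
  assumes f: "cont f" and "\<epsilon> > 0"
  obtains B where "B \<noteq> []" "set B \<subseteq> carrier G"
    "\<And>x y. x \<in> carrier G \<Longrightarrow> y \<in> carrier G
      \<Longrightarrow> norm (avg B (\<lambda>b. f (x \<otimes> b)) - avg B (\<lambda>b. f (y \<otimes> b))) \<le> \<epsilon>"
proof -
  obtain A where A: "A \<noteq> []" "set A \<subseteq> carrier G" and oA: "\<And>x y. x \<in> carrier G \<Longrightarrow> y \<in> carrier G
      \<Longrightarrow> norm (avg A (\<lambda>a. f (inv (a \<otimes> x))) - avg A (\<lambda>a. f (inv (a \<otimes> y)))) \<le> \<epsilon>"
    using small_oscillation_left[OF cont_finv[OF f] assms(2)] by metis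
  have "avg (map (\<lambda>a. inv a) A) (\<lambda>b. f (x \<otimes> b)) = avg A (\<lambda>a. f (inv (a \<otimes> inv x)))" if "x \<in> carrier G" for x
    unfolding avg_map using A that by (intro avg_cong) (auto simp: inv_mult_group subset_iff)
  with oA A show ?thesis
    by (intro that[of "map (\<lambda>a. inv a) A"]) auto
qed

text \<open>These predicates say that \<open>c\<close> is a uniform limit of averages of left, respectively right,
  translates of \<open>f\<close>. Having both kinds is what makes the mean unique and invariant on both sides.\<close>

definition left_mean :: "('g \<Rightarrow> complex) \<Rightarrow> complex \<Rightarrow> bool" where
  "left_mean f c \<longleftrightarrow> (\<forall>\<epsilon>>0. \<exists>A. A \<noteq> [] \<and> set A \<subseteq> carrier G \<and>
     (\<forall>x\<in>carrier G. norm (avg A (\<lambda>a. f (a \<otimes> x)) - c) \<le> \<epsilon>))"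

definition right_mean :: "('g \<Rightarrow> complex) \<Rightarrow> complex \<Rightarrow> bool" where
  "right_mean f c \<longleftrightarrow> (\<forall>\<epsilon>>0. \<exists>B. B \<noteq> [] \<and> set B \<subseteq> carrier G \<and>
     (\<forall>x\<in>carrier G. norm (avg B (\<lambda>b. f (x \<otimes> b)) - c) \<le> \<epsilon>))"

text \<open>Left and right averages commute, so an almost constant left average and an almost constant right
  average take almost the same value: both are close to the two-sided average.\<close>

lemma left_right_average_close:
  assumes A: "A \<noteq> []" "set A \<subseteq> carrier G" and B: "B \<noteq> []" "set B \<subseteq> carrier G"
    and c: "\<And>x. x \<in> carrier G \<Longrightarrow> norm (avg A (\<lambda>a. f (a \<otimes> x)) - c) \<le> \<epsilon>"
    and d: "\<And>x. x \<in> carrier G \<Longrightarrow> norm (avg B (\<lambda>b. f (x \<otimes> b)) - d) \<le> \<delta>"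
  shows "norm (c - d) \<le> \<epsilon> + \<delta>"
proof -
  define m where "m = avg A (\<lambda>a. avg B (\<lambda>b. f (a \<otimes> b)))"
  have "norm (avg A (\<lambda>a. avg B (\<lambda>b. f (a \<otimes> b)) - d)) \<le> \<delta>"
    using A d by (intro norm_avg_le) auto
  then have "norm (m - d) \<le> \<delta>"
    using A by (simp add: avg_diff avg_const m_def)
  moreover have "norm (avg B (\<lambda>b. avg A (\<lambda>a. f (a \<otimes> b)) - c)) \<le> \<epsilon>"
    using B c by (intro norm_avg_le) auto
  then have "norm (m - c) \<le> \<epsilon>"
    unfolding m_def avg_swap[of A B] using B by (simp add: avg_diff avg_const)
  ultimately show ?thesis
    using norm_triangle_ineq4[of "m - d" "m - c"] by (simp add: norm_minus_commute)
qed

lemma left_mean_eq_right_mean: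
  assumes "left_mean f c" "right_mean f d"
  shows "c = d"
proof (rule ccontr)
  assume "c \<noteq> d"
  then have e: "norm (c - d) / 3 > 0" by simp
  obtain A B where "A \<noteq> []" "set A \<subseteq> carrier G" "B \<noteq> []" "set B \<subseteq> carrier G"
    "\<And>x. x \<in> carrier G \<Longrightarrow> norm (avg A (\<lambda>a. f (a \<otimes> x)) - c) \<le> norm (c - d) / 3"
    "\<And>x. x \<in> carrier G \<Longrightarrow> norm (avg B (\<lambda>b. f (x \<otimes> b)) - d) \<le> norm (c - d) / 3"
    using assms e unfolding left_mean_def right_mean_def by meson
  from left_right_average_close[OF this] e show False by simp
qed

text \<open>Left and right averages of oscillation \<open>1 / (n + 1)\<close> take values that are close to each
  other for different \<open>n\<close>, by \<open>left_right_average_close\<close>. Hence both sequences of values are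
  Cauchy with the same limit.\<close>

lemma mean_exists:
  assumes f: "cont f"
  shows "\<exists>c. left_mean f c \<and> right_mean f c"
proof -
  have "\<exists>A. A \<noteq> [] \<and> set A \<subseteq> carrier G \<and> (\<forall>x\<in>carrier G.
      norm (avg A (\<lambda>a. f (a \<otimes> x)) - avg A (\<lambda>a. f (a \<otimes> \<one>))) \<le> inverse (real (Suc n)))" for n
    using small_oscillation_left[OF f, of "inverse (real (Suc n))"] by (metis one_closed inverse_positive_iff_positive of_nat_0_less_iff zero_less_Suc)
  then obtain A where A: "\<And>n. A n \<noteq> [] \<and> set (A n) \<subseteq> carrier G \<and> (\<forall>x\<in>carrier G.
      norm (avg (A n) (\<lambda>a. f (a \<otimes> x)) - avg (A n) (\<lambda>a. f (a \<otimes> \<one>))) \<le> inverse (real (Suc n)))"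
    by metis
  have "\<exists>B. B \<noteq> [] \<and> set B \<subseteq> carrier G \<and> (\<forall>x\<in>carrier G.
      norm (avg B (\<lambda>b. f (x \<otimes> b)) - avg B (\<lambda>b. f (\<one> \<otimes> b))) \<le> inverse (real (Suc n)))" for n
    using small_oscillation_right[OF f, of "inverse (real (Suc n))"] by (metis one_closed inverse_positive_iff_positive of_nat_0_less_iff zero_less_Suc)
  then obtain B where B: "\<And>n. B n \<noteq> [] \<and> set (B n) \<subseteq> carrier G \<and> (\<forall>x\<in>carrier G.
      norm (avg (B n) (\<lambda>b. f (x \<otimes> b)) - avg (B n) (\<lambda>b. f (\<one> \<otimes> b))) \<le> inverse (real (Suc n)))"
    by metis
  define c where "c n = avg (A n) (\<lambda>a. f (a \<otimes> \<one>))" for n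
  define d where "d n = avg (B n) (\<lambda>b. f (\<one> \<otimes> b))" for n
  have cd: "norm (c n - d m) \<le> inverse (real (Suc n)) + inverse (real (Suc m))" for n m
    using A[of n] B[of m] unfolding c_def d_def by (intro left_right_average_close[of "A n" "B m" f]) auto
  have lim0: "(\<lambda>n. inverse (real (Suc n))) \<longlonglongrightarrow> 0" by (rule LIMSEQ_inverse_real_of_nat)
  have "Cauchy c"
  proof (rule metric_CauchyI)
    fix e :: real assume "e > 0"
    then obtain N where N: "inverse (real (Suc N)) < e / 4"
      using reals_Archimedean[of "e / 4"] by auto
    have "dist (c m) (c n) < e" if "m \<ge> N" "n \<ge> N" for m n
    proof -
      have "inverse (real (Suc m)) \<le> inverse (real (Suc N))" "inverse (real (Suc n)) \<le> inverse (real (Suc N))"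
        using that by (auto intro!: le_imp_inverse_le)
      moreover have "dist (c m) (c n) \<le> norm (c m - d N) + norm (c n - d N)"
        by (metis dist_norm dist_triangle2)
      ultimately show ?thesis using cd[of m N] cd[of n N] N by linarith
    qed
    then show "\<exists>M. \<forall>m\<ge>M. \<forall>n\<ge>M. dist (c m) (c n) < e" by blast
  qed
  then obtain l where l: "c \<longlonglongrightarrow> l" by (auto simp: Cauchy_convergent_iff convergent_def)
  have "(\<lambda>n. c n - d n) \<longlonglongrightarrow> 0"
    using cd by (intro Lim_null_comparison[OF always_eventually tendsto_add_zero[OF lim0 lim0]]) blast
  from tendsto_diff[OF l this] have l': "d \<longlonglongrightarrow> l" by simp
  have "left_mean f l"
    unfolding left_mean_def
  proof (intro allI impI)
    fix \<epsilon> :: real assume "\<epsilon> > 0"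
    then have "\<forall>\<^sub>F n in sequentially. inverse (real (Suc n)) < \<epsilon> / 2 \<and> dist (c n) l < \<epsilon> / 2"
      using lim0 l by (intro eventually_conj order_tendstoD(2) tendstoD) auto
    then obtain n where n: "inverse (real (Suc n)) < \<epsilon> / 2" "dist (c n) l < \<epsilon> / 2"
      using eventually_happens'[OF sequentially_bot] by blast
    have "norm (avg (A n) (\<lambda>a. f (a \<otimes> x)) - l) \<le> \<epsilon>" if "x \<in> carrier G" for x
    proof -
      have "norm (avg (A n) (\<lambda>a. f (a \<otimes> x)) - c n) \<le> inverse (real (Suc n))"
        using A[of n] that by (auto simp: c_def)
      with n norm_triangle_ineq[of "avg (A n) (\<lambda>a. f (a \<otimes> x)) - c n" "c n - l"] show ?thesis
        by (simp add: dist_norm)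
    qed
    with A[of n] show "\<exists>A. A \<noteq> [] \<and> set A \<subseteq> carrier G \<and>
      (\<forall>x\<in>carrier G. norm (avg A (\<lambda>a. f (a \<otimes> x)) - l) \<le> \<epsilon>)" by blast
  qed
  moreover have "right_mean f l"
    unfolding right_mean_def
  proof (intro allI impI)
    fix \<epsilon> :: real assume "\<epsilon> > 0"
    then have "\<forall>\<^sub>F n in sequentially. inverse (real (Suc n)) < \<epsilon> / 2 \<and> dist (d n) l < \<epsilon> / 2"
      using lim0 l' by (intro eventually_conj order_tendstoD(2) tendstoD) auto
    then obtain n where n: "inverse (real (Suc n)) < \<epsilon> / 2" "dist (d n) l < \<epsilon> / 2"
      using eventually_happens'[OF sequentially_bot] by blast
    have "norm (avg (B n) (\<lambda>b. f (x \<otimes> b)) - l) \<le> \<epsilon>" if "x \<in> carrier G" for x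
    proof -
      have "norm (avg (B n) (\<lambda>b. f (x \<otimes> b)) - d n) \<le> inverse (real (Suc n))"
        using B[of n] that by (auto simp: d_def)
      with n norm_triangle_ineq[of "avg (B n) (\<lambda>b. f (x \<otimes> b)) - d n" "d n - l"] show ?thesis
        by (simp add: dist_norm)
    qed
    with B[of n] show "\<exists>B. B \<noteq> [] \<and> set B \<subseteq> carrier G \<and>
      (\<forall>x\<in>carrier G. norm (avg B (\<lambda>b. f (x \<otimes> b)) - l) \<le> \<epsilon>)" by blast
  qed
  ultimately show ?thesis by blast
qed

definition haar :: "('g \<Rightarrow> complex) \<Rightarrow> complex" where
  "haar f = (SOME c. left_mean f c \<and> right_mean f c)"

lemma haar_means: "cont f \<Longrightarrow> left_mean f (haar f) \<and> right_mean f (haar f)"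
  unfolding haar_def by (rule someI_ex[OF mean_exists])

lemma haar_eqI_left: "cont f \<Longrightarrow> left_mean f c \<Longrightarrow> haar f = c"
  using haar_means left_mean_eq_right_mean by blast

lemma haar_eqI_right: "cont f \<Longrightarrow> right_mean f c \<Longrightarrow> haar f = c"
  using haar_means left_mean_eq_right_mean by blast

lemma haar_cong: "(\<And>x. x \<in> carrier G \<Longrightarrow> f x = h x) \<Longrightarrow> haar f = haar h"
proof -
  assume eq: "\<And>x. x \<in> carrier G \<Longrightarrow> f x = h x"
  have "avg A (\<lambda>a. f (a \<otimes> x)) = avg A (\<lambda>a. h (a \<otimes> x))"
    "avg A (\<lambda>a. f (x \<otimes> a)) = avg A (\<lambda>a. h (x \<otimes> a))"
    if "set A \<subseteq> carrier G" "x \<in> carrier G" for A x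
    using that by (auto intro!: avg_cong eq)
  then have "left_mean f c = left_mean h c" "right_mean f c = right_mean h c" for c
    unfolding left_mean_def right_mean_def by (simp_all cong: conj_cong)
  then show ?thesis unfolding haar_def by simp
qed

lemma haar_approx_left:
  assumes "cont f" "\<epsilon> > 0"
  obtains A where "A \<noteq> []" "set A \<subseteq> carrier G"
    "\<And>x. x \<in> carrier G \<Longrightarrow> norm (avg A (\<lambda>a. f (a \<otimes> x)) - haar f) \<le> \<epsilon>"
  using haar_means[OF assms(1)] assms(2) unfolding left_mean_def by metis

lemma haar_approx_right:
  assumes "cont f" "\<epsilon> > 0"
  obtains B where "B \<noteq> []" "set B \<subseteq> carrier G"
    "\<And>x. x \<in> carrier G \<Longrightarrow> norm (avg B (\<lambda>b. f (x \<otimes> b)) - haar f) \<le> \<epsilon>"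
  using haar_means[OF assms(1)] assms(2) unfolding right_mean_def by metis

lemma haar_const [simp]: "haar (\<lambda>_. c) = c"
  by (rule haar_eqI_left) (auto simp: left_mean_def avg_const intro!: exI[of _ "[\<one>]"])

text \<open>Left translation commutes with right averages, so it preserves right means. Right translation
  and inversion are treated in the same way with the sides exchanged.\<close>

lemma haar_ltrans:
  assumes f: "cont f" and c: "c \<in> carrier G"
  shows "haar (\<lambda>x. f (c \<otimes> x)) = haar f"
proof (rule haar_eqI_right[OF cont_ltrans[OF f c]])
  show "right_mean (\<lambda>x. f (c \<otimes> x)) (haar f)"
    unfolding right_mean_def
  proof (intro allI impI)
    fix \<epsilon> :: real assume "\<epsilon> > 0"
    then obtain B where B: "B \<noteq> []" "set B \<subseteq> carrier G"
      "\<And>x. x \<in> carrier G \<Longrightarrow> norm (avg B (\<lambda>b. f (x \<otimes> b)) - haar f) \<le> \<epsilon>"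
      using haar_approx_right[OF f] by blast
    have "avg B (\<lambda>b. f (c \<otimes> (x \<otimes> b))) = avg B (\<lambda>b. f ((c \<otimes> x) \<otimes> b))" if "x \<in> carrier G" for x
      using B(2) c that by (intro avg_cong) (auto simp: m_assoc subset_iff)
    with B c show "\<exists>B. B \<noteq> [] \<and> set B \<subseteq> carrier G \<and>
      (\<forall>x\<in>carrier G. norm (avg B (\<lambda>b. f (c \<otimes> (x \<otimes> b))) - haar f) \<le> \<epsilon>)"
      by (intro exI[of _ B]) simp
  qed
qed

lemma haar_rtrans:
  assumes f: "cont f" and c: "c \<in> carrier G"
  shows "haar (\<lambda>x. f (x \<otimes> c)) = haar f"
proof (rule haar_eqI_left[OF cont_rtrans[OF f c]])
  show "left_mean (\<lambda>x. f (x \<otimes> c)) (haar f)"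
    unfolding left_mean_def
  proof (intro allI impI)
    fix \<epsilon> :: real assume "\<epsilon> > 0"
    then obtain B where B: "B \<noteq> []" "set B \<subseteq> carrier G"
      "\<And>x. x \<in> carrier G \<Longrightarrow> norm (avg B (\<lambda>b. f (b \<otimes> x)) - haar f) \<le> \<epsilon>"
      using haar_approx_left[OF f] by blast
    have "avg B (\<lambda>b. f (b \<otimes> x \<otimes> c)) = avg B (\<lambda>b. f (b \<otimes> (x \<otimes> c)))" if "x \<in> carrier G" for x
      using B(2) c that by (intro avg_cong) (auto simp: m_assoc subset_iff)
    with B c show "\<exists>B. B \<noteq> [] \<and> set B \<subseteq> carrier G \<and>
      (\<forall>x\<in>carrier G. norm (avg B (\<lambda>b. f (b \<otimes> x \<otimes> c)) - haar f) \<le> \<epsilon>)"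
      by (intro exI[of _ B]) simp
  qed
qed

lemma haar_inv:
  assumes f: "cont f"
  shows "haar (\<lambda>x. f (inv x)) = haar f"
proof (rule haar_eqI_right[OF cont_finv[OF f]])
  show "right_mean (\<lambda>x. f (inv x)) (haar f)"
    unfolding right_mean_def
  proof (intro allI impI)
    fix \<epsilon> :: real assume "\<epsilon> > 0"
    then obtain A where A: "A \<noteq> []" "set A \<subseteq> carrier G"
      "\<And>x. x \<in> carrier G \<Longrightarrow> norm (avg A (\<lambda>a. f (a \<otimes> x)) - haar f) \<le> \<epsilon>"
      using haar_approx_left[OF f] by blast
    have "avg (map (\<lambda>a. inv a) A) (\<lambda>b. f (inv (x \<otimes> b))) = avg A (\<lambda>a. f (a \<otimes> inv x))"
      if "x \<in> carrier G" for x
      unfolding avg_map using A(2) that by (intro avg_cong) (auto simp: inv_mult_group subset_iff)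
    with A show "\<exists>B. B \<noteq> [] \<and> set B \<subseteq> carrier G \<and>
      (\<forall>x\<in>carrier G. norm (avg B (\<lambda>b. f (inv (x \<otimes> b))) - haar f) \<le> \<epsilon>)"
      by (intro exI[of _ "map (\<lambda>a. inv a) A"]) auto
  qed
qed

lemma haar_cmult:
  assumes f: "cont f"
  shows "haar (\<lambda>x. c * f x) = c * haar f"
proof (rule haar_eqI_left[OF continuous_map_algebra_mult[OF continuous_map_canonical_const f]])
  show "left_mean (\<lambda>x. c * f x) (c * haar f)"
    unfolding left_mean_def
  proof (intro allI impI)
    fix \<epsilon> :: real assume "\<epsilon> > 0"
    then have "\<epsilon> / (norm c + 1) > 0" by (simp add: add_nonneg_pos)
    then obtain A where A: "A \<noteq> []" "set A \<subseteq> carrier G"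
      "\<And>x. x \<in> carrier G \<Longrightarrow> norm (avg A (\<lambda>a. f (a \<otimes> x)) - haar f) \<le> \<epsilon> / (norm c + 1)"
      using haar_approx_left[OF f] by blast
    have "norm (avg A (\<lambda>a. c * f (a \<otimes> x)) - c * haar f) \<le> \<epsilon>" if "x \<in> carrier G" for x
    proof -
      have "norm (avg A (\<lambda>a. c * f (a \<otimes> x)) - c * haar f)
          = norm c * norm (avg A (\<lambda>a. f (a \<otimes> x)) - haar f)"
        by (simp add: avg_cmult flip: norm_mult right_diff_distrib)
      also have "\<dots> \<le> (norm c + 1) * (\<epsilon> / (norm c + 1))"
        using A(3)[OF that] by (intro mult_mono) auto
      also have "\<dots> = \<epsilon>" by (simp add: add_nonneg_eq_0_iff)
      finally show ?thesis .
    qed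
    with A show "\<exists>A. A \<noteq> [] \<and> set A \<subseteq> carrier G \<and>
      (\<forall>x\<in>carrier G. norm (avg A (\<lambda>a. c * f (a \<otimes> x)) - c * haar f) \<le> \<epsilon>)" by blast
  qed
qed

lemma haar_cnj:
  assumes f: "cont f"
  shows "haar (\<lambda>x. cnj (f x)) = cnj (haar f)"
proof (rule haar_eqI_left[OF continuous_map_cnj[OF f]])
  show "left_mean (\<lambda>x. cnj (f x)) (cnj (haar f))"
    unfolding left_mean_def
  proof (intro allI impI)
    fix \<epsilon> :: real assume "\<epsilon> > 0"
    then obtain A where A: "A \<noteq> []" "set A \<subseteq> carrier G"
      "\<And>x. x \<in> carrier G \<Longrightarrow> norm (avg A (\<lambda>a. f (a \<otimes> x)) - haar f) \<le> \<epsilon>"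
      using haar_approx_left[OF f] by blast
    have "norm (avg A (\<lambda>a. cnj (f (a \<otimes> x))) - cnj (haar f)) = norm (avg A (\<lambda>a. f (a \<otimes> x)) - haar f)" for x
      by (simp flip: cnj_avg complex_cnj_diff)
    with A show "\<exists>A. A \<noteq> [] \<and> set A \<subseteq> carrier G \<and>
      (\<forall>x\<in>carrier G. norm (avg A (\<lambda>a. cnj (f (a \<otimes> x))) - cnj (haar f)) \<le> \<epsilon>)" by auto
  qed
qed

lemma cont_avg_ltrans:
  assumes "cont f" "set A \<subseteq> carrier G"
  shows "cont (\<lambda>x. avg A (\<lambda>a. f (a \<otimes> x)))"
proof -
  have "cont (\<lambda>x. \<Sum>a\<leftarrow>A. f (a \<otimes> x))"
    using assms(2) by (induction A) (auto intro!: cont_intros cont_ltrans assms(1))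
  then show ?thesis
    unfolding avg_def divide_inverse by (intro cont_intros)
qed

text \<open>A left average has the same right means as the function itself.\<close>

lemma haar_avg_ltrans:
  assumes f: "cont f" and A: "A \<noteq> []" "set A \<subseteq> carrier G"
  shows "haar (\<lambda>x. avg A (\<lambda>a. f (a \<otimes> x))) = haar f"
proof (rule haar_eqI_right[OF cont_avg_ltrans[OF f A(2)]])
  show "right_mean (\<lambda>x. avg A (\<lambda>a. f (a \<otimes> x))) (haar f)"
    unfolding right_mean_def
  proof (intro allI impI)
    fix \<epsilon> :: real assume "\<epsilon> > 0"
    then obtain B where B: "B \<noteq> []" "set B \<subseteq> carrier G"
      "\<And>x. x \<in> carrier G \<Longrightarrow> norm (avg B (\<lambda>b. f (x \<otimes> b)) - haar f) \<le> \<epsilon>"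
      using haar_approx_right[OF f] by blast
    have "norm (avg B (\<lambda>b. avg A (\<lambda>a. f (a \<otimes> (x \<otimes> b)))) - haar f) \<le> \<epsilon>" if x: "x \<in> carrier G" for x
    proof -
      have "avg B (\<lambda>b. avg A (\<lambda>a. f (a \<otimes> (x \<otimes> b)))) = avg A (\<lambda>a. avg B (\<lambda>b. f ((a \<otimes> x) \<otimes> b)))"
        unfolding avg_swap[of B A] using A B x by (intro avg_cong) (auto simp: m_assoc subset_iff)
      then have "avg B (\<lambda>b. avg A (\<lambda>a. f (a \<otimes> (x \<otimes> b)))) - haar f
          = avg A (\<lambda>a. avg B (\<lambda>b. f ((a \<otimes> x) \<otimes> b)) - haar f)"
        using A by (simp add: avg_diff avg_const)
      also have "norm \<dots> \<le> \<epsilon>"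
        using A B x by (intro norm_avg_le) auto
      finally show ?thesis .
    qed
    with B show "\<exists>B. B \<noteq> [] \<and> set B \<subseteq> carrier G \<and>
      (\<forall>x\<in>carrier G. norm (avg B (\<lambda>b. avg A (\<lambda>a. f (a \<otimes> (x \<otimes> b)))) - haar f) \<le> \<epsilon>)" by blast
  qed
qed

text \<open>Average the functions one after the other: a further average keeps the functions that are almost
  constant already within the same bound of their means.\<close>

lemma haar_approx_finite:
  assumes "\<forall>h\<in>set fs. cont h" "\<epsilon> > 0"
  shows "\<exists>A. A \<noteq> [] \<and> set A \<subseteq> carrier G \<and>
    (\<forall>f\<in>set fs. \<forall>x\<in>carrier G. norm (avg A (\<lambda>a. f (a \<otimes> x)) - haar f) \<le> \<epsilon>)"
  using assms(1)
proof (induction fs)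
  case Nil
  then show ?case by (intro exI[of _ "[\<one>]"]) auto
next
  case (Cons h fs)
  then obtain A where A: "A \<noteq> []" "set A \<subseteq> carrier G"
    "\<And>f x. f \<in> set fs \<Longrightarrow> x \<in> carrier G \<Longrightarrow> norm (avg A (\<lambda>a. f (a \<otimes> x)) - haar f) \<le> \<epsilon>" by auto
  let ?h = "\<lambda>x. avg A (\<lambda>a. h (a \<otimes> x))"
  have h: "cont h" "cont ?h" using Cons.prems A by (auto intro: cont_avg_ltrans)
  obtain B where B: "B \<noteq> []" "set B \<subseteq> carrier G"
    "\<And>x. x \<in> carrier G \<Longrightarrow> norm (avg B (\<lambda>b. ?h (b \<otimes> x)) - haar h) \<le> \<epsilon>"
    using haar_approx_left[OF h(2) assms(2)] haar_avg_ltrans[OF h(1) A(1,2)] by metis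
  define C where "C = [a \<otimes> b. b \<leftarrow> B, a \<leftarrow> A]"
  have C: "C \<noteq> []" "set C \<subseteq> carrier G"
    using A B by (auto simp: C_def neq_Nil_conv)
  have fC: "avg C (\<lambda>a. f (a \<otimes> x)) = avg B (\<lambda>b. avg A (\<lambda>a. f (a \<otimes> (b \<otimes> x))))" if "x \<in> carrier G" for f x
  proof -
    have "avg B (\<lambda>b. avg A (\<lambda>a. f (a \<otimes> (b \<otimes> x)))) = avg B (\<lambda>b. avg A (\<lambda>a. f ((a \<otimes> b) \<otimes> x)))"
      using A B that by (intro avg_cong) (auto simp: m_assoc subset_iff)
    then show ?thesis
      unfolding C_def using avg_avg[of B A "\<lambda>c. f (c \<otimes> x)" "\<lambda>b a. a \<otimes> b"] by simp
  qed
  have "norm (avg C (\<lambda>a. f (a \<otimes> x)) - haar f) \<le> \<epsilon>" if f: "f \<in> set (h # fs)" and x: "x \<in> carrier G" for f x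
  proof (cases "f = h")
    case True
    show ?thesis unfolding True fC[OF x, of h] by (rule B(3)[OF x])
  next
    case False
    have "avg C (\<lambda>a. f (a \<otimes> x)) - haar f = avg B (\<lambda>b. avg A (\<lambda>a. f (a \<otimes> (b \<otimes> x))) - haar f)"
      unfolding fC[OF x] using B by (simp add: avg_diff avg_const)
    also have "norm \<dots> \<le> \<epsilon>"
      using f False x B A(3) by (intro norm_avg_le) auto
    finally show ?thesis .
  qed
  with C show ?case by blast
qed

text \<open>One list averages both functions almost to their means, and finite averages satisfy the
  inequality. Additivity is proved in the same way.\<close>

lemma norm_haar_diff_le:
  assumes "cont f" "cont h" "\<And>x. x \<in> carrier G \<Longrightarrow> norm (f x - h x) \<le> c"
  shows "norm (haar f - haar h) \<le> c"
proof (rule field_le_epsilon)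
  fix e :: real assume "e > 0"
  then have "e / 2 > 0" by simp
  moreover have "\<forall>F\<in>set [f, h]. cont F" using assms(1,2) by simp
  ultimately obtain A where A: "A \<noteq> []" "set A \<subseteq> carrier G"
    "\<And>F x. F \<in> set [f, h] \<Longrightarrow> x \<in> carrier G \<Longrightarrow> norm (avg A (\<lambda>a. F (a \<otimes> x)) - haar F) \<le> e / 2"
    using haar_approx_finite by meson
  have "norm (avg A (\<lambda>a. f (a \<otimes> \<one>) - h (a \<otimes> \<one>))) \<le> c"
    using A assms by (intro norm_avg_le) auto
  then have "norm (avg A (\<lambda>a. f (a \<otimes> \<one>)) - avg A (\<lambda>a. h (a \<otimes> \<one>))) \<le> c"
    by (simp add: avg_diff)
  moreover have "norm (avg A (\<lambda>a. f (a \<otimes> \<one>)) - haar f) \<le> e / 2" "norm (avg A (\<lambda>a. h (a \<otimes> \<one>)) - haar h) \<le> e / 2"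
    using A by auto
  ultimately show "norm (haar f - haar h) \<le> c + e"
    by norm
qed

lemma norm_haar_le:
  assumes "cont f" "\<And>x. x \<in> carrier G \<Longrightarrow> norm (f x) \<le> c"
  shows "norm (haar f) \<le> c"
  using norm_haar_diff_le[OF assms(1) continuous_map_canonical_const[of _ 0]] assms(2) by simp

lemma haar_add:
  assumes "cont f" "cont h"
  shows "haar (\<lambda>x. f x + h x) = haar f + haar h"
proof -
  have fh: "cont (\<lambda>x. f x + h x)" using assms by (intro cont_intros)
  have "norm (haar (\<lambda>x. f x + h x) - (haar f + haar h)) \<le> 0"
  proof (rule field_le_epsilon)
    fix e :: real assume "e > 0"
    then have "e / 3 > 0" by simp
    moreover have "\<forall>F\<in>set [\<lambda>x. f x + h x, f, h]. cont F" using assms fh by simp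
    ultimately obtain A where A: "A \<noteq> []" "set A \<subseteq> carrier G"
      "\<And>F x. F \<in> set [\<lambda>x. f x + h x, f, h] \<Longrightarrow> x \<in> carrier G \<Longrightarrow> norm (avg A (\<lambda>a. F (a \<otimes> x)) - haar F) \<le> e / 3"
      using haar_approx_finite by meson
    have "norm (avg A (\<lambda>a. f (a \<otimes> \<one>)) - haar f) \<le> e / 3" "norm (avg A (\<lambda>a. h (a \<otimes> \<one>)) - haar h) \<le> e / 3"
      "norm (avg A (\<lambda>a. f (a \<otimes> \<one>) + h (a \<otimes> \<one>)) - haar (\<lambda>x. f x + h x)) \<le> e / 3"
      using A(3)[of _ \<one>] by auto
    then show "norm (haar (\<lambda>x. f x + h x) - (haar f + haar h)) \<le> 0 + e"
      unfolding avg_add by norm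
  qed
  then show ?thesis by simp
qed

lemma haar_diff: "cont f \<Longrightarrow> cont h \<Longrightarrow> haar (\<lambda>x. f x - h x) = haar f - haar h"
  using haar_add[of f "\<lambda>x. (-1) * h x"] haar_cmult[of h "-1"]
  by (simp add: continuous_map_minus)

lemma haar_multc: "cont f \<Longrightarrow> haar (\<lambda>x. f x * c) = haar f * c"
  using haar_cmult[of f c] by (simp add: mult.commute)

lemma haar_sum:
  assumes "finite I" "\<And>i. i \<in> I \<Longrightarrow> cont (f i)"
  shows "haar (\<lambda>x. \<Sum>i\<in>I. f i x) = (\<Sum>i\<in>I. haar (f i))"
  using assms
proof (induction I)
  case (insert i I)
  then show ?case
    using haar_add[of "f i" "\<lambda>x. \<Sum>i\<in>I. f i x"] by (simp add: continuous_map_sum)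
qed simp

lemma haar_ge:
  assumes f: "continuous_map T euclideanreal f" and "\<And>x. x \<in> carrier G \<Longrightarrow> c \<le> f x"
  shows "complex_of_real c \<le> haar (\<lambda>x. complex_of_real (f x))"
proof -
  have f': "cont (\<lambda>x. complex_of_real (f x))" using f by (rule continuous_map_of_real)
  have "c \<le> Re (haar (\<lambda>x. complex_of_real (f x)))"
  proof (rule field_le_epsilon)
    fix e :: real assume "e > 0"
    then obtain A where A: "A \<noteq> []" "set A \<subseteq> carrier G"
      "\<And>x. x \<in> carrier G \<Longrightarrow> norm (avg A (\<lambda>a. complex_of_real (f (a \<otimes> x))) - haar (\<lambda>x. complex_of_real (f x))) \<le> e"
      using haar_approx_left[OF f'] by blast
    have "avg A (\<lambda>a. c) \<le> avg A (\<lambda>a. Re (complex_of_real (f (a \<otimes> \<one>))))"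
      using A assms(2) by (intro avg_mono_real) auto
    then have "c \<le> Re (avg A (\<lambda>a. complex_of_real (f (a \<otimes> \<one>))))"
      using A by (simp add: avg_const Re_avg)
    moreover have "\<bar>Re (avg A (\<lambda>a. complex_of_real (f (a \<otimes> \<one>))) - haar (\<lambda>x. complex_of_real (f x)))\<bar> \<le> e"
      using A(3)[OF one_closed] abs_Re_le_cmod order_trans by blast
    ultimately show "c \<le> Re (haar (\<lambda>x. complex_of_real (f x))) + e" by simp
  qed
  moreover have "Im (haar (\<lambda>x. complex_of_real (f x))) = 0"
    using haar_cnj[OF f'] by (simp add: complex_eq_iff)
  ultimately show ?thesis by (simp add: less_eq_complex_def)
qed

section \<open>Integrals depending on a parameter\<close>

lemma cont_sliceI:
  assumes "continuous_map (prod_topology Y T) euclidean (\<lambda>(y, x). F y x)" "y \<in> topspace Y"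
  shows "cont (F y)"
proof -
  have "continuous_map T (prod_topology Y T) (\<lambda>x. (y, x))"
    using assms(2) by (intro continuous_intros) auto
  from continuous_map_comp[OF this assms(1)] show ?thesis by simp
qed

lemma continuous_map_haar:
  assumes F: "continuous_map (prod_topology Y T) euclidean (\<lambda>(y, x). F y x)"
  shows "continuous_map Y euclidean (\<lambda>y. haar (F y))"
  unfolding continuous_map_euclidean_iff
proof (intro ballI allI impI)
  fix y0 and \<epsilon> :: real assume y0: "y0 \<in> topspace Y" and "\<epsilon> > 0"
  then have "\<epsilon> / 2 > 0" by simp
  then obtain U where U: "openin Y U" "y0 \<in> U"
    "\<And>y k. y \<in> U \<Longrightarrow> k \<in> topspace T \<Longrightarrow> norm (F y k - F y0 k) < \<epsilon> / 2"
    using uniformly_close_on_compact[OF compact F y0] by metis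
  have "dist (haar (F y0)) (haar (F y)) < \<epsilon>" if "y \<in> U" for y
  proof -
    have "y \<in> topspace Y" using U(1) that openin_subset by blast
    then have "norm (haar (F y) - haar (F y0)) \<le> \<epsilon> / 2"
      using U(3)[OF that] y0 by (intro norm_haar_diff_le cont_sliceI[OF F]) (auto simp: topspace_eq less_imp_le)
    then show ?thesis using \<open>\<epsilon> > 0\<close> by (simp add: dist_norm norm_minus_commute)
  qed
  with U show "\<exists>U. openin Y U \<and> y0 \<in> U \<and> (\<forall>y\<in>U. dist (haar (F y0)) (haar (F y)) < \<epsilon>)" by blast
qed

lemma cont_sum_list: "(\<And>a. a \<in> set A \<Longrightarrow> cont (F a)) \<Longrightarrow> cont (\<lambda>x. \<Sum>a\<leftarrow>A. F a x :: complex)"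
proof (induction A)
  case (Cons a A)
  then have "cont (\<lambda>x. F a x + (\<Sum>a\<leftarrow>A. F a x))" by (intro continuous_map_add) simp_all
  then show ?case by simp
qed simp

lemma haar_sum_list:
  "(\<And>a. a \<in> set A \<Longrightarrow> cont (F a)) \<Longrightarrow> haar (\<lambda>x. \<Sum>a\<leftarrow>A. F a x) = (\<Sum>a\<leftarrow>A. haar (F a))"
proof (induction A)
  case (Cons a A)
  have "haar (\<lambda>x. F a x + (\<Sum>a\<leftarrow>A. F a x)) = haar (F a) + haar (\<lambda>x. \<Sum>a\<leftarrow>A. F a x)"
    by (intro haar_add cont_sum_list Cons.prems) simp_all
  with Cons show ?case by simp
qed simp

lemma haar_avg: "(\<And>a. a \<in> set A \<Longrightarrow> cont (F a)) \<Longrightarrow> haar (\<lambda>x. avg A (\<lambda>a. F a x)) = avg A (\<lambda>a. haar (F a))"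
  unfolding avg_def divide_inverse
  using haar_multc[of "\<lambda>x. \<Sum>a\<leftarrow>A. F a x"] haar_sum_list[of A F] cont_sum_list[of A F] by simp

lemma cont_avg: "(\<And>a. a \<in> set A \<Longrightarrow> cont (F a)) \<Longrightarrow> cont (\<lambda>x. avg A (\<lambda>a. F a x) :: complex)"
  unfolding avg_def divide_inverse by (intro cont_intros cont_sum_list)

text \<open>Compactness reduces the averaging of all sections \<open>F (\<cdot>, y)\<close> to that of finitely many. One
  finite average therefore approximates the inner integral uniformly in \<open>y\<close>, and finite averages
  commute with integration.\<close>

lemma haar_Fubini:
  assumes F: "continuous_map (prod_topology T T) euclidean (\<lambda>(x, y). F x y)"
  shows "haar (\<lambda>x. haar (\<lambda>y. F x y)) = haar (\<lambda>y. haar (\<lambda>x. F x y))"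
proof -
  have F': "continuous_map (prod_topology T T) euclidean (\<lambda>(y, x). F x y)"
    using continuous_map_comp[OF _ F, of "prod_topology T T" "\<lambda>p. (snd p, fst p)"]
    by (simp add: case_prod_unfold continuous_map_pairedI continuous_map_fst continuous_map_snd)
  have K: "cont (\<lambda>x. haar (F x))" and H: "cont (\<lambda>y. haar (\<lambda>x. F x y))"
    using continuous_map_haar[OF F] continuous_map_haar[OF F'] by auto
  have c1: "cont (F x)" and c2: "cont (\<lambda>z. F z x)" if "x \<in> carrier G" for x
    using cont_sliceI[OF F] cont_sliceI[OF F'] that topspace_eq by auto
  have "left_mean (\<lambda>x. haar (F x)) (haar (\<lambda>y. haar (\<lambda>x. F x y)))"
    unfolding left_mean_def
  proof (intro allI impI)
    fix \<epsilon> :: real assume "\<epsilon> > 0"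
    then have e: "\<epsilon> / 3 > 0" by simp
    have "\<exists>U. openin T U \<and> y \<in> U \<and> (\<forall>z\<in>U. \<forall>x\<in>carrier G. norm (F x z - F x y) < \<epsilon> / 3)"
      if "y \<in> topspace T" for y
      using uniformly_close_on_compact[OF compact F' that e] unfolding topspace_eq by metis
    then obtain U where U: "\<And>y. y \<in> topspace T \<Longrightarrow> openin T (U y) \<and> y \<in> U y \<and>
        (\<forall>z\<in>U y. \<forall>x\<in>carrier G. norm (F x z - F x y) < \<epsilon> / 3)" by metis
    have "\<exists>\<F>. finite \<F> \<and> \<F> \<subseteq> U ` topspace T \<and> topspace T \<subseteq> \<Union>\<F>"
      using compact U unfolding compact_space_def by (intro compactinD) auto
    then obtain \<F> where F0: "finite \<F>" "\<F> \<subseteq> U ` topspace T" "topspace T \<subseteq> \<Union>\<F>" by blast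
    obtain D where D: "D \<subseteq> topspace T" "finite D" "\<F> = U ` D"
      using finite_subset_image[OF F0(1,2)] by blast
    obtain ys where ys: "set ys = D" using finite_list[OF D(2)] by blast
    have "\<forall>f\<in>set (map (\<lambda>y x. F x y) ys). cont f" using c2 D ys topspace_eq by auto
    from haar_approx_finite[OF this e] obtain A where A: "A \<noteq> []" "set A \<subseteq> carrier G"
      "\<And>y x. y \<in> D \<Longrightarrow> x \<in> carrier G \<Longrightarrow> norm (avg A (\<lambda>a. F (a \<otimes> x) y) - haar (\<lambda>x. F x y)) \<le> \<epsilon> / 3"
      using ys by auto
    have close: "norm (avg A (\<lambda>a. F (a \<otimes> x) y) - haar (\<lambda>x. F x y)) \<le> \<epsilon>"
      if x: "x \<in> carrier G" and y: "y \<in> carrier G" for x y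
    proof -
      obtain d where d: "d \<in> D" "y \<in> U d" using F0(3) D(3) y topspace_eq by auto
      then have dT: "d \<in> carrier G" using D(1) topspace_eq by auto
      have Fd: "norm (F z y - F z d) \<le> \<epsilon> / 3" if "z \<in> carrier G" for z
        using U[of d] d dT that topspace_eq by (auto intro: less_imp_le)
      have "norm (avg A (\<lambda>a. F (a \<otimes> x) y - F (a \<otimes> x) d)) \<le> \<epsilon> / 3"
        using A x by (intro norm_avg_le Fd) auto
      moreover have "norm (haar (\<lambda>x. F x y) - haar (\<lambda>x. F x d)) \<le> \<epsilon> / 3"
        using y dT by (intro norm_haar_diff_le c2 Fd)
      moreover have "norm (avg A (\<lambda>a. F (a \<otimes> x) d) - haar (\<lambda>x. F x d)) \<le> \<epsilon> / 3"
        using A(3)[OF d(1) x] .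
      ultimately show ?thesis unfolding avg_diff by norm
    qed
    have "norm (avg A (\<lambda>a. haar (F (a \<otimes> x))) - haar (\<lambda>y. haar (\<lambda>x. F x y))) \<le> \<epsilon>"
      if x: "x \<in> carrier G" for x
    proof -
      have c: "cont (F (a \<otimes> x))" if "a \<in> set A" for a using that A x by (intro c1) auto
      have "norm (haar (\<lambda>y. avg A (\<lambda>a. F (a \<otimes> x) y)) - haar (\<lambda>y. haar (\<lambda>x. F x y))) \<le> \<epsilon>"
        by (intro norm_haar_diff_le cont_avg c H close x)
      then show ?thesis by (simp only: haar_avg[of A "\<lambda>a. F (a \<otimes> x)", OF c])
    qed
    with A show "\<exists>A. A \<noteq> [] \<and> set A \<subseteq> carrier G \<and> (\<forall>x\<in>carrier G.
        norm (avg A (\<lambda>a. haar (F (a \<otimes> x))) - haar (\<lambda>y. haar (\<lambda>x. F x y))) \<le> \<epsilon>)" by blast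
  qed
  from haar_eqI_left[OF K this] show ?thesis .
qed

section \<open>The inner product on the continuous functions\<close>

definition ip :: "('g \<Rightarrow> complex) \<Rightarrow> ('g \<Rightarrow> complex) \<Rightarrow> complex" where
  "ip f h = haar (\<lambda>x. f x * cnj (h x))"

definition nrm2 :: "('g \<Rightarrow> complex) \<Rightarrow> real" where
  "nrm2 f = Re (ip f f)"

lemma ip_cong: "(\<And>x. x \<in> carrier G \<Longrightarrow> f x = f' x) \<Longrightarrow> (\<And>x. x \<in> carrier G \<Longrightarrow> h x = h' x) \<Longrightarrow> ip f h = ip f' h'"
  unfolding ip_def by (intro haar_cong) simp

lemma ip_cnj: "cont f \<Longrightarrow> cont h \<Longrightarrow> cnj (ip f h) = ip h f"
  unfolding ip_def by (subst haar_cnj[symmetric]) (auto intro!: cont_intros simp: mult.commute)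

lemma ip_add: "cont f \<Longrightarrow> cont f' \<Longrightarrow> cont h \<Longrightarrow> ip (\<lambda>x. f x + f' x) h = ip f h + ip f' h"
  unfolding ip_def by (subst haar_add[symmetric]) (auto intro!: cont_intros simp: algebra_simps)

lemma ip_diff: "cont f \<Longrightarrow> cont f' \<Longrightarrow> cont h \<Longrightarrow> ip (\<lambda>x. f x - f' x) h = ip f h - ip f' h"
  unfolding ip_def by (subst haar_diff[symmetric]) (auto intro!: cont_intros simp: algebra_simps)

lemma ip_cmult: "cont f \<Longrightarrow> cont h \<Longrightarrow> ip (\<lambda>x. c * f x) h = c * ip f h"
  unfolding ip_def by (subst haar_cmult[symmetric]) (auto intro!: cont_intros simp: algebra_simps)

lemma ip_sum:
  "finite I \<Longrightarrow> (\<And>i. i \<in> I \<Longrightarrow> cont (f i)) \<Longrightarrow> cont h \<Longrightarrow> ip (\<lambda>x. \<Sum>i\<in>I. f i x) h = (\<Sum>i\<in>I. ip (f i) h)"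
  unfolding ip_def sum_distrib_right by (subst haar_sum) (auto intro!: cont_intros)

lemma ip_diff_right: "cont f \<Longrightarrow> cont f' \<Longrightarrow> cont h \<Longrightarrow> ip h (\<lambda>x. f x - f' x) = ip h f - ip h f'"
  unfolding ip_def by (subst haar_diff[symmetric]) (auto intro!: cont_intros simp: algebra_simps)

lemma ip_cmult_right: "cont f \<Longrightarrow> cont h \<Longrightarrow> ip h (\<lambda>x. c * f x) = cnj c * ip h f"
  unfolding ip_def by (subst haar_cmult[symmetric]) (auto intro!: cont_intros simp: algebra_simps)

lemma ip_sum_right:
  "finite I \<Longrightarrow> (\<And>i. i \<in> I \<Longrightarrow> cont (f i)) \<Longrightarrow> cont h \<Longrightarrow> ip h (\<lambda>x. \<Sum>i\<in>I. f i x) = (\<Sum>i\<in>I. ip h (f i))"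
  unfolding ip_def cnj_sum sum_distrib_left by (subst haar_sum) (auto intro!: cont_intros)

lemma ip_ltrans:
  assumes "cont f" "cont h" "c \<in> carrier G"
  shows "ip (\<lambda>x. f (c \<otimes> x)) (\<lambda>x. h (c \<otimes> x)) = ip f h"
  unfolding ip_def using haar_ltrans[of "\<lambda>x. f x * cnj (h x)" c] assms
  by (simp add: continuous_map_algebra_mult continuous_map_cnj)

lemma ip_self_eq: "ip f f = haar (\<lambda>x. complex_of_real ((norm (f x))\<^sup>2))"
  unfolding ip_def by (simp add: complex_norm_square del: of_real_power)

lemma ip_self_ge:
  assumes "cont f" "\<And>x. x \<in> carrier G \<Longrightarrow> c \<le> (norm (f x))\<^sup>2"
  shows "complex_of_real c \<le> ip f f"
  unfolding ip_self_eq using assms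
  by (intro haar_ge) (auto simp: power2_eq_square intro!: cont_intros continuous_map_norm)

lemma ip_self: "cont f \<Longrightarrow> ip f f = complex_of_real (nrm2 f)"
  using ip_self_ge[of f 0] unfolding nrm2_def by (simp add: less_eq_complex_def complex_eq_iff)

lemma nrm2_nonneg: "cont f \<Longrightarrow> nrm2 f \<ge> 0"
  using ip_self_ge[of f 0] unfolding nrm2_def by (simp add: less_eq_complex_def)

text \<open>Finitely many translates of a nonempty open set cover the group, so a function that is nonzero
  somewhere has finitely many translates whose squares add up to a function bounded below.\<close>

lemma nrm2_eq_0:
  assumes f: "cont f" and "nrm2 f = 0" and x0: "x0 \<in> carrier G"
  shows "f x0 = 0"
proof (rule ccontr)
  assume "f x0 \<noteq> 0"
  define c where "c = norm (f x0) / 2"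
  have c: "c > 0" "c < norm (f x0)" using \<open>f x0 \<noteq> 0\<close> by (auto simp: c_def)
  define U where "U = {x \<in> topspace T. norm (f x) \<in> {c<..}}"
  have "openin T U"
    unfolding U_def by (intro openin_continuous_map_preimage[where Y = euclidean] continuous_map_norm f) simp
  moreover have "x0 \<in> U" using x0 c topspace_eq by (auto simp: U_def)
  ultimately obtain B where B: "B \<noteq> []" "set B \<subseteq> carrier G"
    "\<And>x. x \<in> carrier G \<Longrightarrow> \<exists>b\<in>set B. b \<otimes> x \<in> U"
    by (rule finite_translates_cover) blast
  define s where "s x = (\<Sum>b\<leftarrow>B. (norm (f (b \<otimes> x)))\<^sup>2)" for x
  have "continuous_map T euclideanreal s"
    unfolding s_def using B(2)
    by (induction B) (auto simp: power2_eq_square intro!: cont_intros continuous_map_norm cont_ltrans f)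
  moreover have "c\<^sup>2 \<le> s x" if x: "x \<in> carrier G" for x
  proof -
    obtain b where b: "b \<in> set B" "c < norm (f (b \<otimes> x))" using B(3)[OF x] by (auto simp: U_def)
    have "c\<^sup>2 \<le> (norm (f (b \<otimes> x)))\<^sup>2" using b c by (intro power_mono) auto
    also have "\<dots> \<le> s x"
      unfolding s_def using b(1) by (intro member_le_sum_list) auto
    finally show ?thesis .
  qed
  ultimately have "complex_of_real (c\<^sup>2) \<le> haar (\<lambda>x. complex_of_real (s x))" by (rule haar_ge)
  also have "(\<lambda>x. complex_of_real (s x)) = (\<lambda>x. \<Sum>b\<leftarrow>B. f (b \<otimes> x) * cnj (f (b \<otimes> x)))"
    unfolding s_def by (rule ext) (induction B, simp_all add: complex_norm_square del: of_real_power)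
  also have "haar \<dots> = (\<Sum>b\<leftarrow>B. haar (\<lambda>x. f (b \<otimes> x) * cnj (f (b \<otimes> x))))"
    using B by (intro haar_sum_list cont_intros cont_ltrans f) auto
  also have "\<dots> = (\<Sum>b\<leftarrow>B. 0)"
  proof (intro arg_cong[where f = sum_list] map_cong refl)
    fix b assume "b \<in> set B"
    then show "haar (\<lambda>x. f (b \<otimes> x) * cnj (f (b \<otimes> x))) = 0"
      using ip_ltrans[OF f f, of b] ip_self[OF f] assms(2) B by (auto simp: ip_def)
  qed
  finally show False using c by (simp add: less_eq_complex_def)
qed

lemma nrm2_zero_ip: "cont f \<Longrightarrow> nrm2 f = 0 \<Longrightarrow> ip h f = 0"
  using ip_cong[of h h f "\<lambda>_. 0"] nrm2_eq_0 by (simp add: ip_def)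

lemma Cauchy_Schwarz:
  assumes f: "cont f" and h: "cont h"
  shows "(norm (ip f h))\<^sup>2 \<le> nrm2 f * nrm2 h"
proof (cases "nrm2 h = 0")
  case True
  then show ?thesis using nrm2_zero_ip[OF h] by simp
next
  case False
  then have pos: "nrm2 h > 0" using nrm2_nonneg[OF h] by simp
  define c where "c = ip f h / nrm2 h"
  have ch: "cont (\<lambda>x. c * h x)" using h by (intro cont_intros)
  have "ip (\<lambda>x. f x - c * h x) (\<lambda>x. f x - c * h x)
      = ip f f - cnj c * ip f h - c * (ip h f - cnj c * ip h h)"
    using f h ch by (simp add: ip_diff ip_diff_right ip_cmult ip_cmult_right continuous_map_diff algebra_simps)
  also have "c * (ip h f - cnj c * ip h h) = 0"
    using pos by (simp add: c_def ip_self[OF h] ip_cnj[OF f h])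
  also have "cnj c * ip f h = complex_of_real ((norm (ip f h))\<^sup>2 / nrm2 h)"
    by (simp add: c_def complex_norm_square mult.commute flip: of_real_power)
  finally have "nrm2 (\<lambda>x. f x - c * h x) = nrm2 f - (norm (ip f h))\<^sup>2 / nrm2 h"
    unfolding nrm2_def by simp
  with nrm2_nonneg[OF continuous_map_diff[OF f ch]] have "(norm (ip f h))\<^sup>2 / nrm2 h \<le> nrm2 f" by simp
  with pos show ?thesis by (simp add: field_simps)
qed

text \<open>Only the first \<open>n\<close> members of the sequence \<open>u\<close> form the family, so that extending a family is a
  function update.\<close>

definition orthonormal :: "nat \<Rightarrow> (nat \<Rightarrow> 'g \<Rightarrow> complex) \<Rightarrow> bool" where
  "orthonormal n u \<longleftrightarrow> (\<forall>i<n. cont (u i)) \<and> (\<forall>i<n. \<forall>j<n. ip (u i) (u j) = (if i = j then 1 else 0))"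

definition proj :: "nat \<Rightarrow> (nat \<Rightarrow> 'g \<Rightarrow> complex) \<Rightarrow> ('g \<Rightarrow> complex) \<Rightarrow> 'g \<Rightarrow> complex" where
  "proj n u f x = (\<Sum>i<n. ip f (u i) * u i x)"

lemma cont_proj: "orthonormal n u \<Longrightarrow> cont (proj n u f)"
  unfolding orthonormal_def proj_def by (intro cont_intros) auto

lemma ip_lincomb:
  assumes "orthonormal n u" "j < n"
  shows "ip (\<lambda>x. \<Sum>i<n. c i * u i x) (u j) = c j"
proof -
  have "ip (\<lambda>x. \<Sum>i<n. c i * u i x) (u j) = (\<Sum>i<n. c i * ip (u i) (u j))"
    using assms unfolding orthonormal_def
    by (subst ip_sum) (auto simp: ip_cmult intro!: cont_intros)
  also have "\<dots> = (\<Sum>i<n. if i = j then c i else 0)"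
    using assms unfolding orthonormal_def by (intro sum.cong) auto
  finally show ?thesis using assms by simp
qed

lemma ip_residual:
  assumes "orthonormal n u" "cont f" "j < n"
  shows "ip (\<lambda>x. f x - proj n u f x) (u j) = 0"
  using assms cont_proj[OF assms(1)] ip_lincomb[OF assms(1,3)] unfolding orthonormal_def
  by (simp add: ip_diff proj_def[abs_def])

lemma Bessel:
  assumes on: "orthonormal n u" and f: "cont f"
  shows "(\<Sum>i<n. (norm (ip f (u i)))\<^sup>2) \<le> nrm2 f"
proof -
  let ?r = "\<lambda>x. f x - proj n u f x"
  have u: "cont (u i)" if "i < n" for i using on that by (simp add: orthonormal_def)
  have p: "cont (proj n u f)" and r: "cont ?r" using cont_proj[OF on] f by (auto intro: cont_intros)
  have "ip ?r (proj n u f) = (\<Sum>i<n. cnj (ip f (u i)) * ip ?r (u i))"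
    unfolding proj_def[abs_def] by (subst ip_sum_right)
      (auto simp: ip_cmult_right u r[unfolded proj_def] intro!: cont_intros u f)
  also have "\<dots> = 0" using ip_residual[OF on f] by simp
  finally have "ip ?r ?r = ip ?r f" using f p r by (simp add: ip_diff_right)
  also have "\<dots> = ip f f - ip (proj n u f) f" using f p by (simp add: ip_diff)
  also have "ip (proj n u f) f = (\<Sum>i<n. ip f (u i) * ip (u i) f)"
    unfolding proj_def[abs_def] by (subst ip_sum) (auto simp: ip_cmult u f intro!: cont_intros u f)
  also have "\<dots> = (\<Sum>i<n. complex_of_real ((norm (ip f (u i)))\<^sup>2))"
    using ip_cnj[OF f u] by (intro sum.cong) (auto simp: complex_norm_square simp del: of_real_power)
  finally have "nrm2 ?r = nrm2 f - (\<Sum>i<n. (norm (ip f (u i)))\<^sup>2)"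
    unfolding nrm2_def by (simp flip: of_real_sum)
  with nrm2_nonneg[OF r] show ?thesis by simp
qed

definition fun_space :: "('g \<Rightarrow> complex) set \<Rightarrow> bool" where
  "fun_space V \<longleftrightarrow> (\<lambda>_. 0) \<in> V \<and> (\<forall>f\<in>V. cont f) \<and>
     (\<forall>f\<in>V. \<forall>h\<in>V. (\<lambda>x. f x + h x) \<in> V) \<and> (\<forall>c. \<forall>f\<in>V. (\<lambda>x. c * f x) \<in> V)"

lemma fun_space_cont: "fun_space V \<Longrightarrow> f \<in> V \<Longrightarrow> cont f"
  by (simp add: fun_space_def)

lemma fun_space_add: "fun_space V \<Longrightarrow> f \<in> V \<Longrightarrow> h \<in> V \<Longrightarrow> (\<lambda>x. f x + h x) \<in> V"
  by (simp add: fun_space_def)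

lemma fun_space_cmult: "fun_space V \<Longrightarrow> f \<in> V \<Longrightarrow> (\<lambda>x. c * f x) \<in> V"
  by (simp add: fun_space_def)

lemma fun_space_sum:
  assumes V: "fun_space V" and "finite I" and "\<And>i. i \<in> I \<Longrightarrow> f i \<in> V"
  shows "(\<lambda>x. \<Sum>i\<in>I. c i * f i x) \<in> V"
  using assms(2,3)
proof (induction I)
  case empty
  then show ?case using V by (simp add: fun_space_def)
next
  case (insert i I)
  then have "(\<lambda>x. c i * f i x) \<in> V" "(\<lambda>x. \<Sum>i\<in>I. c i * f i x) \<in> V"
    using V by (auto simp: fun_space_def)
  then have "(\<lambda>x. c i * f i x + (\<Sum>i\<in>I. c i * f i x)) \<in> V"
    by (rule fun_space_add[OF V])
  then show ?case using insert by simp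
qed

lemma fun_space_diff:
  assumes V: "fun_space V" and "f \<in> V" "h \<in> V"
  shows "(\<lambda>x. f x - h x) \<in> V"
proof -
  have "(\<lambda>x. f x + (-1) * h x) \<in> V" using assms by (intro fun_space_add fun_space_cmult)
  then show ?thesis by simp
qed

text \<open>One step of the Gram--Schmidt process: the normalised residual of \<open>f\<close> extends the family. The
  last conclusion says that the extended family spans \<open>f\<close>.\<close>

lemma orthonormal_extend:
  assumes on: "orthonormal n u" and V: "fun_space V" and uV: "\<And>i. i < n \<Longrightarrow> u i \<in> V" and f: "f \<in> V"
    and x: "x \<in> carrier G" "f x \<noteq> proj n u f x"
  obtains v where "orthonormal (Suc n) (u(n := v))" "v \<in> V"
    "\<And>x. f x = proj n u f x + complex_of_real (sqrt (nrm2 (\<lambda>x. f x - proj n u f x))) * v x"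
proof -
  let ?r = "\<lambda>x. f x - proj n u f x"
  define s where "s = sqrt (nrm2 ?r)"
  define v where "v = (\<lambda>x. complex_of_real (inverse s) * ?r x)"
  have cf: "cont f" using V f by (simp add: fun_space_def)
  have r: "cont ?r" using cf cont_proj[OF on] by (intro cont_intros)
  have "nrm2 ?r \<noteq> 0" using nrm2_eq_0[OF r _ x(1)] x(2) by auto
  then have pos: "nrm2 ?r > 0" using nrm2_nonneg[OF r] by simp
  then have s: "s > 0" "s * s = nrm2 ?r" by (auto simp: s_def)
  have v: "cont v" unfolding v_def by (intro cont_intros cf cont_proj[OF on])
  have u: "cont (u i)" if "i < n" for i using on that by (simp add: orthonormal_def)
  have "ip v v = inverse s * (inverse s * nrm2 ?r)"
    using ip_cmult[OF r v[unfolded v_def], of "complex_of_real (inverse s)"]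
      ip_cmult_right[OF r r, of "complex_of_real (inverse s)"] ip_self[OF r]
    unfolding v_def by simp
  then have vv: "ip v v = 1" using s pos by (simp add: field_simps flip: of_real_mult)
  have vu: "ip v (u i) = 0" if "i < n" for i
    using ip_cmult[OF r u[OF that]] ip_residual[OF on cf that] unfolding v_def by simp
  have uv: "ip (u i) v = 0" if "i < n" for i
    using ip_cnj[OF v u[OF that]] vu[OF that] by simp
  have 1: "orthonormal (Suc n) (u(n := v))"
    using on v vv vu uv unfolding orthonormal_def by (auto simp: less_Suc_eq)
  have "(\<lambda>x. proj n u f x) \<in> V"
    unfolding proj_def by (intro fun_space_sum V uV) auto
  then have "?r \<in> V" using f by (intro fun_space_diff V) auto
  then have 2: "v \<in> V" unfolding v_def using V by (simp add: fun_space_def)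
  have 3: "f x = proj n u f x + complex_of_real (sqrt (nrm2 ?r)) * v x" for x
    unfolding v_def s_def[symmetric] using s by (simp flip: mult.assoc of_real_mult)
  show ?thesis using that[OF 1 2 3] .
qed

lemma orthonormal_basis_of_list:
  assumes V: "fun_space V" and "set hs \<subseteq> V"
  shows "\<exists>n u. orthonormal n u \<and> (\<forall>i<n. u i \<in> V) \<and> (\<forall>h\<in>set hs. \<forall>x\<in>carrier G. h x = proj n u h x)"
  using assms(2)
proof (induction hs)
  case Nil
  show ?case by (intro exI[of _ 0]) (simp add: orthonormal_def)
next
  case (Cons f hs)
  then obtain n u where on: "orthonormal n u" and u: "\<And>i. i < n \<Longrightarrow> u i \<in> V"
    and hs: "\<And>h x. h \<in> set hs \<Longrightarrow> x \<in> carrier G \<Longrightarrow> h x = proj n u h x" by auto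
  have f: "f \<in> V" using Cons by simp
  show ?case
  proof (cases "\<forall>x\<in>carrier G. f x = proj n u f x")
    case True
    with on u hs show ?thesis by (intro exI[of _ n] exI[of _ u]) auto
  next
    case False
    then obtain x where "x \<in> carrier G" "f x \<noteq> proj n u f x" by auto
    then obtain v where on': "orthonormal (Suc n) (u(n := v))" and v: "v \<in> V"
      and fv: "\<And>x. f x = proj n u f x + complex_of_real (sqrt (nrm2 (\<lambda>x. f x - proj n u f x))) * v x"
      using orthonormal_extend[OF on V u f] by metis
    have *: "h x = proj (Suc n) (u(n := v)) h x"
      if hc: "\<And>x. x \<in> carrier G \<Longrightarrow> h x = (\<Sum>i<Suc n. c i * (u(n := v)) i x)" and x: "x \<in> carrier G"
      for h c x
    proof -
      have "ip h ((u(n := v)) j) = c j" if "j < Suc n" for j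
        using trans[OF ip_cong[of h "\<lambda>x. \<Sum>i<Suc n. c i * (u(n := v)) i x", OF hc refl] ip_lincomb[OF on' that, of c]] .
      then have "proj (Suc n) (u(n := v)) h x = (\<Sum>i<Suc n. c i * (u(n := v)) i x)"
        unfolding proj_def by (intro sum.cong refl arg_cong2[where f = "(*)"]) simp
      with hc[OF x] show ?thesis by simp
    qed
    have "f x = proj (Suc n) (u(n := v)) f x" if "x \<in> carrier G" for x
      by (rule *[of f "\<lambda>i. if i = n then complex_of_real (sqrt (nrm2 (\<lambda>x. f x - proj n u f x))) else ip f (u i)"])
        (rule trans[OF fv], simp add: proj_def, rule that)
    moreover have "h x = proj (Suc n) (u(n := v)) h x" if "h \<in> set hs" "x \<in> carrier G" for h x
      by (rule *[of h "\<lambda>i. if i = n then 0 else ip h (u i)"])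
        (rule trans[OF hs[OF that(1)]], assumption, simp add: proj_def, rule that)
    moreover have "(u(n := v)) i \<in> V" if "i < Suc n" for i
      using u v that by (auto simp: less_Suc_eq)
    ultimately show ?thesis
      using on' unfolding set_simps by (intro exI[of _ "Suc n"] exI[of _ "u(n := v)"]) blast
  qed
qed

end

text \<open>In the application \<open>b n\<close> is the trace of a power of a positive compact operator and \<open>\<mu>\<close> its
  largest eigenvalue, so that the limit is the multiplicity of \<open>\<mu>\<close>. Log-convexity makes the
  quotients increase to \<open>\<mu>\<close>. Submultiplicativity, applied far out where the quotients are almost
  \<open>\<mu>\<close>, keeps the normalised sequence away from \<open>0\<close>.\<close>

lemma log_convex_submultiplicative_limit:
  fixes b :: "nat \<Rightarrow> real"
  assumes pos: "b 0 > 0" "b 1 > 0" and nonneg: "\<And>n. b n \<ge> 0"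
    and convex: "\<And>n. (b (Suc n))\<^sup>2 \<le> b n * b (Suc (Suc n))"
    and submult: "\<And>i j. b (Suc (i + j)) \<le> b i * b j"
  obtains \<mu> c where "\<mu> > 0" "c \<ge> 1" "(\<lambda>n. b n / \<mu> ^ Suc n) \<longlonglongrightarrow> c"
proof -
  have bpos: "b n > 0 \<and> b (Suc n) > 0" for n
  proof (induction n)
    case (Suc n)
    then have "b n * b (Suc (Suc n)) > 0"
      using convex[of n] by (smt (verit) zero_less_power)
    with Suc show ?case by (simp add: zero_less_mult_iff)
  qed (use pos in auto)
  define \<rho> where "\<rho> n = b (Suc n) / b n" for n
  have \<rho>pos: "\<rho> n > 0" for n using bpos[of n] by (simp add: \<rho>_def)
  have "incseq \<rho>"
  proof (rule incseq_SucI)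
    fix n show "\<rho> n \<le> \<rho> (Suc n)"
      using convex[of n] bpos[of n] bpos[of "Suc n"] by (simp add: \<rho>_def field_simps power2_eq_square)
  qed
  moreover have \<rho>b: "\<rho> n \<le> b 0" for n
    using submult[of n 0] bpos[of n] by (simp add: \<rho>_def field_simps)
  ultimately obtain \<mu> where lim: "\<rho> \<longlonglongrightarrow> \<mu>" and le: "\<And>n. \<rho> n \<le> \<mu>"
    by (meson incseq_convergent)
  have \<mu>: "\<mu> > 0" using le[of 0] \<rho>pos[of 0] by linarith
  define c where "c n = b n / \<mu> ^ Suc n" for n
  have cpos: "c n > 0" for n using bpos \<mu> by (simp add: c_def)
  have cSuc: "c (Suc n) = (\<rho> n / \<mu>) * c n" for n
    using bpos[of n] by (simp add: c_def \<rho>_def)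
  have "decseq c"
  proof (rule decseq_SucI)
    fix n show "c (Suc n) \<le> c n"
      unfolding cSuc using le[of n] \<mu> cpos[of n] \<rho>pos[of n]
      by (intro mult_left_le_one_le) (auto intro: less_imp_le)
  qed
  have quot: "(\<lambda>m. c (m + p) / c m) \<longlonglongrightarrow> 1" for p
  proof (induction p)
    case 0
    have "c m / c m = 1" for m using cpos[of m] by simp
    then show ?case by simp
  next
    case (Suc p)
    have t: "(\<lambda>m. \<rho> (m + p) / \<mu> * (c (m + p) / c m)) \<longlonglongrightarrow> \<mu> / \<mu> * 1"
      by (intro tendsto_mult tendsto_divide Suc LIMSEQ_ignore_initial_segment[OF lim] tendsto_const)
        (use \<mu> in simp)
    have eq: "c (m + Suc p) / c m = \<rho> (m + p) / \<mu> * (c (m + p) / c m)" for m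
      unfolding add_Suc_right cSuc by simp
    have one: "\<mu> / \<mu> * 1 = 1" using \<mu> by simp
    show ?case using t unfolding eq one .
  qed
  have ge1: "c n \<ge> 1" for n
  proof (rule LIMSEQ_le_const2[OF quot[of "Suc n"]], intro exI allI impI)
    fix m :: nat
    have "c (m + Suc n) \<le> c m * c n"
      using submult[of m n] \<mu> by (simp add: c_def divide_right_mono power_add mult.commute mult.left_commute)
    then show "c (m + Suc n) / c m \<le> c n"
      using cpos[of m] by (simp add: field_simps)
  qed
  obtain l where l: "c \<longlonglongrightarrow> l" using decseq_convergent[OF \<open>decseq c\<close>, of 1] ge1 by blast
  have "l \<ge> 1" using LIMSEQ_le_const[OF l] ge1 by blast
  with \<mu> l that show ?thesis unfolding c_def by blast
qed

context compact_group
begin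

section \<open>Convolution\<close>

lemma cont_at: "cont f \<Longrightarrow> continuous_map Y T a \<Longrightarrow> continuous_map Y euclidean (\<lambda>y. f (a y))"
  by (rule continuous_map_comp)

definition conv :: "('g \<Rightarrow> complex) \<Rightarrow> ('g \<Rightarrow> complex) \<Rightarrow> 'g \<Rightarrow> complex" where
  "conv f h x = haar (\<lambda>y. f y * h (inv y \<otimes> x))"

definition adj :: "('g \<Rightarrow> complex) \<Rightarrow> 'g \<Rightarrow> complex" where
  "adj f x = cnj (f (inv x))"

lemma cont_conv: "cont f \<Longrightarrow> cont h \<Longrightarrow> cont (conv f h)"
proof -
  assume f: "cont f" and h: "cont h"
  have "continuous_map (prod_topology T T) euclidean (\<lambda>(x, y). f y * h (inv y \<otimes> x))"
    unfolding case_prod_unfold by (intro cont_intros cont_at[OF f] cont_at[OF h] cont_group)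
  from continuous_map_haar[OF this] show "cont (conv f h)" by (simp add: conv_def[abs_def])
qed

lemma cont_adj: "cont f \<Longrightarrow> cont (adj f)"
  unfolding adj_def[abs_def] by (intro cont_intros cont_finv)

lemma conv_cong:
  assumes "\<And>x. x \<in> carrier G \<Longrightarrow> f x = f' x" "\<And>x. x \<in> carrier G \<Longrightarrow> h x = h' x" "x \<in> carrier G"
  shows "conv f h x = conv f' h' x"
  unfolding conv_def by (rule haar_cong) (simp add: assms)

text \<open>Fubini's theorem and the invariance of the mean.\<close>

lemma conv_assoc:
  assumes f: "cont f" and h: "cont h" and k: "cont k" and x: "x \<in> carrier G"
  shows "conv (conv f h) k x = conv f (conv h k) x"
proof -
  have "conv (conv f h) k x = haar (\<lambda>y. haar (\<lambda>z. f z * h (inv z \<otimes> y) * k (inv y \<otimes> x)))"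
    unfolding conv_def using x
    by (intro haar_cong haar_multc[symmetric] cont_intros f cont_at[OF h] cont_group) auto
  also have "\<dots> = haar (\<lambda>z. haar (\<lambda>y. f z * h (inv z \<otimes> y) * k (inv y \<otimes> x)))"
    unfolding case_prod_unfold using x
    by (intro haar_Fubini, unfold case_prod_unfold)
      (intro cont_intros cont_at[OF f] cont_at[OF h] cont_at[OF k] cont_group)
  also have "\<dots> = haar (\<lambda>z. f z * haar (\<lambda>y. h y * k (inv y \<otimes> (inv z \<otimes> x))))"
  proof (rule haar_cong)
    fix z assume z: "z \<in> carrier G"
    have c: "cont (\<lambda>y. h (inv z \<otimes> y) * k (inv y \<otimes> x))"
      using x z by (intro cont_intros cont_at[OF h] cont_at[OF k] cont_group) auto
    have "haar (\<lambda>y. f z * h (inv z \<otimes> y) * k (inv y \<otimes> x)) = f z * haar (\<lambda>y. h (inv z \<otimes> y) * k (inv y \<otimes> x))"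
      using haar_cmult[OF c, of "f z"] by (simp add: mult.assoc)
    also have "haar (\<lambda>y. h (inv z \<otimes> y) * k (inv y \<otimes> x))
        = haar (\<lambda>y. h (inv z \<otimes> (z \<otimes> y)) * k (inv (z \<otimes> y) \<otimes> x))"
      using haar_ltrans[OF c z] by simp
    also have "\<dots> = haar (\<lambda>y. h y * k (inv y \<otimes> (inv z \<otimes> x)))"
      using x z by (intro haar_cong) (simp add: inv_mult_group m_assoc flip: m_assoc[of "inv z" z])
    finally show "haar (\<lambda>y. f z * h (inv z \<otimes> y) * k (inv y \<otimes> x))
        = f z * haar (\<lambda>y. h y * k (inv y \<otimes> (inv z \<otimes> x)))" .
  qed
  finally show ?thesis by (simp add: conv_def)
qed

lemma adj_conv:
  assumes f: "cont f" and h: "cont h" and x: "x \<in> carrier G"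
  shows "adj (conv f h) x = conv (adj h) (adj f) x"
proof -
  let ?F = "\<lambda>y. cnj (f y) * cnj (h (inv y \<otimes> inv x))"
  have c: "cont ?F" using x by (intro cont_intros f cont_at[OF h] cont_group) auto
  have "adj (conv f h) x = haar ?F"
    unfolding adj_def conv_def using x
    by (subst haar_cnj[symmetric]) (auto intro!: cont_intros f cont_at[OF h] cont_group)
  also have "\<dots> = haar (\<lambda>y. ?F (inv x \<otimes> y))" using haar_ltrans[OF c, of "inv x"] x by simp
  also have "\<dots> = conv (adj h) (adj f) x"
    unfolding conv_def adj_def using x
    by (intro haar_cong) (simp add: inv_mult_group m_assoc)
  finally show ?thesis .
qed

lemma adj_adj: "x \<in> carrier G \<Longrightarrow> adj (adj f) x = f x"
  by (simp add: adj_def)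

lemma ip_eq_conv: "ip f h = conv f (adj h) \<one>"
  unfolding ip_def conv_def adj_def by (rule haar_cong) simp

lemma conv_eq_ip: "conv f h x = ip f (\<lambda>y. cnj (h (inv y \<otimes> x)))"
  unfolding ip_def conv_def by simp

text \<open>The function \<open>y \<mapsto> cnj (h (y\<^sup>-\<^sup>1 x))\<close> against which \<open>f\<close> is integrated in \<open>conv f h x\<close> has
  the same norm for all \<open>x\<close>. This makes convolution continuous from the mean square norm to the
  supremum norm.\<close>

lemma nrm2_reflect:
  assumes h: "cont h" and x: "x \<in> carrier G"
  shows "cont (\<lambda>y. cnj (h (inv y \<otimes> x)))" "nrm2 (\<lambda>y. cnj (h (inv y \<otimes> x))) = nrm2 h"
proof -
  let ?F = "\<lambda>y. h y * cnj (h y)"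
  have c: "cont ?F" "cont (\<lambda>y. ?F (y \<otimes> x))" using h x by (auto intro!: cont_intros cont_rtrans)
  show "cont (\<lambda>y. cnj (h (inv y \<otimes> x)))"
    using x by (intro cont_intros cont_at[OF h] cont_group)
  have "haar (\<lambda>y. ?F (inv y \<otimes> x)) = haar ?F"
    using haar_inv[OF c(2)] haar_rtrans[OF c(1) x] by simp
  then show "nrm2 (\<lambda>y. cnj (h (inv y \<otimes> x))) = nrm2 h"
    by (simp add: nrm2_def ip_def mult.commute)
qed

lemma norm_conv_le:
  assumes "cont f" "cont h" "x \<in> carrier G"
  shows "(norm (conv f h x))\<^sup>2 \<le> nrm2 f * nrm2 h"
  unfolding conv_eq_ip using Cauchy_Schwarz[OF assms(1) nrm2_reflect(1)[OF assms(2,3)]]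
  by (simp add: nrm2_reflect(2)[OF assms(2,3)])

lemma nrm2_le:
  assumes "cont f" "\<And>x. x \<in> carrier G \<Longrightarrow> (norm (f x))\<^sup>2 \<le> c"
  shows "nrm2 f \<le> c"
proof -
  have "norm (ip f f) \<le> c"
    unfolding ip_self_eq using assms
    by (intro norm_haar_le continuous_map_of_real)
      (auto simp: power2_eq_square norm_mult intro!: cont_intros continuous_map_norm)
  then show ?thesis unfolding nrm2_def using complex_Re_le_cmod order_trans by blast
qed

lemma nrm2_conv_le: "cont f \<Longrightarrow> cont h \<Longrightarrow> nrm2 (conv f h) \<le> nrm2 f * nrm2 h"
  by (intro nrm2_le cont_conv norm_conv_le)

text \<open>The index is shifted by one, because convolution has no unit among the functions:
  \<open>conv_power k n\<close> is the convolution of \<open>n + 1\<close> copies of \<open>k\<close>.\<close>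

primrec conv_power :: "('g \<Rightarrow> complex) \<Rightarrow> nat \<Rightarrow> 'g \<Rightarrow> complex" where
  "conv_power k 0 = k"
| "conv_power k (Suc n) = conv (conv_power k n) k"

lemma cont_conv_power: "cont k \<Longrightarrow> cont (conv_power k n)"
  by (induction n) (auto intro: cont_conv)

lemma conv_power_add:
  assumes k: "cont k" and x: "x \<in> carrier G"
  shows "conv (conv_power k m) (conv_power k n) x = conv_power k (Suc (m + n)) x"
  using x
proof (induction n arbitrary: x)
  case (Suc n)
  have "conv (conv_power k m) (conv_power k (Suc n)) x = conv (conv (conv_power k m) (conv_power k n)) k x"
    using k Suc by (simp add: conv_assoc cont_conv_power)
  also have "\<dots> = conv (conv_power k (Suc (m + n))) k x"
    by (intro conv_cong Suc) auto
  finally show ?case by simp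
qed simp

lemma adj_conv_power:
  assumes k: "cont k" and sa: "\<And>x. x \<in> carrier G \<Longrightarrow> adj k x = k x" and x: "x \<in> carrier G"
  shows "adj (conv_power k n) x = conv_power k n x"
  using x
proof (induction n arbitrary: x)
  case (Suc n)
  have "adj (conv_power k (Suc n)) x = conv (adj k) (adj (conv_power k n)) x"
    using k Suc by (simp add: adj_conv cont_conv_power)
  also have "\<dots> = conv (conv_power k 0) (conv_power k n) x"
    by (intro conv_cong) (use Suc sa in auto)
  also have "\<dots> = conv_power k (Suc n) x" using conv_power_add[OF k Suc.prems, of 0 n] by simp
  finally show ?case .
qed (use sa in auto)

lemma ip_conv_power:
  assumes k: "cont k" and sa: "\<And>x. x \<in> carrier G \<Longrightarrow> adj k x = k x"
  shows "ip (conv_power k m) (conv_power k n) = conv_power k (Suc (m + n)) \<one>"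
proof -
  have "ip (conv_power k m) (conv_power k n) = conv (conv_power k m) (conv_power k n) \<one>"
    unfolding ip_eq_conv by (intro conv_cong) (simp_all add: adj_conv_power[OF k sa])
  then show ?thesis using conv_power_add[OF k] by simp
qed

declare conv_power.simps(2) [simp del]

lemma conv_cmult_left: "cont f \<Longrightarrow> cont h \<Longrightarrow> x \<in> carrier G \<Longrightarrow> conv (\<lambda>y. c * f y) h x = c * conv f h x"
  unfolding conv_def by (subst haar_cmult[symmetric])
    (auto intro!: cont_intros cont_at[of h] cont_group simp: mult.assoc)

lemma conv_cmult_right: "cont f \<Longrightarrow> cont h \<Longrightarrow> x \<in> carrier G \<Longrightarrow> conv f (\<lambda>y. c * h y) x = c * conv f h x"
  unfolding conv_def by (subst haar_cmult[symmetric])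
    (auto intro!: cont_intros cont_at[of h] cont_group simp: mult.left_commute)

lemma conv_diff_left:
  "cont f \<Longrightarrow> cont f' \<Longrightarrow> cont h \<Longrightarrow> x \<in> carrier G \<Longrightarrow> conv (\<lambda>y. f y - f' y) h x = conv f h x - conv f' h x"
  unfolding conv_def by (subst haar_diff[symmetric])
    (auto intro!: cont_intros cont_at[of h] cont_group simp: algebra_simps)

lemma conv_zero_left: "conv (\<lambda>_. 0) h x = 0"
  by (simp add: conv_def)

text \<open>On the compact group the fixed factor is bounded, so uniform convergence passes through the
  integral.\<close>

lemma tendsto_conv_right:
  assumes f: "cont f" and h: "\<And>n. cont (h n)" "cont h'"
    and lim: "uniform_limit (carrier G) h h' sequentially" and x: "x \<in> carrier G"
  shows "(\<lambda>n. conv f (h n) x) \<longlonglongrightarrow> conv f h' x"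
proof (rule tendstoI)
  fix \<epsilon> :: real assume "\<epsilon> > 0"
  obtain c where c: "c > 0" "\<And>x. x \<in> topspace T \<Longrightarrow> norm (f x) \<le> c"
    using compact_space_bounded[OF compact f] by blast
  have "\<epsilon> / (2 * c) > 0" using c \<open>\<epsilon> > 0\<close> by simp
  from uniform_limitD[OF lim this]
  show "\<forall>\<^sub>F n in sequentially. dist (conv f (h n) x) (conv f h' x) < \<epsilon>"
  proof eventually_elim
    case (elim n)
    have "norm (conv f (h n) x - conv f h' x) \<le> c * (\<epsilon> / (2 * c))"
      unfolding conv_def
    proof (intro norm_haar_diff_le cont_intros f cont_at[OF h(1)] cont_at[OF h(2)] cont_group x)
      fix y assume y: "y \<in> carrier G"
      have "f y * h n (inv y \<otimes> x) - f y * h' (inv y \<otimes> x) = f y * (h n (inv y \<otimes> x) - h' (inv y \<otimes> x))"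
        by (simp add: algebra_simps)
      also have "norm \<dots> \<le> c * (\<epsilon> / (2 * c))"
        unfolding norm_mult using c elim x y \<open>\<epsilon> > 0\<close>
        by (intro mult_mono) (auto simp: topspace_eq dist_norm less_imp_le)
      finally show "norm (f y * h n (inv y \<otimes> x) - f y * h' (inv y \<otimes> x)) \<le> c * (\<epsilon> / (2 * c))" .
    qed
    then show ?case using c \<open>\<epsilon> > 0\<close> by (simp add: dist_norm)
  qed
qed

lemma tendsto_conv_left:
  assumes f: "cont f" and h: "\<And>n. cont (h n)" "cont h'"
    and lim: "uniform_limit (carrier G) h h' sequentially" and x: "x \<in> carrier G"
  shows "(\<lambda>n. conv (h n) f x) \<longlonglongrightarrow> conv h' f x"
proof (rule tendstoI)
  fix \<epsilon> :: real assume "\<epsilon> > 0"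
  obtain c where c: "c > 0" "\<And>x. x \<in> topspace T \<Longrightarrow> norm (f x) \<le> c"
    using compact_space_bounded[OF compact f] by blast
  have "\<epsilon> / (2 * c) > 0" using c \<open>\<epsilon> > 0\<close> by simp
  from uniform_limitD[OF lim this]
  show "\<forall>\<^sub>F n in sequentially. dist (conv (h n) f x) (conv h' f x) < \<epsilon>"
  proof eventually_elim
    case (elim n)
    have "norm (conv (h n) f x - conv h' f x) \<le> (\<epsilon> / (2 * c)) * c"
      unfolding conv_def
    proof (intro norm_haar_diff_le cont_intros cont_at[OF f] h cont_group x)
      fix y assume y: "y \<in> carrier G"
      have "h n y * f (inv y \<otimes> x) - h' y * f (inv y \<otimes> x) = (h n y - h' y) * f (inv y \<otimes> x)"
        by (simp add: algebra_simps)
      also have "norm \<dots> \<le> (\<epsilon> / (2 * c)) * c"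
        unfolding norm_mult using c elim x y \<open>\<epsilon> > 0\<close>
        by (intro mult_mono) (auto simp: topspace_eq dist_norm less_imp_le)
      finally show "norm (h n y * f (inv y \<otimes> x) - h' y * f (inv y \<otimes> x)) \<le> (\<epsilon> / (2 * c)) * c" .
    qed
    then show ?case using c \<open>\<epsilon> > 0\<close> by (simp add: dist_norm)
  qed
qed

text \<open>The power method. Convolution by \<open>k\<close> is a self-adjoint Hilbert--Schmidt operator, and the even
  convolution powers of \<open>k\<close>, divided by powers of the largest eigenvalue of its square, converge
  to the kernel of the orthogonal projection onto the eigenspace of this eigenvalue. The
  convergence holds first in the mean square, because all inner products are values of the
  normalised sequence of \<open>log_convex_submultiplicative_limit\<close>, and uniformly after one more
  convolution.\<close>

lemma idempotent_exists:
  assumes k: "cont k" and sa: "\<And>x. x \<in> carrier G \<Longrightarrow> adj k x = k x"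
    and nz: "x0 \<in> carrier G" "k x0 \<noteq> 0"
  obtains e where "cont e" "\<And>x. x \<in> carrier G \<Longrightarrow> conv e e x = e x"
    "\<And>x. x \<in> carrier G \<Longrightarrow> adj e x = e x" "e \<one> \<noteq> 0"
    "\<And>f x. cont f \<Longrightarrow> (\<And>y. y \<in> carrier G \<Longrightarrow> conv f k y = 0) \<Longrightarrow> x \<in> carrier G \<Longrightarrow> conv f e x = 0"
proof -
  let ?k = "conv_power k"
  have ck: "cont (?k n)" for n by (rule cont_conv_power[OF k])
  have ipk: "ip (?k m) (?k n) = ?k (Suc (m + n)) \<one>" for m n
    using k sa by (rule ip_conv_power)
  define b where "b n = nrm2 (?k n)" for n
  have b_eq: "complex_of_real (b n) = ?k (Suc (n + n)) \<one>" for n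
    using ipk[of n n] ip_self[OF ck] by (simp add: b_def)
  have b_nonneg: "b n \<ge> 0" for n unfolding b_def by (rule nrm2_nonneg[OF ck])
  have nrm2_pos: "nrm2 f > 0" if "cont f" "x \<in> carrier G" "f x \<noteq> 0" for f x
    using nrm2_nonneg[OF that(1)] nrm2_eq_0[OF that(1) _ that(2)] that(3) by (metis less_eq_real_def)
  have b0: "b 0 > 0" unfolding b_def using nrm2_pos[OF k nz] by simp
  then have "?k 1 \<one> \<noteq> 0" using b_eq[of 0] by (metis One_nat_def add_0 less_irrefl of_real_0 of_real_eq_iff)
  then have b1: "b 1 > 0" unfolding b_def by (intro nrm2_pos[OF ck, of \<one>]) auto
  have convex: "(b (Suc n))\<^sup>2 \<le> b n * b (Suc (Suc n))" for n
  proof -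
    have "ip (?k n) (?k (Suc (Suc n))) = complex_of_real (b (Suc n))"
      unfolding ipk b_eq by simp
    with Cauchy_Schwarz[OF ck ck, of n "Suc (Suc n)"] show ?thesis by (simp add: b_def)
  qed
  have submult: "b (Suc (i + j)) \<le> b i * b j" for i j
  proof -
    have "nrm2 (?k (Suc (i + j))) = nrm2 (conv (?k i) (?k j))"
      unfolding nrm2_def by (intro arg_cong[where f = Re] ip_cong) (simp_all only: conv_power_add[OF k])
    then show ?thesis using nrm2_conv_le[OF ck ck] by (simp add: b_def)
  qed
  obtain \<mu> c where \<mu>: "\<mu> > 0" and c: "c \<ge> 1" and lim: "(\<lambda>n. b n / \<mu> ^ Suc n) \<longlonglongrightarrow> c"
    using log_convex_submultiplicative_limit[OF b0 b1 b_nonneg convex submult] by metis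
  define r where "r n = b n / \<mu> ^ Suc n" for n
  (* In terms of convolution powers, E n is the power of exponent 2 (n + 1), whose operator is the (n + 1)-st
     power of the square of the operator of k. *)
  define E where "E n = (\<lambda>x. complex_of_real (inverse (\<mu> ^ Suc n)) * ?k (Suc (n + n)) x)" for n
  have cE: "cont (E n)" for n unfolding E_def by (intro cont_intros ck)
  have ipE: "ip (E i) (E j) = complex_of_real (r (Suc (i + j)))" for i j
  proof -
    have "ip (E i) (E j) = complex_of_real (inverse (\<mu> ^ Suc i)) * (complex_of_real (inverse (\<mu> ^ Suc j))
        * ip (?k (Suc (i + i))) (?k (Suc (j + j))))"
      using ip_cmult[OF ck cE[of j], of "complex_of_real (inverse (\<mu> ^ Suc i))" "Suc (i + i)"]
        ip_cmult_right[OF ck ck, of "Suc (i + i)" "complex_of_real (inverse (\<mu> ^ Suc j))" "Suc (j + j)"]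
      unfolding E_def by simp
    also have "ip (?k (Suc (i + i))) (?k (Suc (j + j))) = complex_of_real (b (Suc (i + j)))"
      unfolding ipk b_eq by (simp add: algebra_simps)
    also have "complex_of_real (inverse (\<mu> ^ Suc i)) * (complex_of_real (inverse (\<mu> ^ Suc j)) * complex_of_real (b (Suc (i + j))))
        = complex_of_real (r (Suc (i + j)))"
      using \<mu> unfolding r_def of_real_mult[symmetric] by (simp add: field_simps power_add)
    finally show ?thesis .
  qed
  have nrm2E: "nrm2 (\<lambda>x. E i x - E j x) = r (Suc (i + i)) + r (Suc (j + j)) - 2 * r (Suc (i + j))" for i j
    unfolding nrm2_def by (simp add: ip_diff ip_diff_right cE continuous_map_diff ipE add.commute)
  have r1: "r \<longlonglongrightarrow> c" using lim unfolding r_def[abs_def] .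
  have Estep: "E (Suc n) x = complex_of_real (inverse \<mu>) * conv (E n) (?k 1) x" if x: "x \<in> carrier G" for n x
  proof -
    have "conv (E n) (?k 1) x = complex_of_real (inverse (\<mu> ^ Suc n)) * conv (?k (Suc (n + n))) (?k 1) x"
      unfolding E_def by (rule conv_cmult_left[OF ck ck x])
    also have "conv (?k (Suc (n + n))) (?k 1) x = ?k (Suc (Suc n + Suc n)) x"
      by (subst conv_power_add[OF k x]) simp
    finally show ?thesis by (simp add: E_def)
  qed
  have "uniformly_Cauchy_on (carrier G) (\<lambda>n. E (Suc n))"
  proof (rule uniformly_Cauchy_onI)
    fix \<epsilon> :: real assume \<epsilon>: "\<epsilon> > 0"
    (* Passing from E n to E (Suc n) convolves with the function conv_power k 1 of squared norm b 1 and divides by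
       \<mu>, and nrm2E bounds the squared distances by 2 \<delta>: this gives \<epsilon>\<^sup>2 / 2 in the supremum norm. *)
    define \<delta> where "\<delta> = (\<epsilon> * \<mu>)\<^sup>2 / b 1 / 4"
    have \<delta>: "\<delta> > 0" using \<epsilon> \<mu> b1 by (simp add: \<delta>_def)
    then obtain N where "\<forall>n\<ge>N. norm (r n - c) < \<delta> / 2"
      using LIMSEQ_D[OF r1, of "\<delta> / 2"] by auto
    then have N: "r n < c + \<delta> / 2 \<and> c - \<delta> / 2 < r n" if "n \<ge> N" for n
      using that unfolding real_norm_def abs_less_iff by (smt (verit, best))
    have "dist (E (Suc m) x) (E (Suc n) x) < \<epsilon>" if mn: "m \<ge> N" "n \<ge> N" and x: "x \<in> carrier G" for m n x
    proof -
      have cd: "cont (\<lambda>x. E m x - E n x)" by (intro cont_intros cE)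
      have "E (Suc m) x - E (Suc n) x = complex_of_real (inverse \<mu>) * conv (\<lambda>x. E m x - E n x) (?k 1) x"
        unfolding Estep[OF x] conv_diff_left[OF cE cE ck x] by (simp add: right_diff_distrib)
      then have "(norm (E (Suc m) x - E (Suc n) x))\<^sup>2 = (inverse \<mu>)\<^sup>2 * (norm (conv (\<lambda>x. E m x - E n x) (?k 1) x))\<^sup>2"
        using \<mu> by (simp add: norm_mult power_mult_distrib norm_inverse)
      also have "\<dots> \<le> (inverse \<mu>)\<^sup>2 * (nrm2 (\<lambda>x. E m x - E n x) * b 1)"
        using norm_conv_le[OF cd ck x, of 1] unfolding b_def by (intro mult_left_mono) auto
      also have "nrm2 (\<lambda>x. E m x - E n x) \<le> 2 * \<delta>"
        unfolding nrm2E using N[of "Suc (m + m)"] N[of "Suc (n + n)"] N[of "Suc (m + n)"] mn by simp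
      then have "(inverse \<mu>)\<^sup>2 * (nrm2 (\<lambda>x. E m x - E n x) * b 1) \<le> (inverse \<mu>)\<^sup>2 * (2 * \<delta> * b 1)"
        using b1 by (intro mult_left_mono mult_right_mono) auto
      also have "\<dots> = \<epsilon>\<^sup>2 / 2" using \<mu> b1 by (simp add: \<delta>_def power2_eq_square field_simps)
      also have "\<dots> < \<epsilon>\<^sup>2" using \<epsilon> by simp
      finally show ?thesis
        using \<epsilon> by (simp add: dist_norm power2_less_imp_less)
    qed
    then show "\<exists>M. \<forall>x\<in>carrier G. \<forall>m\<ge>M. \<forall>n\<ge>M. dist (E (Suc m) x) (E (Suc n) x) < \<epsilon>" by blast
  qed
  then obtain e where e: "uniform_limit (carrier G) (\<lambda>n. E (Suc n)) e sequentially"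
    using Cauchy_uniformly_convergent unfolding uniformly_convergent_on_def by blast
  have ptw: "(\<lambda>n. E (Suc n) x) \<longlonglongrightarrow> e x" if "x \<in> carrier G" for x
    using tendsto_uniform_limitI[OF e that] .
  have ce: "cont e"
  proof -
    have "continuous_map T Met_TC.mtopology e"
    proof (rule Met_TC.continuous_map_uniform_limit[where F = sequentially and f = "\<lambda>n. E (Suc n)"])
      show "\<forall>\<^sub>F n in sequentially. continuous_map T Met_TC.mtopology (E (Suc n))"
        using cE by (simp add: mtopology_is_euclidean)
      fix \<epsilon> :: real assume "0 < \<epsilon>"
      with uniform_limitD[OF e] show "\<forall>\<^sub>F n in sequentially. \<forall>x\<in>topspace T. e x \<in> UNIV \<and> dist (E (Suc n) x) (e x) < \<epsilon>"
        by (simp add: topspace_eq)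
    qed simp
    then show ?thesis by (simp add: mtopology_is_euclidean)
  qed
  have EE: "conv (E m) (E n) x = E (Suc (m + n)) x" if x: "x \<in> carrier G" for m n x
  proof -
    have "conv (E m) (E n) x = complex_of_real (inverse (\<mu> ^ Suc m)) * (complex_of_real (inverse (\<mu> ^ Suc n))
        * conv (?k (Suc (m + m))) (?k (Suc (n + n))) x)"
      using conv_cmult_left[OF ck cE[of n] x, of "complex_of_real (inverse (\<mu> ^ Suc m))" "Suc (m + m)"]
        conv_cmult_right[OF ck ck x, of "Suc (m + m)" "complex_of_real (inverse (\<mu> ^ Suc n))" "Suc (n + n)"]
      unfolding E_def by simp
    also have "conv (?k (Suc (m + m))) (?k (Suc (n + n))) x = ?k (Suc (Suc (m + n) + Suc (m + n))) x"
      unfolding conv_power_add[OF k x] by (simp add: algebra_simps)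
    finally show ?thesis
      using \<mu> unfolding E_def by (simp add: field_simps power_add)
  qed
  have Ee: "conv (E m) e x = e x" if x: "x \<in> carrier G" for m x
  proof (rule LIMSEQ_unique)
    show "(\<lambda>n. conv (E m) (E (Suc n)) x) \<longlonglongrightarrow> conv (E m) e x"
      by (rule tendsto_conv_right[OF cE cE ce e x])
    show "(\<lambda>n. conv (E m) (E (Suc n)) x) \<longlonglongrightarrow> e x"
      using LIMSEQ_ignore_initial_segment[OF ptw[OF x], of "Suc m"] unfolding EE[OF x] by (simp add: add.commute)
  qed
  show ?thesis
  proof (rule that[OF ce])
    fix x assume x: "x \<in> carrier G"
    have "(\<lambda>n. conv (E (Suc n)) e x) \<longlonglongrightarrow> conv e e x"
      by (rule tendsto_conv_left[OF ce cE ce e x])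
    then show "conv e e x = e x" unfolding Ee[OF x] by (simp add: LIMSEQ_const_iff)
    have "adj (E n) x = E n x" for n
      using adj_conv_power[OF k sa x, of "Suc (n + n)"] unfolding E_def adj_def by simp
    moreover have "(\<lambda>n. adj (E (Suc n)) x) \<longlonglongrightarrow> adj e x"
      unfolding adj_def using x by (intro tendsto_cnj ptw) auto
    ultimately show "adj e x = e x" using LIMSEQ_unique[OF ptw[OF x]] by simp
  next
    have "(\<lambda>n. E n \<one>) = (\<lambda>n. complex_of_real (r n))"
      unfolding E_def r_def b_eq[symmetric] by (simp add: divide_inverse mult.commute)
    then have "(\<lambda>n. E (Suc n) \<one>) = (\<lambda>n. complex_of_real (r (Suc n)))" by (simp add: fun_eq_iff)
    moreover have "(\<lambda>n. complex_of_real (r (Suc n))) \<longlonglongrightarrow> complex_of_real c"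
      by (intro tendsto_of_real LIMSEQ_Suc r1)
    ultimately have "e \<one> = complex_of_real c" using LIMSEQ_unique[OF ptw[OF one_closed]] by simp
    with c show "e \<one> \<noteq> 0" by simp
  next
    fix f x assume f: "cont f" and fk: "\<And>y. y \<in> carrier G \<Longrightarrow> conv f k y = 0" and x: "x \<in> carrier G"
    have "conv f (?k (Suc n)) x = 0" for n
    proof -
      have "conv f (?k (Suc n)) x = conv f (conv k (?k n)) x"
        using conv_power_add[OF k, of _ 0 n] by (intro conv_cong x) auto
      also have "\<dots> = conv (conv f k) (?k n) x" by (rule conv_assoc[OF f k ck x, symmetric])
      also have "\<dots> = conv (\<lambda>_. 0) (?k n) x" by (intro conv_cong fk x refl)
      finally show ?thesis by (simp add: conv_zero_left)
    qed
    then have "conv f (E n) x = 0" for n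
      unfolding E_def conv_cmult_right[OF f ck x] by simp
    with tendsto_conv_right[OF f cE ce e x] show "conv f e x = 0" by (simp add: LIMSEQ_const_iff)
  qed
qed

section \<open>Finite-dimensional invariant function spaces\<close>

definition ltrans :: "'g \<Rightarrow> ('g \<Rightarrow> complex) \<Rightarrow> 'g \<Rightarrow> complex" where
  "ltrans t f = (\<lambda>x. f (inv t \<otimes> x))"

definition invariant_space :: "('g \<Rightarrow> complex) set \<Rightarrow> bool" where
  "invariant_space V \<longleftrightarrow> fun_space V \<and> (\<forall>t\<in>carrier G. \<forall>f\<in>V. ltrans t f \<in> V)"

text \<open>Dimension is measured by the size of orthonormal families, which counts functions up to equality
  on the carrier.\<close>

definition dim_at_most :: "('g \<Rightarrow> complex) set \<Rightarrow> nat \<Rightarrow> bool" where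
  "dim_at_most V N \<longleftrightarrow> (\<forall>n u. orthonormal n u \<longrightarrow> (\<forall>i<n. u i \<in> V) \<longrightarrow> n \<le> N)"

lemma dim_at_mostD:
  "dim_at_most V N \<Longrightarrow> orthonormal n u \<Longrightarrow> (\<And>i. i < n \<Longrightarrow> u i \<in> V) \<Longrightarrow> n \<le> N"
  by (simp add: dim_at_most_def)

definition moves :: "'g \<Rightarrow> ('g \<Rightarrow> complex) set \<Rightarrow> bool" where
  "moves s V \<longleftrightarrow> (\<exists>f\<in>V. \<exists>x\<in>carrier G. ltrans s f x \<noteq> f x)"

lemma cont_ltrans': "cont f \<Longrightarrow> t \<in> carrier G \<Longrightarrow> cont (ltrans t f)"
  unfolding ltrans_def by (intro cont_ltrans) auto

lemma ip_ltrans_both: "cont f \<Longrightarrow> cont h \<Longrightarrow> t \<in> carrier G \<Longrightarrow> ip (ltrans t f) (ltrans t h) = ip f h"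
  unfolding ltrans_def by (intro ip_ltrans) auto

lemma ip_ltrans_swap:
  assumes "cont f" "cont h" "t \<in> carrier G"
  shows "ip (ltrans t f) h = ip f (ltrans (inv t) h)"
proof -
  have "ip (ltrans t f) h = ip (ltrans t f) (ltrans t (ltrans (inv t) h))"
    using assms by (intro ip_cong) (simp_all add: ltrans_def flip: m_assoc)
  then show ?thesis using assms by (simp add: ip_ltrans_both cont_ltrans')
qed

text \<open>A largest orthonormal family spans, since otherwise the Gram--Schmidt step would enlarge it.\<close>

lemma orthonormal_basis:
  assumes V: "fun_space V" and N: "dim_at_most V N"
  shows "\<exists>n u. orthonormal n u \<and> (\<forall>i<n. u i \<in> V) \<and> dim_at_most V n \<and>
    (\<forall>f\<in>V. \<forall>x\<in>carrier G. f x = proj n u f x)"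
proof -
  let ?P = "\<lambda>n. \<exists>u. orthonormal n u \<and> (\<forall>i<n. u i \<in> V)"
  define n where "n = (GREATEST n. ?P n)"
  have "?P 0" by (simp add: orthonormal_def)
  moreover have bound: "\<And>m. ?P m \<Longrightarrow> m \<le> N" using N unfolding dim_at_most_def by blast
  ultimately have "?P n" unfolding n_def by (rule GreatestI_nat)
  then obtain u where u: "orthonormal n u" "\<And>i. i < n \<Longrightarrow> u i \<in> V" by blast
  have max: "m \<le> n" if "?P m" for m
    unfolding n_def using that bound by (rule Greatest_le_nat)
  have span: "f x = proj n u f x" if f: "f \<in> V" and x: "x \<in> carrier G" for f x
  proof (rule ccontr)
    assume "f x \<noteq> proj n u f x"
    from orthonormal_extend[OF u(1) V u(2) f x this] obtain v where
      "orthonormal (Suc n) (u(n := v))" "v \<in> V" by metis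
    then have "?P (Suc n)" using u(2) by (intro exI[of _ "u(n := v)"]) (auto simp: less_Suc_eq)
    from max[OF this] show False by simp
  qed
  moreover have "dim_at_most V n" using max unfolding dim_at_most_def by blast
  ultimately show ?thesis using u by blast
qed

text \<open>The functions fixed by right convolution with a continuous kernel form a finite-dimensional
  space: by Bessel's inequality the squares of an orthonormal family in it add up to at most the
  squared norm of the kernel at every point, and integrating gives the size of the family.\<close>

lemma dim_at_most_conv_fixed:
  assumes e: "cont e"
  shows "\<exists>N. dim_at_most {f. cont f \<and> (\<forall>x\<in>carrier G. conv f e x = f x)} N"
proof -
  have "real n \<le> nrm2 e" if on: "orthonormal n u"
    and fixed: "\<And>i x. i < n \<Longrightarrow> x \<in> carrier G \<Longrightarrow> conv (u i) e x = u i x" for n u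
  proof -
    have u: "cont (u i)" if "i < n" for i using on that by (simp add: orthonormal_def)
    have c: "cont (\<lambda>x. \<Sum>i<n. u i x * cnj (u i x))" by (intro cont_intros u) auto
    have "norm (haar (\<lambda>x. \<Sum>i<n. u i x * cnj (u i x))) \<le> nrm2 e"
    proof (rule norm_haar_le[OF c])
      fix x assume x: "x \<in> carrier G"
      let ?E = "\<lambda>y. cnj (e (inv y \<otimes> x))"
      have "norm (ip ?E (u i)) = norm (u i x)" if "i < n" for i
        using fixed[OF that x] ip_cnj[OF u[OF that] nrm2_reflect(1)[OF e x]]
        unfolding conv_eq_ip by (metis complex_mod_cnj)
      then have "(\<Sum>i<n. (norm (u i x))\<^sup>2) \<le> nrm2 e"
        using Bessel[OF on nrm2_reflect(1)[OF e x]] nrm2_reflect(2)[OF e x] by simp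
      moreover have "(\<Sum>i<n. u i x * cnj (u i x)) = complex_of_real (\<Sum>i<n. (norm (u i x))\<^sup>2)"
        by (simp add: complex_norm_square del: of_real_power)
      moreover have "0 \<le> (\<Sum>i<n. (norm (u i x))\<^sup>2)" by (intro sum_nonneg) simp
      ultimately show "norm (\<Sum>i<n. u i x * cnj (u i x)) \<le> nrm2 e"
        by (simp only: norm_of_real abs_of_nonneg)
    qed
    also have "haar (\<lambda>x. \<Sum>i<n. u i x * cnj (u i x)) = (\<Sum>i<n. ip (u i) (u i))"
      unfolding ip_def by (intro haar_sum cont_intros u) auto
    also have "\<dots> = of_nat n" using on unfolding orthonormal_def by simp
    finally show ?thesis by simp
  qed
  then have "dim_at_most {f. cont f \<and> (\<forall>x\<in>carrier G. conv f e x = f x)} (nat \<lfloor>nrm2 e\<rfloor>)"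
    unfolding dim_at_most_def by (auto simp: le_nat_floor)
  then show ?thesis by blast
qed

text \<open>Right convolution commutes with left translation, so the functions that it fixes form an
  invariant space.\<close>

lemma conv_ltrans:
  assumes f: "cont f" and h: "cont h" and s: "s \<in> carrier G" and x: "x \<in> carrier G"
  shows "conv (ltrans s f) h x = ltrans s (conv f h) x"
proof -
  let ?F = "\<lambda>y. f (inv s \<otimes> y) * h (inv y \<otimes> x)"
  have c: "cont ?F" using s x by (intro cont_intros cont_at[OF f] cont_at[OF h] cont_group) auto
  have "conv (ltrans s f) h x = haar (\<lambda>y. ?F (s \<otimes> y))"
    unfolding conv_def ltrans_def by (rule haar_ltrans[OF c s, symmetric])
  also have "\<dots> = ltrans s (conv f h) x"
    unfolding conv_def ltrans_def using s x
    by (intro haar_cong) (simp add: inv_mult_group m_assoc flip: m_assoc[of "inv s" s])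
  finally show ?thesis .
qed

text \<open>Start from a function that \<open>s\<close> moves and let \<open>f\<close> be the difference with its translate.
  Convolution with the idempotent of \<open>idempotent_exists\<close> for the kernel \<open>f\<^sup>* * f\<close> does not
  annihilate \<open>f\<close>, so \<open>s\<close> still moves the image of the original function in the space fixed by the
  idempotent.\<close>

lemma finite_dimensional_moved_space:
  assumes s: "s \<in> carrier G" and u: "cont u" and x0: "x0 \<in> carrier G" "ltrans s u x0 \<noteq> u x0"
  obtains V N where "invariant_space V" "dim_at_most V N" "moves s V"
proof -
  define f where "f = (\<lambda>x. ltrans s u x - u x)"
  have f: "cont f" unfolding f_def by (intro cont_intros u cont_ltrans' s)
  define k where "k = conv (adj f) f"
  have k: "cont k" unfolding k_def by (intro cont_conv cont_adj f)
  have sa: "adj k x = k x" if "x \<in> carrier G" for x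
    unfolding k_def adj_conv[OF cont_adj[OF f] f that]
    by (intro conv_cong that) (auto simp: adj_adj)
  have "k \<one> = complex_of_real (nrm2 (adj f))"
    unfolding ip_self[OF cont_adj[OF f], symmetric] ip_eq_conv k_def
    by (intro conv_cong) (auto simp: adj_adj)
  moreover have "nrm2 (adj f) \<noteq> 0"
    using nrm2_eq_0[OF cont_adj[OF f], of "inv x0"] x0 by (auto simp: adj_def f_def)
  ultimately have "k \<one> \<noteq> 0" by simp
  from idempotent_exists[OF k sa one_closed this] obtain e where e: "cont e"
    "\<And>x. x \<in> carrier G \<Longrightarrow> conv e e x = e x" "\<And>x. x \<in> carrier G \<Longrightarrow> adj e x = e x" "e \<one> \<noteq> 0"
    and ek: "\<And>h x. cont h \<Longrightarrow> (\<And>y. y \<in> carrier G \<Longrightarrow> conv h k y = 0) \<Longrightarrow> x \<in> carrier G \<Longrightarrow> conv h e x = 0"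
    by blast
  define V where "V = {h. cont h \<and> (\<forall>x\<in>carrier G. conv h e x = h x)}"
  have inV: "conv h e \<in> V" if "cont h" for h
  proof -
    have "conv (conv h e) e x = conv h e x" if "x \<in> carrier G" for x
      unfolding conv_assoc[OF \<open>cont h\<close> e(1) e(1) that] by (intro conv_cong that e(2) refl)
    then show ?thesis unfolding V_def using cont_conv[OF that e(1)] by simp
  qed
  have "fun_space V"
    unfolding fun_space_def
  proof (intro conjI ballI allI)
    show "(\<lambda>_. 0) \<in> V" by (simp add: V_def conv_zero_left)
    show "cont h" if "h \<in> V" for h using that by (simp add: V_def)
    show "(\<lambda>x. h x + h' x) \<in> V" if "h \<in> V" "h' \<in> V" for h h'
    proof -
      have hh: "cont h" "cont h'" using that by (auto simp: V_def)
      have "conv (\<lambda>x. h x - (-1) * h' x) e x = h x - (-1) * h' x" if "x \<in> carrier G" for x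
        using hh that e(1) \<open>h \<in> V\<close> \<open>h' \<in> V\<close>
          conv_diff_left[of h "\<lambda>x. (-1) * h' x" e x] conv_cmult_left[of h' e x "-1"]
        by (simp add: V_def continuous_map_minus)
      with hh show ?thesis by (simp add: V_def continuous_map_add)
    qed
    show "(\<lambda>x. c * h x) \<in> V" if "h \<in> V" for h c
      using that e(1) by (auto simp: V_def conv_cmult_left intro!: cont_intros)
  qed
  moreover have "ltrans t h \<in> V" if "t \<in> carrier G" "h \<in> V" for t h
  proof -
    have h: "cont h" using that by (simp add: V_def)
    have "conv (ltrans t h) e x = ltrans t h x" if x: "x \<in> carrier G" for x
      unfolding conv_ltrans[OF h e(1) \<open>t \<in> carrier G\<close> x] using \<open>h \<in> V\<close> \<open>t \<in> carrier G\<close> x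
      by (simp add: V_def ltrans_def)
    with cont_ltrans'[OF h that(1)] show ?thesis by (simp add: V_def)
  qed
  ultimately have "invariant_space V" unfolding invariant_space_def by blast
  moreover obtain N where "dim_at_most V N" using dim_at_most_conv_fixed[OF e(1)] unfolding V_def by blast
  moreover have "moves s V"
  proof (rule ccontr)
    assume no: "\<not> moves s V"
    have fe: "conv f e x = 0" if x: "x \<in> carrier G" for x
    proof -
      have "conv f e x = ltrans s (conv u e) x - conv u e x"
        unfolding f_def conv_diff_left[OF cont_ltrans'[OF u s] u e(1) x] conv_ltrans[OF u e(1) s x] ..
      then show ?thesis using no inV[OF u] x unfolding moves_def by auto
    qed
    have ke: "conv k e x = 0" if x: "x \<in> carrier G" for x
    proof -
      have "conv k e x = conv (adj f) (\<lambda>_. 0) x"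
        unfolding k_def conv_assoc[OF cont_adj[OF f] f e(1) x] by (intro conv_cong fe x refl)
      then show ?thesis by (simp add: conv_def)
    qed
    have "conv e k x = 0" if x: "x \<in> carrier G" for x
    proof -
      have "conv e k x = conv (adj e) (adj k) x" by (intro conv_cong x) (simp_all add: e(3) sa)
      also have "\<dots> = adj (conv k e) x" by (rule adj_conv[OF k e(1) x, symmetric])
      also have "\<dots> = 0" using ke x by (simp add: adj_def)
      finally show ?thesis .
    qed
    from ek[OF e(1) this one_closed] e(2)[OF one_closed] e(4) show False by simp
  qed
  ultimately show ?thesis using that by blast
qed

text \<open>Among the finite-dimensional invariant spaces that \<open>s\<close> moves, one of minimal dimension is
  irreducible: a nonzero invariant subspace and its orthogonal complement cannot both be smaller,
  since \<open>s\<close> would then fix both and hence their sum.\<close>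

lemma irreducible_moved_space:
  assumes s: "s \<in> carrier G" and "invariant_space V0" "dim_at_most V0 N0" "moves s V0"
  obtains V n u where "invariant_space V" "moves s V" "orthonormal n u" "\<And>i. i < n \<Longrightarrow> u i \<in> V"
    "\<And>f x. f \<in> V \<Longrightarrow> x \<in> carrier G \<Longrightarrow> f x = proj n u f x"
    "\<And>W w x. invariant_space W \<Longrightarrow> W \<subseteq> V \<Longrightarrow> w \<in> W \<Longrightarrow> x \<in> carrier G \<Longrightarrow> w x \<noteq> 0
      \<Longrightarrow> \<forall>f\<in>V. \<exists>h\<in>W. \<forall>x\<in>carrier G. f x = h x"
proof -
  let ?P = "\<lambda>n. \<exists>V. invariant_space V \<and> dim_at_most V n \<and> moves s V"
  define m where "m = (LEAST n. ?P n)"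
  have ex: "\<exists>n. ?P n" using assms(2-4) by (intro exI[of _ N0] exI[of _ V0] conjI)
  have "?P m" unfolding m_def by (rule LeastI_ex[OF ex])
  then obtain V where V: "invariant_space V" "dim_at_most V m" "moves s V" by blast
  have least: "m \<le> n" if "?P n" for n unfolding m_def using that by (rule Least_le)
  have fV: "fun_space V" using V(1) by (simp add: invariant_space_def)
  obtain n u where u: "orthonormal n u" "\<And>i. i < n \<Longrightarrow> u i \<in> V" "dim_at_most V n"
    "\<And>f x. f \<in> V \<Longrightarrow> x \<in> carrier G \<Longrightarrow> f x = proj n u f x"
    using orthonormal_basis[OF fV V(2)] by (elim exE conjE) auto
  have mn: "m = n" using least[of n] V u unfolding dim_at_most_def by (metis le_antisym)
  have "\<forall>f\<in>V. \<exists>h\<in>W. \<forall>x\<in>carrier G. f x = h x"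
    if W: "invariant_space W" "W \<subseteq> V" and w: "w \<in> W" "x0 \<in> carrier G" "w x0 \<noteq> 0" for W w x0
  proof -
    have fW: "fun_space W" using W by (simp add: invariant_space_def)
    have dW: "dim_at_most W n" using u(3) W(2) unfolding dim_at_most_def by blast
    obtain r v where v: "orthonormal r v" "\<And>i. i < r \<Longrightarrow> v i \<in> W" "dim_at_most W r"
      "\<And>f x. f \<in> W \<Longrightarrow> x \<in> carrier G \<Longrightarrow> f x = proj r v f x"
      using orthonormal_basis[OF fW dW] by (elim exE conjE) auto
    have vV: "\<And>i. i < r \<Longrightarrow> v i \<in> V" using v(2) W(2) by blast
    have projW: "proj r v f \<in> W" for f
      unfolding proj_def[abs_def] by (intro fun_space_sum[OF fW] v(2)) auto
    show ?thesis
    proof (cases "\<forall>f\<in>V. \<forall>x\<in>carrier G. f x = proj r v f x")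
      case True
      with projW show ?thesis by blast
    next
      case False
      then obtain f0 y0 where f0: "f0 \<in> V" "y0 \<in> carrier G" "f0 y0 \<noteq> proj r v f0 y0" by blast
      obtain v' where v': "orthonormal (Suc r) (v(r := v'))" "v' \<in> V"
        using orthonormal_extend[OF v(1) fV vV f0] by metis
      have "Suc r \<le> n"
        by (rule dim_at_mostD[OF u(3) v'(1)]) (auto simp: less_Suc_eq v'(2) vV)
      then have noW: "\<not> moves s W" using least[of r] W v(3) mn by auto
      define W' where "W' = {h \<in> V. \<forall>k\<in>W. ip h k = 0}"
      have cV: "cont h" if "h \<in> V" for h using fV that by (rule fun_space_cont)
      have cW: "cont h" if "h \<in> W" for h using fW that by (rule fun_space_cont)
      have fW': "fun_space W'"
        unfolding fun_space_def W'_def using fV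
        by (auto simp: fun_space_def ip_add ip_cmult cW) (simp add: ip_def)
      have "ltrans t h \<in> W'" if "t \<in> carrier G" "h \<in> W'" for t h
      proof -
        have h: "h \<in> V" "\<And>k. k \<in> W \<Longrightarrow> ip h k = 0" using that by (auto simp: W'_def)
        have "ltrans t h \<in> V" using V(1) h(1) that(1) by (simp add: invariant_space_def)
        moreover have "ip (ltrans t h) k = 0" if "k \<in> W" for k
          using ip_ltrans_swap[OF cV[OF h(1)] cW[OF that] \<open>t \<in> carrier G\<close>] h(2) W(1) that \<open>t \<in> carrier G\<close>
          by (simp add: invariant_space_def)
        ultimately show ?thesis by (simp add: W'_def)
      qed
      then have iW': "invariant_space W'" using fW' by (simp add: invariant_space_def)
      have "dim_at_most W' (n - 1)"
        unfolding dim_at_most_def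
      proof (intro allI impI)
        fix q a assume a: "orthonormal q a" "\<forall>i<q. a i \<in> W'"
        have aV: "a i \<in> V" if "i < q" for i using a that by (auto simp: W'_def)
        have "ip w (a i) = 0" if "i < q" for i
          using a that ip_cnj[OF cV[OF aV[OF that]] cW[OF w(1)]] w(1) by (auto simp: W'_def)
        then have "proj q a w x0 = 0" unfolding proj_def by simp
        then obtain b where b: "orthonormal (Suc q) (a(q := b))" "b \<in> V"
          using orthonormal_extend[OF a(1) fV aV _ w(2), of w] w W(2) by (metis subsetD)
        have "Suc q \<le> n"
          by (rule dim_at_mostD[OF u(3) b(1)]) (auto simp: less_Suc_eq b(2) aV)
        then show "q \<le> n - 1" by simp
      qed
      moreover have "n - 1 < n" using \<open>Suc r \<le> n\<close> by simp
      ultimately have noW': "\<not> moves s W'" using least[of "n - 1"] iW' mn by auto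
      obtain f x where f: "f \<in> V" "x \<in> carrier G" "ltrans s f x \<noteq> f x"
        using V(3) unfolding moves_def by blast
      let ?p = "proj r v f" and ?q = "\<lambda>x. f x - proj r v f x"
      have cp: "cont ?p" by (rule cW[OF projW])
      have "ip ?q k = 0" if "k \<in> W" for k
      proof -
        have "ip ?q k = ip ?q (\<lambda>x. \<Sum>i<r. ip k (v i) * v i x)"
          by (rule ip_cong) (simp_all add: v(4)[OF that, unfolded proj_def])
        also have "\<dots> = (\<Sum>i<r. cnj (ip k (v i)) * ip ?q (v i))"
          using cW[OF v(2)] cV[OF f(1)] cp
          by (subst ip_sum_right) (auto simp: ip_cmult_right continuous_map_diff intro!: cont_intros)
        also have "\<dots> = 0" using ip_residual[OF v(1) cV[OF f(1)]] by simp
        finally show ?thesis .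
      qed
      moreover have "?q \<in> V" using projW W(2) f(1) by (intro fun_space_diff[OF fV]) auto
      ultimately have "?q \<in> W'" by (simp add: W'_def)
      then have "ltrans s ?q x = ?q x" using noW' f(2) by (auto simp: moves_def)
      moreover have "ltrans s ?p x = ?p x" using noW f(2) projW by (auto simp: moves_def)
      ultimately have "ltrans s f x = f x" by (simp add: ltrans_def)
      with f(3) show ?thesis by simp
    qed
  qed
  note irreducible = this
  show ?thesis
  proof (rule that[OF V(1,3) u(1,2,4)], assumption+)
    show "\<forall>f\<in>V. \<exists>h\<in>W. \<forall>x\<in>carrier G. f x = h x"
      if "invariant_space W" "W \<subseteq> V" "w \<in> W" "x \<in> carrier G" "w x \<noteq> 0" for W w x
      using irreducible[OF that] .
  qed
qed

section \<open>Matrix coefficients separate the points of the group\<close>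

text \<open>In an orthonormal basis, translation acts by unitary matrices because it preserves the inner
  product. Their entries are integrals that depend continuously on the group element.\<close>

lemma representation_on_invariant_space:
  assumes V: "invariant_space V" and u: "orthonormal n u" "\<And>i. i < n \<Longrightarrow> u i \<in> V"
    and span: "\<And>f x. f \<in> V \<Longrightarrow> x \<in> carrier G \<Longrightarrow> f x = proj n u f x"
  defines "\<pi> \<equiv> \<lambda>t. mat n n (\<lambda>(i, j). ip (ltrans t (u j)) (u i))"
  shows "unitary_rep G T n \<pi>"
    "\<And>t j x. t \<in> carrier G \<Longrightarrow> j < n \<Longrightarrow> x \<in> carrier G \<Longrightarrow> ltrans t (u j) x = (\<Sum>i<n. \<pi> t $$ (i, j) * u i x)"
proof -
  have c: "cont (u i)" if "i < n" for i using u that by (simp add: orthonormal_def)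
  have LV: "ltrans t (u j) \<in> V" if "t \<in> carrier G" "j < n" for t j
    using V u(2) that by (simp add: invariant_space_def)
  show act: "ltrans t (u j) x = (\<Sum>i<n. \<pi> t $$ (i, j) * u i x)" if "t \<in> carrier G" "j < n" "x \<in> carrier G" for t j x
    using span[OF LV[OF that(1,2)] that(3)] that(2) unfolding proj_def \<pi>_def by simp
  have mult: "\<pi> (g \<otimes> h) = \<pi> g * \<pi> h" if g: "g \<in> carrier G" and h: "h \<in> carrier G" for g h
  proof (rule eq_matI)
    fix i j assume "i < dim_row (\<pi> g * \<pi> h)" "j < dim_col (\<pi> g * \<pi> h)"
    then have ij: "i < n" "j < n" by (auto simp: \<pi>_def)
    have "\<pi> (g \<otimes> h) $$ (i, j) = ip (ltrans (g \<otimes> h) (u j)) (u i)" using ij by (simp add: \<pi>_def)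
    also have "\<dots> = ip (\<lambda>x. \<Sum>k<n. \<pi> h $$ (k, j) * ltrans g (u k) x) (u i)"
    proof (rule ip_cong)
      fix x assume x: "x \<in> carrier G"
      have "ltrans (g \<otimes> h) (u j) x = ltrans h (u j) (inv g \<otimes> x)"
        using g h x by (simp add: ltrans_def inv_mult_group m_assoc)
      also have "\<dots> = (\<Sum>k<n. \<pi> h $$ (k, j) * u k (inv g \<otimes> x))"
        using g h x ij by (intro act) auto
      finally show "ltrans (g \<otimes> h) (u j) x = (\<Sum>k<n. \<pi> h $$ (k, j) * ltrans g (u k) x)"
        by (simp add: ltrans_def)
    qed simp
    also have "\<dots> = (\<Sum>k<n. \<pi> h $$ (k, j) * ip (ltrans g (u k)) (u i))"
      using g ij by (subst ip_sum) (auto simp: ip_cmult c cont_ltrans' intro!: cont_intros cont_ltrans' c)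
    also have "\<dots> = (\<Sum>k<n. \<pi> g $$ (i, k) * \<pi> h $$ (k, j))"
      using ij by (intro sum.cong) (auto simp: \<pi>_def)
    also have "\<dots> = (\<pi> g * \<pi> h) $$ (i, j)"
      using ij by (simp add: \<pi>_def scalar_prod_def lessThan_atLeast0)
    finally show "\<pi> (g \<otimes> h) $$ (i, j) = (\<pi> g * \<pi> h) $$ (i, j)" .
  qed (auto simp: \<pi>_def)
  have "\<pi> \<one> = 1\<^sub>m n"
  proof (rule eq_matI)
    fix i j assume "i < dim_row (1\<^sub>m n :: complex mat)" "j < dim_col (1\<^sub>m n :: complex mat)"
    then have ij: "i < n" "j < n" by auto
    have "ip (ltrans \<one> (u j)) (u i) = ip (u j) (u i)" by (rule ip_cong) (simp_all add: ltrans_def)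
    then show "\<pi> \<one> $$ (i, j) = (1\<^sub>m n :: complex mat) $$ (i, j)"
      using ij u(1) by (simp add: \<pi>_def orthonormal_def)
  qed (auto simp: \<pi>_def)
  moreover have "map_mat cnj (transpose_mat (\<pi> g)) = \<pi> (inv g)" if g: "g \<in> carrier G" for g
  proof (rule eq_matI)
    fix i j assume "i < dim_row (\<pi> (inv g))" "j < dim_col (\<pi> (inv g))"
    then have ij: "i < n" "j < n" by (auto simp: \<pi>_def)
    have "cnj (ip (ltrans g (u i)) (u j)) = ip (u j) (ltrans g (u i))"
      using ij g by (intro ip_cnj cont_ltrans' c)
    also have "\<dots> = ip (ltrans (inv g) (u j)) (u i)"
      using ip_ltrans_swap[of "u j" "u i" "inv g"] ij g c by simp
    finally show "map_mat cnj (transpose_mat (\<pi> g)) $$ (i, j) = \<pi> (inv g) $$ (i, j)"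
      using ij by (simp add: \<pi>_def)
  qed (auto simp: \<pi>_def)
  ultimately have "\<pi> g * map_mat cnj (transpose_mat (\<pi> g)) = 1\<^sub>m n" if "g \<in> carrier G" for g
    using mult[of g "inv g"] that by simp
  moreover have "cont (\<lambda>g. \<pi> g $$ (i, j))" if "i < n" "j < n" for i j
  proof -
    have "continuous_map (prod_topology T T) euclidean (\<lambda>(t, x). u j (inv t \<otimes> x) * cnj (u i x))"
      unfolding case_prod_unfold using that
      by (intro cont_intros cont_at[OF c[of j]] cont_at[OF c[of i]] cont_group)
    from continuous_map_haar[OF this] that show ?thesis
      by (simp add: \<pi>_def ip_def ltrans_def)
  qed
  ultimately show "unitary_rep G T n \<pi>"
    unfolding unitary_rep_def using mult by (auto simp: \<pi>_def)
qed

text \<open>Urysohn's lemma gives a function that \<open>s\<close> moves, hence an irreducible finite-dimensional space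
  of functions that \<open>s\<close> moves. The matrices of its representation cannot be equal at \<open>s\<close> and at
  the identity. An invariant subspace \<open>W\<close> of coordinate vectors corresponds to an invariant
  subspace \<open>W'\<close> of functions, so the representation is irreducible.\<close>

lemma matrix_coefficients_separate:
  assumes s: "s \<in> carrier G" "s \<noteq> \<one>"
  shows "\<exists>h\<in>matrix_coefficients G T. h s \<noteq> h \<one>"
proof -
  have "normal_space T" using compact Hausdorff compact_Hausdorff_or_regular_imp_normal_space by blast
  moreover have "closedin T {inv s}" "closedin T {\<one>}"
    using Hausdorff s by (auto intro!: closedin_Hausdorff_singleton simp: topspace_eq)
  moreover have "disjnt {inv s} {\<one>}" using s inv_eq_1_iff by (auto simp: disjnt_def)
  ultimately obtain v :: "'g \<Rightarrow> real" where v: "continuous_map T euclideanreal v" "v ` {inv s} \<subseteq> {0}" "v ` {\<one>} \<subseteq> {1}"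
    by (rule Urysohn_lemma_alt)
  define u0 where "u0 x = complex_of_real (v x)" for x
  have u0: "cont u0" unfolding u0_def[abs_def] by (rule continuous_map_of_real[OF v(1)])
  have "ltrans s u0 \<one> \<noteq> u0 \<one>" using v s by (simp add: u0_def ltrans_def)
  from finite_dimensional_moved_space[OF s(1) u0 one_closed this]
  obtain V0 N0 where V0: "invariant_space V0" "dim_at_most V0 N0" "moves s V0" by blast
  show ?thesis
  proof (rule irreducible_moved_space[OF s(1) V0])
    fix V n u
    assume V: "invariant_space V" "moves s V" and u: "orthonormal n u" "\<And>i. i < n \<Longrightarrow> u i \<in> V"
    and span: "\<And>f x. f \<in> V \<Longrightarrow> x \<in> carrier G \<Longrightarrow> f x = proj n u f x"
    and irr: "\<And>W w x. invariant_space W \<Longrightarrow> W \<subseteq> V \<Longrightarrow> w \<in> W \<Longrightarrow> x \<in> carrier G \<Longrightarrow> w x \<noteq> 0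
      \<Longrightarrow> \<forall>f\<in>V. \<exists>h\<in>W. \<forall>x\<in>carrier G. f x = h x"
  define \<pi> where "\<pi> = (\<lambda>t. mat n n (\<lambda>(i, j). ip (ltrans t (u j)) (u i)))"
  have rep1: "unitary_rep G T n \<pi>"
    unfolding \<pi>_def using V(1) u span by (rule representation_on_invariant_space(1))
  have rep2: "ltrans t (u j) x = (\<Sum>i<n. \<pi> t $$ (i, j) * u i x)"
    if "t \<in> carrier G" "j < n" "x \<in> carrier G" for t j x
    unfolding \<pi>_def using V(1) u span that by (rule representation_on_invariant_space(2))
  have fV: "fun_space V" using V(1) by (simp add: invariant_space_def)
  have lin: "(\<lambda>x. \<Sum>j<n. w j * u j x) \<in> V" for w by (intro fun_space_sum[OF fV] u(2)) auto
  have \<pi>c: "\<pi> t \<in> carrier_mat n n" for t by (simp add: \<pi>_def)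
  have nonzero_move: "\<exists>i<n. \<exists>j<n. \<pi> s $$ (i, j) \<noteq> \<pi> \<one> $$ (i, j)"
  proof (rule ccontr)
    assume "\<not> ?thesis"
    then have eq: "\<pi> s $$ (i, j) = \<pi> \<one> $$ (i, j)" if "i < n" "j < n" for i j using that by blast
    have uj: "ltrans s (u j) x = u j x" if "j < n" "x \<in> carrier G" for j x
    proof -
      have "ltrans s (u j) x = ltrans \<one> (u j) x"
        unfolding rep2[OF s(1) that] rep2[OF one_closed that] using eq that by (intro sum.cong) auto
      then show ?thesis using that by (simp add: ltrans_def)
    qed
    obtain f x where f: "f \<in> V" "x \<in> carrier G" "ltrans s f x \<noteq> f x" using V(2) by (auto simp: moves_def)
    have "ltrans s f x = proj n u f (inv s \<otimes> x)"
      unfolding ltrans_def using f s by (intro span) auto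
    also have "\<dots> = proj n u f x"
      unfolding proj_def using uj f(2) by (intro sum.cong) (auto simp: ltrans_def)
    also have "\<dots> = f x" using span[OF f(1,2)] by simp
    finally show False using f(3) by simp
  qed
  have "irreducible_rep G n \<pi>"
    unfolding irreducible_rep_def
  proof (intro conjI allI impI)
    show "0 < n" using nonzero_move by auto
    fix W assume W: "submodule W complex_ring (module_vec TYPE(complex) n)"
      and inv: "\<forall>g\<in>carrier G. \<forall>w\<in>W. \<pi> g *\<^sub>v w \<in> W"
    have sg: "subgroup W (add_monoid (module_vec TYPE(complex) n))" using W by (simp add: submodule_def)
    have Wc: "W \<subseteq> carrier_vec n" using subgroup.subset[OF sg] by (simp add: module_vec_def)
    have W0: "0\<^sub>v n \<in> W" using subgroup.one_closed[OF sg] by (simp add: module_vec_def)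
    have Wadd: "a + b \<in> W" if "a \<in> W" "b \<in> W" for a b
      using subgroup.m_closed[OF sg that] by (simp add: module_vec_def)
    have Wsm: "c \<cdot>\<^sub>v a \<in> W" if "a \<in> W" for a c
      using submodule.smult_closed[OF W, of c a] that by (simp add: module_vec_def complex_ring_def)
    show "W = {0\<^sub>v n} \<or> W = carrier_vec n"
    proof (cases "W = {0\<^sub>v n}")
      case False
      then obtain w0 where w0: "w0 \<in> W" "w0 \<noteq> 0\<^sub>v n" using W0 by blast
      define F where "F w = (\<lambda>x. \<Sum>j<n. w $ j * u j x)" for w :: "complex vec"
      define W' where "W' = {h \<in> V. \<exists>w\<in>W. \<forall>x\<in>carrier G. h x = F w x}"
      have FV: "F w \<in> V" for w unfolding F_def by (rule lin)
      have "fun_space W'"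
        unfolding fun_space_def
      proof (intro conjI ballI allI)
        show "(\<lambda>_. 0) \<in> W'"
          using fV W0 by (auto simp: W'_def fun_space_def F_def intro!: bexI[of _ "0\<^sub>v n"])
        show "cont h" if "h \<in> W'" for h using that fV by (auto simp: W'_def fun_space_def)
        show "(\<lambda>x. h x + h' x) \<in> W'" if hh: "h \<in> W'" "h' \<in> W'" for h h'
        proof -
          obtain w w' where w: "w \<in> W" "\<And>x. x \<in> carrier G \<Longrightarrow> h x = F w x"
            and w': "w' \<in> W" "\<And>x. x \<in> carrier G \<Longrightarrow> h' x = F w' x" using hh by (auto simp: W'_def)
          have "F (w + w') x = F w x + F w' x" for x
            unfolding F_def sum.distrib[symmetric] using subsetD[OF Wc w(1)] subsetD[OF Wc w'(1)]
            by (intro sum.cong) (auto simp: distrib_right)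
          then have "\<forall>x\<in>carrier G. h x + h' x = F (w + w') x" using w(2) w'(2) by simp
          moreover have "(\<lambda>x. h x + h' x) \<in> V" using hh by (intro fun_space_add[OF fV]) (auto simp: W'_def)
          ultimately show ?thesis using Wadd[OF w(1) w'(1)] unfolding W'_def by blast
        qed
        show "(\<lambda>x. c * h x) \<in> W'" if hh: "h \<in> W'" for h c
        proof -
          obtain w where w: "w \<in> W" "\<And>x. x \<in> carrier G \<Longrightarrow> h x = F w x" using hh by (auto simp: W'_def)
          have "F (c \<cdot>\<^sub>v w) x = c * F w x" for x
            unfolding F_def sum_distrib_left using subsetD[OF Wc w(1)]
            by (intro sum.cong) (auto simp: mult.assoc)
          then have "\<forall>x\<in>carrier G. c * h x = F (c \<cdot>\<^sub>v w) x" using w(2) by simp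
          moreover have "(\<lambda>x. c * h x) \<in> V" using hh by (intro fun_space_cmult[OF fV]) (auto simp: W'_def)
          ultimately show ?thesis using Wsm[OF w(1)] unfolding W'_def by blast
        qed
      qed
      moreover have "ltrans t h \<in> W'" if t: "t \<in> carrier G" and h: "h \<in> W'" for t h
      proof -
        obtain w where w: "w \<in> W" "\<And>x. x \<in> carrier G \<Longrightarrow> h x = F w x" using h by (auto simp: W'_def)
        have "ltrans t h x = F (\<pi> t *\<^sub>v w) x" if x: "x \<in> carrier G" for x
        proof -
          have "ltrans t h x = (\<Sum>j<n. w $ j * ltrans t (u j) x)"
            using w(2) t x by (simp add: ltrans_def F_def)
          also have "\<dots> = (\<Sum>j<n. \<Sum>i<n. w $ j * (\<pi> t $$ (i, j) * u i x))"
            using rep2[OF t _ x] by (intro sum.cong) (auto simp: sum_distrib_left)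
          also have "\<dots> = (\<Sum>i<n. \<Sum>j<n. w $ j * (\<pi> t $$ (i, j) * u i x))" by (rule sum.swap)
          also have "\<dots> = F (\<pi> t *\<^sub>v w) x"
            unfolding F_def using subsetD[OF Wc w(1)] \<pi>c[of t]
            by (intro sum.cong refl) (auto simp: scalar_prod_def sum_distrib_left lessThan_atLeast0 mult_ac)
          finally show ?thesis .
        qed
        moreover have "ltrans t h \<in> V" using V(1) h t by (auto simp: W'_def invariant_space_def)
        ultimately show ?thesis using inv[rule_format, OF t w(1)] unfolding W'_def by blast
      qed
      ultimately have iW': "invariant_space W'" by (simp add: invariant_space_def)
      have w0W': "F w0 \<in> W'" using w0 FV by (auto simp: W'_def)
      have coord: "v $ j = ip (F v) (u j)" if "j < n" for v :: "complex vec" and j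
        unfolding F_def using ip_lincomb[OF u(1) that, of "\<lambda>j. v $ j"] by simp
      have "\<exists>x\<in>carrier G. F w0 x \<noteq> 0"
      proof (rule ccontr)
        assume "\<not> ?thesis"
        then have "ip (F w0) (u j) = ip (\<lambda>_. 0) (u j)" for j by (intro ip_cong) auto
        then have "w0 $ j = 0" if "j < n" for j using coord[OF that, of w0] by (simp add: ip_def)
        then have "w0 = 0\<^sub>v n" using w0 Wc by (intro eq_vecI) auto
        with w0 show False by simp
      qed
      then obtain x where x: "x \<in> carrier G" "F w0 x \<noteq> 0" by blast
      have "W' \<subseteq> V" by (auto simp: W'_def)
      from irr[OF iW' this w0W' x] have all: "\<forall>f\<in>V. \<exists>h\<in>W'. \<forall>x\<in>carrier G. f x = h x" .
      have "v \<in> W" if v: "v \<in> carrier_vec n" for v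
      proof -
        obtain h where h: "h \<in> W'" "\<And>x. x \<in> carrier G \<Longrightarrow> F v x = h x" using all FV[of v] by blast
        then obtain w where w: "w \<in> W" "\<And>x. x \<in> carrier G \<Longrightarrow> F v x = F w x" by (auto simp: W'_def)
        have "v $ j = w $ j" if "j < n" for j
          unfolding coord[OF that] by (rule ip_cong) (simp_all add: w(2))
        then have "v = w" using v w(1) Wc by (intro eq_vecI) auto
        with w show ?thesis by simp
      qed
      with Wc show ?thesis by blast
    qed simp
  qed
  moreover obtain i j where ij: "i < n" "j < n" "\<pi> s $$ (i, j) \<noteq> \<pi> \<one> $$ (i, j)"
    using nonzero_move by blast
  ultimately have "(\<lambda>g. if g \<in> carrier G then \<pi> g $$ (i, j) else 0) \<in> matrix_coefficients G T"
    unfolding matrix_coefficients_def using rep1 by blast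
  with ij s show ?thesis by (intro bexI) auto
  qed
qed

section \<open>The algebra of matrix coefficients\<close>

abbreviation "\<O> \<equiv> coeff_algebra G T"

lemma function_subalgebra_coeff: "function_subalgebra (carrier G) \<O>"
  unfolding coeff_algebra_def by (rule hull_in) (auto simp: function_subalgebra_def)

lemma coeff_one: "indicator (carrier G) \<in> \<O>"
  using function_subalgebra_coeff by (simp add: function_subalgebra_def)

lemma coeff_add: "f \<in> \<O> \<Longrightarrow> h \<in> \<O> \<Longrightarrow> (\<lambda>x. f x + h x) \<in> \<O>"
  using function_subalgebra_coeff by (simp add: function_subalgebra_def)

lemma coeff_mult: "f \<in> \<O> \<Longrightarrow> h \<in> \<O> \<Longrightarrow> (\<lambda>x. f x * h x) \<in> \<O>"
  using function_subalgebra_coeff by (simp add: function_subalgebra_def)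

lemma coeff_cmult: "f \<in> \<O> \<Longrightarrow> (\<lambda>x. c * f x) \<in> \<O>"
  using function_subalgebra_coeff by (simp add: function_subalgebra_def)

lemma coeff_zero: "(\<lambda>_. 0) \<in> \<O>"
  using coeff_cmult[OF coeff_one, of 0] by simp

lemma coeff_matrix: "f \<in> matrix_coefficients G T \<Longrightarrow> f \<in> \<O>"
  unfolding coeff_algebra_def by (rule hull_inc)

lemma coeff_induct [consumes 1, case_names matrix one add mult cmult]:
  assumes "h \<in> \<O>" and "\<And>f. f \<in> matrix_coefficients G T \<Longrightarrow> P f" and "P (indicator (carrier G))"
    and "\<And>f h. f \<in> \<O> \<Longrightarrow> h \<in> \<O> \<Longrightarrow> P f \<Longrightarrow> P h \<Longrightarrow> P (\<lambda>x. f x + h x)"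
    and "\<And>f h. f \<in> \<O> \<Longrightarrow> h \<in> \<O> \<Longrightarrow> P f \<Longrightarrow> P h \<Longrightarrow> P (\<lambda>x. f x * h x)"
    and "\<And>f c. f \<in> \<O> \<Longrightarrow> P f \<Longrightarrow> P (\<lambda>x. c * f x)"
  shows "P h"
proof -
  have "h \<in> \<O> \<and> P h"
    using assms(1)[unfolded coeff_algebra_def]
  proof (rule hull_induct[where P = "\<lambda>h. h \<in> \<O> \<and> P h"])
    show "f \<in> \<O> \<and> P f" if "f \<in> matrix_coefficients G T" for f
      using that assms(2) coeff_matrix by blast
    show "function_subalgebra (carrier G) {h. h \<in> \<O> \<and> P h}"
      unfolding function_subalgebra_def
      using assms(3-6) by (simp add: coeff_one coeff_add coeff_mult coeff_cmult)
  qed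
  then show ?thesis ..
qed

lemma cont_indicator: "cont (indicator (carrier G) :: 'g \<Rightarrow> complex)"
  by (rule continuous_map_eq[of _ _ "\<lambda>_. 1"]) (auto simp: topspace_eq)

lemma coeff_cont: "h \<in> \<O> \<Longrightarrow> cont h"
proof (induction rule: coeff_induct)
  case (matrix f)
  then obtain n \<pi> i j where f: "f = (\<lambda>g. if g \<in> carrier G then \<pi> g $$ (i, j) else 0)"
    and \<pi>: "unitary_rep G T n \<pi>" "i < n" "j < n" unfolding matrix_coefficients_def by blast
  have "cont (\<lambda>g. \<pi> g $$ (i, j))" using \<pi> unfolding unitary_rep_def by blast
  then show ?case by (rule continuous_map_eq) (auto simp: f topspace_eq)
qed (auto intro: cont_intros cont_indicator)

lemma coeff_outside: "h \<in> \<O> \<Longrightarrow> x \<notin> carrier G \<Longrightarrow> h x = 0"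
  by (induction rule: coeff_induct) (auto simp: matrix_coefficients_def)

lemma coeff_fun_space: "fun_space \<O>"
  unfolding fun_space_def by (simp add: coeff_zero coeff_cont coeff_add coeff_cmult)

lemma coeff_sum_list: "(\<And>p. p \<in> set L \<Longrightarrow> F p \<in> \<O>) \<Longrightarrow> (\<lambda>x. \<Sum>p\<leftarrow>L. F p x) \<in> \<O>"
  by (induction L) (auto intro: coeff_zero coeff_add)

text \<open>Take the entrywise conjugate \<open>\<rho>\<close> of the representation. Conjugating vectors carries the
  subspaces that are invariant under \<open>\<rho>\<close> to those invariant under \<open>\<pi>\<close>, so \<open>\<rho>\<close> is irreducible as
  well.\<close>

lemma cnj_matrix_coefficients:
  assumes "f \<in> matrix_coefficients G T"
  shows "(\<lambda>x. cnj (f x)) \<in> matrix_coefficients G T"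
proof -
  obtain n \<pi> i j where f: "f = (\<lambda>g. if g \<in> carrier G then \<pi> g $$ (i, j) else 0)"
    and \<pi>: "unitary_rep G T n \<pi>" "irreducible_rep G n \<pi>" and ij: "i < n" "j < n"
    using assms unfolding matrix_coefficients_def by blast
  have \<pi>c: "\<pi> g \<in> carrier_mat n n" if "g \<in> carrier G" for g using \<pi>(1) that by (simp add: unitary_rep_def)
  define \<rho> where "\<rho> g = map_mat cnj (\<pi> g)" for g
  have \<rho>_entry: "\<rho> g $$ (i, j) = cnj (\<pi> g $$ (i, j))" if "g \<in> carrier G" "i < n" "j < n" for g i j
    using \<pi>c[OF that(1)] that by (simp add: \<rho>_def)
  have cnj_mult: "map_mat cnj (A * B) = map_mat cnj A * map_mat cnj B"
    if "A \<in> carrier_mat n n" "B \<in> carrier_mat n n" for A B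
    using that by (intro eq_matI) (auto simp: scalar_prod_def)
  have "unitary_rep G T n \<rho>"
    unfolding unitary_rep_def
  proof (intro conjI ballI allI impI)
    fix g assume g: "g \<in> carrier G"
    show "\<rho> g \<in> carrier_mat n n" using \<pi>c[OF g] by (simp add: \<rho>_def)
    have "\<rho> g * map_mat cnj (transpose_mat (\<rho> g)) = map_mat cnj (\<pi> g * map_mat cnj (transpose_mat (\<pi> g)))"
      using \<pi>c[OF g] by (subst cnj_mult) (auto simp: \<rho>_def intro!: arg_cong2[where f = "(*)"] eq_matI)
    also have "\<dots> = map_mat cnj (1\<^sub>m n)" using \<pi>(1) g by (simp add: unitary_rep_def)
    also have "\<dots> = 1\<^sub>m n" by (intro eq_matI) auto
    finally show "\<rho> g * map_mat cnj (transpose_mat (\<rho> g)) = 1\<^sub>m n" .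
    fix h assume h: "h \<in> carrier G"
    have "\<pi> (g \<otimes> h) = \<pi> g * \<pi> h" using \<pi>(1) g h by (simp add: unitary_rep_def)
    then show "\<rho> (g \<otimes> h) = \<rho> g * \<rho> h"
      using cnj_mult[OF \<pi>c[OF g] \<pi>c[OF h]] by (simp add: \<rho>_def)
  next
    fix i j assume ij: "i < n" "j < n"
    have "cont (\<lambda>g. \<pi> g $$ (i, j))" using \<pi>(1) ij by (simp add: unitary_rep_def)
    from continuous_map_cnj[OF this] show "cont (\<lambda>g. \<rho> g $$ (i, j))"
      by (rule continuous_map_eq) (use ij in \<open>simp add: \<rho>_entry topspace_eq\<close>)
  qed
  moreover have "irreducible_rep G n \<rho>"
    unfolding irreducible_rep_def
  proof (intro conjI allI impI)
    show "0 < n" using \<pi>(2) by (simp add: irreducible_rep_def)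
    fix W assume W: "submodule W complex_ring (module_vec TYPE(complex) n)"
      and inv: "\<forall>g\<in>carrier G. \<forall>w\<in>W. \<rho> g *\<^sub>v w \<in> W"
    let ?C = "map_vec cnj"
    have sg: "subgroup W (add_monoid (module_vec TYPE(complex) n))" using W by (simp add: submodule_def)
    have Wc: "w \<in> carrier_vec n" if "w \<in> W" for w
      using subgroup.subset[OF sg] that by (auto simp: module_vec_def)
    have CC: "?C (?C w) = w" for w by (intro eq_vecI) auto
    have "submodule (?C ` W) complex_ring (module_vec TYPE(complex) n)"
    proof (intro submodule.intro subgroup.intro submodule_axioms.intro)
      show "?C ` W \<subseteq> carrier (add_monoid (module_vec TYPE(complex) n))"
        using Wc by (auto simp: module_vec_def)
      show "\<one>\<^bsub>add_monoid (module_vec TYPE(complex) n)\<^esub> \<in> ?C ` W"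
      proof -
        have "0\<^sub>v n \<in> W" using subgroup.one_closed[OF sg] by (simp add: module_vec_def)
        moreover have "0\<^sub>v n = ?C (0\<^sub>v n)" by (intro eq_vecI) auto
        ultimately show ?thesis by (simp add: module_vec_def image_iff) blast
      qed
      show "x \<otimes>\<^bsub>add_monoid (module_vec TYPE(complex) n)\<^esub> y \<in> ?C ` W" if xy: "x \<in> ?C ` W" "y \<in> ?C ` W" for x y
      proof -
        obtain a b where ab: "a \<in> W" "b \<in> W" "x = ?C a" "y = ?C b" using xy by blast
        have "x + y = ?C (a + b)" using ab Wc[OF ab(1)] Wc[OF ab(2)] by (intro eq_vecI) auto
        moreover have "a + b \<in> W" using subgroup.m_closed[OF sg ab(1,2)] by (simp add: module_vec_def)
        ultimately show ?thesis by (simp add: module_vec_def)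
      qed
      show "inv\<^bsub>add_monoid (module_vec TYPE(complex) n)\<^esub> x \<in> ?C ` W" if x: "x \<in> ?C ` W" for x
      proof -
        obtain a where a: "a \<in> W" "x = ?C a" using x by blast
        have ac: "a \<in> carrier_vec n" using Wc[OF a(1)] .
        have "(-1) \<cdot>\<^sub>v a \<in> W"
          using submodule.smult_closed[OF W, of "-1" a] a(1) by (simp add: module_vec_def complex_ring_def)
        moreover have "inv\<^bsub>add_monoid (module_vec TYPE(complex) n)\<^esub> x = ?C ((-1) \<cdot>\<^sub>v a)"
        proof -
          have neg: "x + ?C ((-1) \<cdot>\<^sub>v a) = 0\<^sub>v n" "?C ((-1) \<cdot>\<^sub>v a) + x = 0\<^sub>v n"
            unfolding a(2) using ac by (auto intro!: eq_vecI)
          have uniq: "y = ?C ((-1) \<cdot>\<^sub>v a)" if y: "y \<in> carrier_vec n" "x + y = 0\<^sub>v n" for y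
          proof (rule eq_vecI)
            fix i assume "i < dim_vec (?C ((-1) \<cdot>\<^sub>v a))"
            then have i: "i < n" using ac by simp
            have "(x + y) $ i = 0" using y(2) i by simp
            then have "cnj (a $ i) + y $ i = 0" using i ac y(1) by (simp add: a(2))
            then show "y $ i = ?C ((-1) \<cdot>\<^sub>v a) $ i"
              using i ac by (simp add: add_eq_0_iff)
          qed (use y ac in auto)
          show ?thesis
            unfolding m_inv_def using neg uniq ac by (intro the_equality) (auto simp: module_vec_def)
        qed
        ultimately show ?thesis by simp
      qed
      show "c \<odot>\<^bsub>module_vec TYPE(complex) n\<^esub> x \<in> ?C ` W" if x: "c \<in> carrier complex_ring" "x \<in> ?C ` W" for c x
      proof -
        obtain a where a: "a \<in> W" "x = ?C a" using x by blast
        have "c \<cdot>\<^sub>v x = ?C (cnj c \<cdot>\<^sub>v a)" unfolding a by (intro eq_vecI) auto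
        moreover have "cnj c \<cdot>\<^sub>v a \<in> W"
          using submodule.smult_closed[OF W, of "cnj c" a] a(1) by (simp add: module_vec_def complex_ring_def)
        ultimately show ?thesis by (simp add: module_vec_def)
      qed
    qed
    moreover have "\<forall>g\<in>carrier G. \<forall>w\<in>?C ` W. \<pi> g *\<^sub>v w \<in> ?C ` W"
    proof (intro ballI)
      fix g v assume g: "g \<in> carrier G" and "v \<in> ?C ` W"
      then obtain w where w: "w \<in> W" "v = ?C w" by blast
      have "\<pi> g *\<^sub>v v = ?C (\<rho> g *\<^sub>v w)"
        using \<pi>c[OF g] Wc[OF w(1)] unfolding w(2) \<rho>_def by (intro eq_vecI) (auto simp: scalar_prod_def)
      with inv g w show "\<pi> g *\<^sub>v v \<in> ?C ` W" by blast
    qed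
    ultimately have "?C ` W = {0\<^sub>v n} \<or> ?C ` W = carrier_vec n"
      using \<pi>(2) unfolding irreducible_rep_def by blast
    then show "W = {0\<^sub>v n} \<or> W = carrier_vec n"
    proof
      have im: "W = ?C ` (?C ` W)" using CC by (simp add: image_comp o_def)
      {
        assume "?C ` W = {0\<^sub>v n}"
        moreover have "?C (0\<^sub>v n) = 0\<^sub>v n" by (intro eq_vecI) auto
        ultimately show ?thesis using im by simp
      next
        assume all: "?C ` W = carrier_vec n"
        have "w \<in> W" if "w \<in> carrier_vec n" for w
        proof -
          have "?C w \<in> ?C ` W" unfolding all using that by simp
          then show ?thesis using CC by (metis image_iff)
        qed
        with Wc show ?thesis by blast
      }
    qed
  qed
  moreover have "(\<lambda>x. cnj (f x)) = (\<lambda>g. if g \<in> carrier G then \<rho> g $$ (i, j) else 0)"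
    using ij by (auto simp: f \<rho>_entry)
  ultimately show ?thesis unfolding matrix_coefficients_def using ij by blast
qed

lemma coeff_cnj: "h \<in> \<O> \<Longrightarrow> (\<lambda>x. cnj (h x)) \<in> \<O>"
proof (induction rule: coeff_induct)
  case (matrix f)
  then show ?case by (intro coeff_matrix cnj_matrix_coefficients)
next
  case one
  have "(\<lambda>x. cnj (indicator (carrier G) x)) = indicator (carrier G)" by (auto simp: indicator_def)
  then show ?case using coeff_one by simp
next
  case (add f h)
  then show ?case using coeff_add by simp
next
  case (mult f h)
  then show ?case using coeff_mult by simp
next
  case (cmult f c)
  then show ?case using coeff_cmult[of "\<lambda>x. cnj (f x)" "cnj c"] by simp
qed

lemma sum_list_product:
  fixes F :: "'a \<Rightarrow> complex"
  shows "(\<Sum>p\<leftarrow>L. F p) * (\<Sum>q\<leftarrow>M. H q) = (\<Sum>(p, q)\<leftarrow>List.product L M. F p * H q)"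
  by (induction L) (simp_all add: distrib_right sum_list_const_mult o_def)

text \<open>For a matrix coefficient this is matrix multiplication, and the property passes to sums and
  products.\<close>

lemma coeff_coproduct:
  "h \<in> \<O> \<Longrightarrow> \<exists>L. set L \<subseteq> \<O> \<times> \<O> \<and>
    (\<forall>x\<in>carrier G. \<forall>y\<in>carrier G. h (x \<otimes> y) = (\<Sum>(a, b)\<leftarrow>L. a x * b y))"
proof (induction rule: coeff_induct)
  case (matrix f)
  then obtain n \<pi> i j where f: "f = (\<lambda>g. if g \<in> carrier G then \<pi> g $$ (i, j) else 0)"
    and \<pi>: "unitary_rep G T n \<pi>" "irreducible_rep G n \<pi>" and ij: "i < n" "j < n"
    unfolding matrix_coefficients_def by blast
  define c where "c i j = (\<lambda>g. if g \<in> carrier G then \<pi> g $$ (i, j) else 0)" for i j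
  have c: "c i j \<in> \<O>" if "i < n" "j < n" for i j
    using \<pi> that unfolding c_def by (intro coeff_matrix) (auto simp: matrix_coefficients_def)
  have "f (x \<otimes> y) = (\<Sum>(a, b)\<leftarrow>map (\<lambda>k. (c i k, c k j)) [0..<n]. a x * b y)"
    if x: "x \<in> carrier G" and y: "y \<in> carrier G" for x y
  proof -
    have "\<pi> (x \<otimes> y) = \<pi> x * \<pi> y" "\<pi> x \<in> carrier_mat n n" "\<pi> y \<in> carrier_mat n n"
      using \<pi>(1) x y by (auto simp: unitary_rep_def)
    then have "f (x \<otimes> y) = (\<Sum>k = 0..<n. c i k x * c k j y)"
      using x y ij by (simp add: f c_def scalar_prod_def)
    also have "\<dots> = (\<Sum>k\<leftarrow>[0..<n]. c i k x * c k j y)"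
      by (simp add: sum_list_distinct_conv_sum_set)
    finally show ?thesis by (simp add: o_def)
  qed
  then show ?case using c ij by (intro exI[of _ "map (\<lambda>k. (c i k, c k j)) [0..<n]"]) auto
next
  case one
  show ?case
    by (intro exI[of _ "[(indicator (carrier G), indicator (carrier G))]"]) (simp add: coeff_one)
next
  case (add f h)
  then obtain L M where "set L \<subseteq> \<O> \<times> \<O>" "set M \<subseteq> \<O> \<times> \<O>"
    "\<forall>x\<in>carrier G. \<forall>y\<in>carrier G. f (x \<otimes> y) = (\<Sum>(a, b)\<leftarrow>L. a x * b y)"
    "\<forall>x\<in>carrier G. \<forall>y\<in>carrier G. h (x \<otimes> y) = (\<Sum>(a, b)\<leftarrow>M. a x * b y)" by blast
  then show ?case by (intro exI[of _ "L @ M"]) simp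
next
  case (mult f h)
  then obtain L M where L: "set L \<subseteq> \<O> \<times> \<O>" and M: "set M \<subseteq> \<O> \<times> \<O>"
    and f: "\<forall>x\<in>carrier G. \<forall>y\<in>carrier G. f (x \<otimes> y) = (\<Sum>(a, b)\<leftarrow>L. a x * b y)"
    and h: "\<forall>x\<in>carrier G. \<forall>y\<in>carrier G. h (x \<otimes> y) = (\<Sum>(a, b)\<leftarrow>M. a x * b y)" by blast
  let ?P = "map (\<lambda>((a, b), (a', b')). (\<lambda>x. a x * a' x, \<lambda>x. b x * b' x)) (List.product L M)"
  have "set ?P \<subseteq> \<O> \<times> \<O>"
    using L M by (auto intro!: coeff_mult)
  moreover have "f (x \<otimes> y) * h (x \<otimes> y) = (\<Sum>(a, b)\<leftarrow>?P. a x * b y)"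
    if "x \<in> carrier G" "y \<in> carrier G" for x y
  proof -
    have "f (x \<otimes> y) * h (x \<otimes> y) = (\<Sum>(p, q)\<leftarrow>List.product L M. (case p of (a, b) \<Rightarrow> a x * b y) * (case q of (a, b) \<Rightarrow> a x * b y))"
      using f h that by (simp add: sum_list_product)
    also have "\<dots> = (\<Sum>(a, b)\<leftarrow>?P. a x * b y)"
      unfolding map_map by (intro arg_cong[where f = sum_list] map_cong refl) (auto simp: mult_ac)
    finally show ?thesis .
  qed
  ultimately show ?case by (intro exI[of _ ?P]) simp
next
  case (cmult f c)
  then obtain L where L: "set L \<subseteq> \<O> \<times> \<O>"
    and f: "\<forall>x\<in>carrier G. \<forall>y\<in>carrier G. f (x \<otimes> y) = (\<Sum>(a, b)\<leftarrow>L. a x * b y)" by blast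
  have "c * f (x \<otimes> y) = (\<Sum>(a, b)\<leftarrow>map (\<lambda>(a, b). (\<lambda>x. c * a x, b)) L. a x * b y)"
    if "x \<in> carrier G" "y \<in> carrier G" for x y
    using f that by (simp add: o_def case_prod_unfold mult.assoc sum_list_const_mult)
  moreover have "set (map (\<lambda>(a, b). (\<lambda>x. c * a x, b)) L) \<subseteq> \<O> \<times> \<O>"
    using L by (auto intro!: coeff_cmult)
  ultimately show ?case by (intro exI[of _ "map (\<lambda>(a, b). (\<lambda>x. c * a x, b)) L"]) simp
qed

text \<open>Evaluation at the identity is a linear functional on the span of finitely many coefficients. By
  the Riesz representation on this finite-dimensional space it is integration against an element
  of the coefficient algebra.\<close>

lemma evaluation_kernel:
  assumes "set hs \<subseteq> \<O>"
  obtains e where "e \<in> \<O>" "\<And>h. h \<in> set hs \<Longrightarrow> haar (\<lambda>x. h x * e x) = h \<one>"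
proof -
  obtain n u where on: "orthonormal n u" and u: "\<And>i. i < n \<Longrightarrow> u i \<in> \<O>"
    and span: "\<And>h x. h \<in> set hs \<Longrightarrow> x \<in> carrier G \<Longrightarrow> h x = proj n u h x"
    using orthonormal_basis_of_list[OF coeff_fun_space assms] by (elim exE conjE) auto
  define e where "e = (\<lambda>x. \<Sum>i<n. u i \<one> * cnj (u i x))"
  have "e \<in> \<O>"
    unfolding e_def by (intro fun_space_sum[OF coeff_fun_space] coeff_cnj u) auto
  moreover have "haar (\<lambda>x. h x * e x) = h \<one>" if "h \<in> set hs" for h
  proof -
    have h: "cont h" using assms that coeff_cont by blast
    have ch: "cont (\<lambda>x. h x * cnj (u i x))" if "i < n" for i
      by (intro cont_intros h coeff_cont u that)
    have "haar (\<lambda>x. h x * e x) = haar (\<lambda>x. \<Sum>i<n. u i \<one> * (h x * cnj (u i x)))"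
      by (simp add: e_def sum_distrib_left mult.left_commute)
    also have "\<dots> = (\<Sum>i<n. haar (\<lambda>x. u i \<one> * (h x * cnj (u i x))))"
      by (rule haar_sum) (auto intro: cont_intros ch)
    also have "\<dots> = (\<Sum>i<n. u i \<one> * ip h (u i))"
      by (intro sum.cong refl) (simp add: haar_cmult ch ip_def)
    also have "\<dots> = h \<one>"
      unfolding span[OF that one_closed] proj_def by (simp add: mult.commute)
    finally show ?thesis .
  qed
  ultimately show ?thesis using that by blast
qed

end

section \<open>Tensor products of modules of functions\<close>

definition function_subspace :: "('a \<Rightarrow> complex) set \<Rightarrow> bool" where
  "function_subspace A \<longleftrightarrow> (\<lambda>_. 0) \<in> A \<and> (\<forall>f\<in>A. \<forall>h\<in>A. (\<lambda>y. f y + h y) \<in> A) \<and> (\<forall>c. \<forall>f\<in>A. (\<lambda>y. c * f y) \<in> A)"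

lemma function_subspace_sum:
  assumes A: "function_subspace A" and "finite I" "\<And>i. i \<in> I \<Longrightarrow> f i \<in> A"
  shows "(\<lambda>y. \<Sum>i\<in>I. f i y) \<in> A"
  using assms(2,3)
proof (induction I)
  case empty
  then show ?case using A by (simp add: function_subspace_def)
next
  case (insert i I)
  then have "f i \<in> A" "(\<lambda>y. \<Sum>i\<in>I. f i y) \<in> A" by auto
  then have "(\<lambda>y. f i y + (\<Sum>i\<in>I. f i y)) \<in> A" using A by (simp add: function_subspace_def)
  then show ?case using insert by simp
qed

lemma fun_module_simps [simp]:
  "carrier (fun_module S sc A) = A"
  "f \<oplus>\<^bsub>fun_module S sc A\<^esub> h = (\<lambda>y. f y + h y)"
  "f \<otimes>\<^bsub>fun_module S sc A\<^esub> h = (\<lambda>y. f y * h y)"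
  "\<zero>\<^bsub>fun_module S sc A\<^esub> = (\<lambda>_. 0)"
  "\<one>\<^bsub>fun_module S sc A\<^esub> = indicator S"
  "r \<odot>\<^bsub>fun_module S sc A\<^esub> f = (\<lambda>y. sc r y * f y)"
  by (simp_all add: fun_module_def)

lemma abelian_group_fun_module:
  assumes A: "function_subspace A"
  shows "abelian_group (fun_module S sc A)"
proof (rule abelian_groupI)
  fix f assume "f \<in> carrier (fun_module S sc A)"
  then have "(\<lambda>y. (-1) * f y) \<in> A" using A unfolding function_subspace_def fun_module_simps by blast
  then have "(\<lambda>y. - f y) \<in> A" by simp
  then show "\<exists>h\<in>carrier (fun_module S sc A). h \<oplus>\<^bsub>fun_module S sc A\<^esub> f = \<zero>\<^bsub>fun_module S sc A\<^esub>"
    by (intro bexI[of _ "\<lambda>y. - f y"]) simp_all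
qed (use A in \<open>auto simp: function_subspace_def algebra_simps\<close>)

lemma cring_complex_ring: "cring complex_ring"
proof (rule cringI)
  show "abelian_group complex_ring"
    by (rule abelian_groupI) (auto simp: complex_ring_def algebra_simps intro: exI[of _ "- x" for x])
  show "comm_monoid complex_ring"
    by (rule comm_monoidI) (auto simp: complex_ring_def)
qed (auto simp: complex_ring_def algebra_simps)

lemma module_fun_vs:
  assumes "function_subspace A"
  shows "module complex_ring (fun_vs S A)"
  using assms
  by (intro moduleI cring_complex_ring abelian_group_fun_module)
    (auto simp: function_subspace_def complex_ring_def algebra_simps)

text \<open>The functions in \<open>B\<close> vanish outside \<open>S\<close>, so multiplication with the indicator function of \<open>S\<close> is
  the identity on them.\<close>

lemma cring_fun_module:
  assumes B: "function_subspace B" "indicator S \<in> B" "\<And>f h. f \<in> B \<Longrightarrow> h \<in> B \<Longrightarrow> (\<lambda>y. f y * h y) \<in> B"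
    and out: "\<And>f y. f \<in> B \<Longrightarrow> y \<notin> S \<Longrightarrow> f y = 0"
  shows "cring (fun_module S sc B)"
proof (rule cringI)
  have one: "(\<lambda>y. indicator S y * f y) = f" if "f \<in> B" for f
  proof
    show "indicator S y * f y = f y" for y using out[OF that, of y] by (cases "y \<in> S") auto
  qed
  show "comm_monoid (fun_module S sc B)"
    by (rule comm_monoidI) (use B one in \<open>auto simp: algebra_simps\<close>)
qed (auto simp: algebra_simps intro: abelian_group_fun_module B)

lemma module_fun_module:
  assumes R: "cring (fun_module S sc' B)"
    and A: "function_subspace A" and smult: "\<And>b f. b \<in> B \<Longrightarrow> f \<in> A \<Longrightarrow> (\<lambda>y. b y * f y) \<in> A"
    and out: "\<And>f y. f \<in> A \<Longrightarrow> y \<notin> S \<Longrightarrow> f y = 0"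
  shows "module (fun_module S sc' B) (fun_module S (\<lambda>b. b) A)"
proof (intro moduleI R abelian_group_fun_module A)
  fix f assume "f \<in> carrier (fun_module S (\<lambda>b. b) A)"
  then show "\<one>\<^bsub>fun_module S sc' B\<^esub> \<odot>\<^bsub>fun_module S (\<lambda>b. b) A\<^esub> f = f"
    using out[of f] by (intro ext) (auto simp: indicator_def)
qed (use smult in \<open>auto simp: algebra_simps\<close>)

text \<open>The tensor product of two modules of functions that are also complex vector spaces. The complex
  scalars need not act through \<open>R\<close>; they serve to absorb the integer multiplicities of formal sums
  into the left factors.\<close>

locale function_tensor =
  fixes R :: "('r, 'b) ring_scheme" and S :: "'a set" and sc and A :: "('a \<Rightarrow> complex) set"
    and S' :: "'c set" and sc' and A' :: "('c \<Rightarrow> complex) set"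
  assumes M: "module R (fun_module S sc A)" and N: "module R (fun_module S' sc' A')"
    and A: "function_subspace A" and A': "function_subspace A'"
begin

text \<open>\<open>cls c\<close> is the element of the tensor product that is represented by the formal sum \<open>c\<close>.\<close>

abbreviation "TP \<equiv> tensor_product R (fun_module S sc A) (fun_module S' sc' A')"
abbreviation "K \<equiv> tensor_kernel R (fun_module S sc A) (fun_module S' sc' A')"
abbreviation "F \<equiv> free_Abelian_group (A \<times> A')"
abbreviation "cls c \<equiv> K #>\<^bsub>F\<^esub> c"

lemma F_simps: "carrier F = {c. Poly_Mapping.keys c \<subseteq> A \<times> A'}" "a \<otimes>\<^bsub>F\<^esub> b = a + b" "\<one>\<^bsub>F\<^esub> = 0"
  by (simp_all add: free_Abelian_group_def)

lemma smult_A: "r \<in> carrier R \<Longrightarrow> f \<in> A \<Longrightarrow> (\<lambda>y. sc r y * f y) \<in> A"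
  using module.smult_closed[OF M, of r f] by simp

lemma smult_A': "r \<in> carrier R \<Longrightarrow> f \<in> A' \<Longrightarrow> (\<lambda>y. sc' r y * f y) \<in> A'"
  using module.smult_closed[OF N, of r f] by simp

lemma add_A: "f \<in> A \<Longrightarrow> h \<in> A \<Longrightarrow> (\<lambda>y. f y + h y) \<in> A"
  using A by (simp add: function_subspace_def)

lemma add_A': "f \<in> A' \<Longrightarrow> h \<in> A' \<Longrightarrow> (\<lambda>y. f y + h y) \<in> A'"
  using A' by (simp add: function_subspace_def)

lemma cmult_A: "f \<in> A \<Longrightarrow> (\<lambda>y. c * f y) \<in> A"
  using A by (simp add: function_subspace_def)

lemma relations_carrier: "tensor_relations R (fun_module S sc A) (fun_module S' sc' A') \<subseteq> carrier F"
  unfolding tensor_relations_def F_simps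
  by (auto simp: add_A add_A' smult_A smult_A' split: if_splits dest!: subsetD[OF keys_diff])

lemma K_subgroup: "subgroup K F"
  unfolding tensor_kernel_def fun_module_simps
  by (rule group.generate_is_subgroup[OF group_free_Abelian_group relations_carrier])

lemma K_keys: "c \<in> K \<Longrightarrow> Poly_Mapping.keys c \<subseteq> A \<times> A'"
  using subgroup.subset[OF K_subgroup] by (auto simp: F_simps)

lemma K_zero: "0 \<in> K"
  using subgroup.one_closed[OF K_subgroup] by (simp add: F_simps)

lemma K_add: "a \<in> K \<Longrightarrow> b \<in> K \<Longrightarrow> a + b \<in> K"
  using subgroup.m_closed[OF K_subgroup] by (simp add: F_simps)

lemma K_uminus: "a \<in> K \<Longrightarrow> - a \<in> K"
  using subgroup.m_inv_closed[OF K_subgroup, of a] K_keys[of a] by simp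

lemma K_diff: "a \<in> K \<Longrightarrow> b \<in> K \<Longrightarrow> a - b \<in> K"
  using K_add[of a "- b"] K_uminus[of b] by simp

lemma K_cmul: "a \<in> K \<Longrightarrow> frag_cmul k a \<in> K"
  by (rule frag_closure_minus_cmul[where P = "\<lambda>c. c \<in> K"]) (auto intro: K_zero K_diff)

lemma K_sum: "(\<And>i. i \<in> I \<Longrightarrow> f i \<in> K) \<Longrightarrow> sum f I \<in> K"
  by (induction I rule: infinite_finite_induct) (auto intro: K_zero K_add)

lemma K_rel: "c \<in> tensor_relations R (fun_module S sc A) (fun_module S' sc' A') \<Longrightarrow> c \<in> K"
  unfolding tensor_kernel_def by (rule generate.incl)

lemma K_add_left:
  "m \<in> A \<Longrightarrow> m' \<in> A \<Longrightarrow> n \<in> A' \<Longrightarrow> frag_of (\<lambda>y. m y + m' y, n) - frag_of (m, n) - frag_of (m', n) \<in> K"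
  by (rule K_rel) (unfold tensor_relations_def fun_module_simps, blast)

lemma K_add_right:
  "m \<in> A \<Longrightarrow> n \<in> A' \<Longrightarrow> n' \<in> A' \<Longrightarrow> frag_of (m, \<lambda>y. n y + n' y) - frag_of (m, n) - frag_of (m, n') \<in> K"
  by (rule K_rel) (unfold tensor_relations_def fun_module_simps, blast)

lemma K_balance:
  "r \<in> carrier R \<Longrightarrow> m \<in> A \<Longrightarrow> n \<in> A' \<Longrightarrow> frag_of (\<lambda>y. sc r y * m y, n) - frag_of (m, \<lambda>y. sc' r y * n y) \<in> K"
  by (rule K_rel) (unfold tensor_relations_def fun_module_simps, blast)

lemma K_zero_left: "n \<in> A' \<Longrightarrow> frag_of (\<lambda>_. 0, n) \<in> K"
  using K_uminus[OF K_add_left[of "\<lambda>_. 0" "\<lambda>_. 0" n]] A by (simp add: function_subspace_def)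

lemma K_zero_right: "m \<in> A \<Longrightarrow> frag_of (m, \<lambda>_. 0) \<in> K"
  using K_uminus[OF K_add_right[of m "\<lambda>_. 0" "\<lambda>_. 0"]] A' by (simp add: function_subspace_def)

lemma K_sum_right:
  assumes m: "m \<in> A" and "finite I" "\<And>i. i \<in> I \<Longrightarrow> n i \<in> A'"
  shows "frag_of (m, \<lambda>y. \<Sum>i\<in>I. n i y) - (\<Sum>i\<in>I. frag_of (m, n i)) \<in> K"
  using assms(2,3)
proof (induction I)
  case empty
  then show ?case using K_zero_right[OF m] by simp
next
  case (insert i I)
  let ?s = "\<lambda>y. \<Sum>i\<in>I. n i y"
  have s: "?s \<in> A'" using insert by (intro function_subspace_sum A') auto
  have "(frag_of (m, \<lambda>y. n i y + ?s y) - frag_of (m, n i) - frag_of (m, ?s))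
      + (frag_of (m, ?s) - (\<Sum>i\<in>I. frag_of (m, n i))) \<in> K"
    by (rule K_add[OF K_add_right[OF m _ s]]) (use insert in auto)
  then show ?case using insert by (simp add: algebra_simps)
qed

lemma K_sum_left:
  assumes n: "n \<in> A'" and "finite I" "\<And>i. i \<in> I \<Longrightarrow> m i \<in> A"
  shows "(\<Sum>i\<in>I. frag_of (m i, n)) - frag_of (\<lambda>y. \<Sum>i\<in>I. m i y, n) \<in> K"
  using assms(2,3)
proof (induction I)
  case empty
  then show ?case using K_uminus[OF K_zero_left[OF n]] by simp
next
  case (insert i I)
  let ?s = "\<lambda>y. \<Sum>i\<in>I. m i y"
  have s: "?s \<in> A" using insert by (intro function_subspace_sum A) auto
  have "((\<Sum>i\<in>I. frag_of (m i, n)) - frag_of (?s, n))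
      - (frag_of (\<lambda>y. m i y + ?s y, n) - frag_of (m i, n) - frag_of (?s, n)) \<in> K"
    by (rule K_diff[OF _ K_add_left[OF _ s n]]) (use insert in auto)
  then show ?case using insert by (simp add: algebra_simps)
qed

text \<open>Formal multiples of a generator agree with multiples of its left factor. The induction goes up
  and down from \<open>0\<close>.\<close>

lemma K_int_mult:
  assumes m: "m \<in> A" and n: "n \<in> A'"
  shows "frag_cmul k (frag_of (m, n)) - frag_of (\<lambda>y. of_int k * m y, n) \<in> K"
proof (induction k rule: int_induct[where k = 0])
  case base
  then show ?case using K_uminus[OF K_zero_left[OF n]] by simp
next
  case (step1 k)
  have "(frag_cmul k (frag_of (m, n)) - frag_of (\<lambda>y. of_int k * m y, n))
      - (frag_of (\<lambda>y. of_int k * m y + m y, n) - frag_of (\<lambda>y. of_int k * m y, n) - frag_of (m, n)) \<in> K"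
    by (rule K_diff[OF step1(2) K_add_left[OF cmult_A[OF m] m n]])
  then show ?case by (simp add: algebra_simps frag_cmul_distrib)
next
  case (step2 k)
  have "(frag_cmul k (frag_of (m, n)) - frag_of (\<lambda>y. of_int k * m y, n))
      + (frag_of (\<lambda>y. of_int (k - 1) * m y + m y, n) - frag_of (\<lambda>y. of_int (k - 1) * m y, n) - frag_of (m, n)) \<in> K"
    by (rule K_add[OF step2(2) K_add_left[OF cmult_A[OF m] m n]])
  then show ?case by (simp add: algebra_simps frag_cmul_diff_distrib)
qed

text \<open>If the right factors of a tensor are combinations of functions \<open>z k\<close>, then the tensor is a
  combination of the \<open>z k\<close> with left factors as coefficients, and it vanishes when these
  coefficients do. The injectivity of \<open>tensor_fun\<close> and that of the canonical map are both proved
  by producing such \<open>z k\<close>.\<close>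

lemma kernel_criterion:
  fixes n :: nat
  assumes keys: "Poly_Mapping.keys c \<subseteq> A \<times> A'"
    and z: "\<And>k. k < n \<Longrightarrow> z k \<in> A'"
    and r: "\<And>p k. p \<in> Poly_Mapping.keys c \<Longrightarrow> k < n \<Longrightarrow> r p k \<in> carrier R"
    and right: "\<And>p. p \<in> Poly_Mapping.keys c \<Longrightarrow> snd p = (\<lambda>y. \<Sum>k<n. sc' (r p k) y * z k y)"
    and left: "\<And>k y. k < n \<Longrightarrow>
      (\<Sum>p\<in>Poly_Mapping.keys c. of_int (Poly_Mapping.lookup c p) * (sc (r p k) y * fst p y)) = 0"
  shows "c \<in> K"
proof -
  let ?I = "Poly_Mapping.keys c" and ?c = "Poly_Mapping.lookup c"
  let ?a = "\<lambda>p k. frag_of (fst p, \<lambda>y. sc' (r p k) y * z k y)"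
  let ?b = "\<lambda>p k. frag_of (\<lambda>y. sc (r p k) y * fst p y, z k)"
  let ?d = "\<lambda>p k. frag_of (\<lambda>y. of_int (?c p) * (sc (r p k) y * fst p y), z k)"
  have fst: "fst p \<in> A" if "p \<in> ?I" for p using keys that by auto
  have 1: "frag_of p - (\<Sum>k<n. ?a p k) \<in> K" if p: "p \<in> ?I" for p
    using K_sum_right[where I = "{..<n}" and n = "\<lambda>k y. sc' (r p k) y * z k y", OF fst[OF p] finite_lessThan] p
    by (simp add: right[OF p, symmetric] smult_A' r z)
  have 2: "(\<Sum>k<n. ?a p k) - (\<Sum>k<n. ?b p k) \<in> K" if p: "p \<in> ?I" for p
    unfolding sum_subtractf[symmetric]
    using K_uminus[OF K_balance[OF r[OF p] fst[OF p] z]] by (intro K_sum) simp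
  have 3: "frag_cmul (?c p) (?b p k) - ?d p k \<in> K" if "p \<in> ?I" "k < n" for p k
    using that by (intro K_int_mult smult_A fst r z)
  have 4: "(\<Sum>p\<in>?I. ?d p k) - frag_of (\<lambda>_. 0, z k) \<in> K" if k: "k < n" for k
    using K_sum_left[where I = ?I and m = "\<lambda>p y. of_int (?c p) * (sc (r p k) y * fst p y)", OF z[OF k] finite_keys]
    unfolding left[OF k] by (simp add: cmult_A smult_A fst r k)
  (* Telescoping: the facts 1 to 4 rewrite c into a tensor whose left factors are all 0. *)
  have "c = (\<Sum>p\<in>?I. frag_cmul (?c p) (frag_of p))"
    using frag_expansion[of c] by (simp add: frag_extend_def)
  also have "\<dots> = (\<Sum>p\<in>?I. frag_cmul (?c p) (frag_of p - (\<Sum>k<n. ?a p k) + ((\<Sum>k<n. ?a p k) - (\<Sum>k<n. ?b p k)))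
      + (\<Sum>k<n. frag_cmul (?c p) (?b p k) - ?d p k)) + (\<Sum>k<n. (\<Sum>p\<in>?I. ?d p k) - frag_of (\<lambda>_. 0, z k))
      + (\<Sum>k<n. frag_of (\<lambda>_. 0, z k))"
    (is "?l = ?r")
  proof -
    have "frag_cmul (?c p) (frag_of p) = frag_cmul (?c p) (frag_of p - (\<Sum>k<n. ?a p k) + ((\<Sum>k<n. ?a p k) - (\<Sum>k<n. ?b p k)))
      + (\<Sum>k<n. frag_cmul (?c p) (?b p k) - ?d p k) + (\<Sum>k<n. ?d p k)" for p
    proof -
      have "frag_cmul (?c p) (frag_of p) = frag_cmul (?c p) ((frag_of p - (\<Sum>k<n. ?b p k)) + (\<Sum>k<n. ?b p k))" by simp
      also have "\<dots> = frag_cmul (?c p) (frag_of p - (\<Sum>k<n. ?b p k)) + (\<Sum>k<n. frag_cmul (?c p) (?b p k))"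
        unfolding frag_cmul_distrib2 by (simp add: frag_cmul_sum)
      finally show ?thesis by (simp add: sum_subtractf)
    qed
    then have "?l = (\<Sum>p\<in>?I. frag_cmul (?c p) (frag_of p - (\<Sum>k<n. ?a p k) + ((\<Sum>k<n. ?a p k) - (\<Sum>k<n. ?b p k)))
      + (\<Sum>k<n. frag_cmul (?c p) (?b p k) - ?d p k)) + (\<Sum>p\<in>?I. \<Sum>k<n. ?d p k)"
      by (simp only: sum.distrib[symmetric])
    also have "(\<Sum>p\<in>?I. \<Sum>k<n. ?d p k) = (\<Sum>k<n. \<Sum>p\<in>?I. ?d p k)" by (rule sum.swap)
    finally show ?thesis by (simp only: sum_subtractf) simp
  qed
  finally have "c = ?r" .
  moreover have "?r \<in> K"
    by (intro K_add K_sum K_cmul 1 2 3 4 K_zero_left z) auto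
  ultimately show ?thesis by (simp only:)
qed

lemma carrier_TP: "carrier TP = {cls c | c. Poly_Mapping.keys c \<subseteq> A \<times> A'}"
  by (auto simp: tensor_product_def Let_def FactGroup_def RCOSETS_def F_simps)

lemma cls_eq: "cls c = {k + c | k. k \<in> K}"
  by (auto simp: r_coset_def F_simps)

lemma cls_eq_iff: "cls c = cls d \<longleftrightarrow> c - d \<in> K"
proof
  assume "cls c = cls d"
  moreover have "c \<in> cls c" unfolding cls_eq using K_zero by force
  ultimately obtain k where "k \<in> K" "c = k + d" unfolding cls_eq by blast
  then show "c - d \<in> K" by simp
next
  assume cd: "c - d \<in> K"
  show "cls c = cls d"
  proof (intro equalityI subsetI)
    fix x assume "x \<in> cls c"
    then obtain k where k: "k \<in> K" "x = k + c" unfolding cls_eq by blast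
    then have "x = (k + (c - d)) + d" by simp
    with K_add[OF k(1) cd] show "x \<in> cls d" unfolding cls_eq by blast
  next
    fix x assume "x \<in> cls d"
    then obtain k where k: "k \<in> K" "x = k + d" unfolding cls_eq by blast
    then have "x = (k - (c - d)) + c" by simp
    with K_diff[OF k(1) cd] show "x \<in> cls c" unfolding cls_eq by blast
  qed
qed

lemma add_TP: "cls c \<oplus>\<^bsub>TP\<^esub> cls d = cls (c + d)"
proof -
  have "cls c \<oplus>\<^bsub>TP\<^esub> cls d = {x + y | x y. x \<in> cls c \<and> y \<in> cls d}"
    by (auto simp: tensor_product_def Let_def FactGroup_def set_mult_def F_simps)
  also have "\<dots> = cls (c + d)"
  proof (intro equalityI subsetI)
    fix x assume "x \<in> {x + y | x y. x \<in> cls c \<and> y \<in> cls d}"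
    then obtain k l where "k \<in> K" "l \<in> K" "x = (k + c) + (l + d)" unfolding cls_eq by blast
    then show "x \<in> cls (c + d)" unfolding cls_eq using K_add[of k l]
      by (auto intro!: exI[of _ "k + l"])
  next
    fix x assume "x \<in> cls (c + d)"
    then obtain k where k: "k \<in> K" "x = k + (c + d)" unfolding cls_eq by blast
    then have "x = (k + c) + (0 + d)" by simp
    with k K_zero show "x \<in> {x + y | x y. x \<in> cls c \<and> y \<in> cls d}" unfolding cls_eq by blast
  qed
  finally show ?thesis .
qed

text \<open>This makes the union of cosets by which a scalar acts on the tensor product a single coset.\<close>

lemma scale_K:
  assumes r: "r \<in> carrier R" and c: "c \<in> K"
  shows "frag_extend (\<lambda>(m, n). frag_of (\<lambda>y. sc r y * m y, n)) c \<in> K"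
proof -
  let ?E = "frag_extend (\<lambda>(m, n). frag_of (\<lambda>y. sc r y * m y, n))"
  have distr: "(\<lambda>y. sc r y * (m y + m' y)) = (\<lambda>y. sc r y * m y + sc r y * m' y)" for m m'
    by (simp add: distrib_left)
  have comm: "(\<lambda>y. sc r y * (sc s y * m y)) = (\<lambda>y. sc s y * (sc r y * m y))" for s m
    by (simp add: mult.left_commute)
  have rel: "?E h \<in> K" if "h \<in> tensor_relations R (fun_module S sc A) (fun_module S' sc' A')" for h
    using that unfolding tensor_relations_def fun_module_simps
  proof (elim UnE CollectE exE conjE)
    fix m m' n assume "h = frag_of (\<lambda>y. m y + m' y, n) - frag_of (m, n) - frag_of (m', n)" "m \<in> A" "m' \<in> A" "n \<in> A'"
    then show ?thesis by (simp add: frag_extend_diff distr K_add_left smult_A r)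
  next
    fix m n n' assume "h = frag_of (m, \<lambda>y. n y + n' y) - frag_of (m, n) - frag_of (m, n')" "m \<in> A" "n \<in> A'" "n' \<in> A'"
    then show ?thesis by (simp add: frag_extend_diff K_add_right smult_A r)
  next
    fix s m n assume "h = frag_of (\<lambda>y. sc s y * m y, n) - frag_of (m, \<lambda>y. sc' s y * n y)" "s \<in> carrier R" "m \<in> A" "n \<in> A'"
    then show ?thesis by (simp add: frag_extend_diff comm K_balance smult_A r)
  qed
  show ?thesis
    using c unfolding tensor_kernel_def fun_module_simps
  proof (induction c rule: generate.induct)
    case one
    then show ?case using K_zero by (simp add: F_simps tensor_kernel_def)
  next
    case (incl h)
    then show ?case using rel by (simp add: tensor_kernel_def)
  next
    case (inv h)
    have "Poly_Mapping.keys h \<subseteq> A \<times> A'" using relations_carrier inv by (auto simp: F_simps)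
    then show ?case using K_uminus[OF rel[OF inv]] by (simp add: frag_extend_minus tensor_kernel_def)
  next
    case (eng h1 h2)
    then show ?case using K_add by (simp add: F_simps frag_extend_add tensor_kernel_def)
  qed
qed

lemma smult_TP:
  assumes r: "r \<in> carrier R"
  shows "r \<odot>\<^bsub>TP\<^esub> cls c = cls (frag_extend (\<lambda>(m, n). frag_of (\<lambda>y. sc r y * m y, n)) c)"
proof -
  let ?E = "frag_extend (\<lambda>(m, n). frag_of (\<lambda>y. sc r y * m y, n))"
  have "r \<odot>\<^bsub>TP\<^esub> cls c = (\<Union>d\<in>cls c. cls (?E d))"
    by (simp add: tensor_product_def Let_def)
  also have "\<dots> = (\<Union>d\<in>cls c. cls (?E c))"
  proof (intro SUP_cong refl)
    fix d assume "d \<in> cls c"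
    then obtain k where k: "k \<in> K" "d = k + c" unfolding cls_eq by blast
    then show "cls (?E d) = cls (?E c)"
      unfolding cls_eq_iff using scale_K[OF r k(1)] by (simp add: frag_extend_add)
  qed
  also have "\<dots> = cls (?E c)"
    using K_zero by (auto simp: cls_eq)
  finally show ?thesis .
qed

lemma keys_scale:
  assumes "r \<in> carrier R" "Poly_Mapping.keys c \<subseteq> A \<times> A'"
  shows "Poly_Mapping.keys (frag_extend (\<lambda>(m, n). frag_of (\<lambda>y. sc r y * m y, n)) c) \<subseteq> A \<times> A'"
proof -
  have "Poly_Mapping.keys (case p of (m, n) \<Rightarrow> frag_of (\<lambda>y. sc r y * m y, n)) \<subseteq> A \<times> A'"
    if "p \<in> Poly_Mapping.keys c" for p
    using that assms by (auto simp: smult_A split: prod.splits)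
  then show ?thesis
    by (intro order_trans[OF keys_frag_extend] UN_least)
qed

lemma TP_smult_closed: "r \<in> carrier R \<Longrightarrow> t \<in> carrier TP \<Longrightarrow> r \<odot>\<^bsub>TP\<^esub> t \<in> carrier TP"
proof -
  assume r: "r \<in> carrier R" and "t \<in> carrier TP"
  then obtain c where c: "t = cls c" "Poly_Mapping.keys c \<subseteq> A \<times> A'" unfolding carrier_TP by blast
  show "r \<odot>\<^bsub>TP\<^esub> t \<in> carrier TP"
    unfolding c(1) smult_TP[OF r] carrier_TP using keys_scale[OF r c(2)] by blast
qed

lemma TP_add_closed: "s \<in> carrier TP \<Longrightarrow> t \<in> carrier TP \<Longrightarrow> s \<oplus>\<^bsub>TP\<^esub> t \<in> carrier TP"
proof -
  assume "s \<in> carrier TP" "t \<in> carrier TP"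
  then obtain c d where c: "s = cls c" "Poly_Mapping.keys c \<subseteq> A \<times> A'"
    and d: "t = cls d" "Poly_Mapping.keys d \<subseteq> A \<times> A'" unfolding carrier_TP by blast
  have "Poly_Mapping.keys (c + d) \<subseteq> A \<times> A'" using keys_add[of c d] c(2) d(2) by blast
  then show "s \<oplus>\<^bsub>TP\<^esub> t \<in> carrier TP"
    unfolding c(1) d(1) add_TP carrier_TP by blast
qed

end

text \<open>The assumption \<open>hom\<close> lets the values of the lift be written as sums over lists of pairs, without
  integer coefficients.\<close>

locale balanced_map = function_tensor R S sc A S' sc' A'
  for R :: "('r, 'b) ring_scheme" and S :: "'a set" and sc and A :: "('a \<Rightarrow> complex) set"
    and S' :: "'c set" and sc' and A' :: "('c \<Rightarrow> complex) set" +
  fixes \<phi> :: "('a \<Rightarrow> complex) \<times> ('c \<Rightarrow> complex) \<Rightarrow> 'z \<Rightarrow> complex"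
  assumes bal: "balanced R (fun_module S sc A) (fun_module S' sc' A') \<phi>"
    and hom: "\<And>m n c z. m \<in> A \<Longrightarrow> n \<in> A' \<Longrightarrow> \<phi> (\<lambda>y. c * m y, n) z = c * \<phi> (m, n) z"
begin

lemma lift_cls: "tensor_lift \<phi> (cls c) = frag_eval \<phi> c"
  using tensor_lift_coset[OF bal M N, of c] by simp

lemma lift_add:
  assumes "s \<in> carrier TP" "t \<in> carrier TP"
  shows "tensor_lift \<phi> (s \<oplus>\<^bsub>TP\<^esub> t) = (\<lambda>z. tensor_lift \<phi> s z + tensor_lift \<phi> t z)"
proof -
  obtain c d where "s = cls c" "t = cls d" using assms unfolding carrier_TP by blast
  then show ?thesis by (simp only: add_TP lift_cls) (rule ext, rule frag_eval_add)
qed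

lemma lift_image: "tensor_lift \<phi> ` carrier TP = {\<lambda>z. \<Sum>p\<leftarrow>L. \<phi> p z | L. set L \<subseteq> A \<times> A'}"
proof (intro equalityI subsetI)
  fix f assume "f \<in> tensor_lift \<phi> ` carrier TP"
  then obtain t where t: "t \<in> carrier TP" "f = tensor_lift \<phi> t" by (rule imageE)
  then obtain c where tc: "t = cls c" "Poly_Mapping.keys c \<subseteq> A \<times> A'" unfolding carrier_TP by blast
  then have c: "Poly_Mapping.keys c \<subseteq> A \<times> A'" "f = frag_eval \<phi> c"
    using t(2) by (simp_all add: lift_cls)
  obtain ps where ps: "set ps = Poly_Mapping.keys c" "distinct ps"
    using finite_distinct_list[OF finite_keys[of c]] by (elim exE conjE)
  let ?s = "\<lambda>p. (\<lambda>y. of_int (Poly_Mapping.lookup c p) * fst p y, snd p)"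
  have "f z = (\<Sum>p\<leftarrow>map ?s ps. \<phi> p z)" for z
  proof -
    have "f z = (\<Sum>p\<in>set ps. \<phi> (?s p) z)"
      unfolding c(2) frag_eval_def ps(1)
    proof (rule sum.cong[OF refl])
      fix p assume "p \<in> Poly_Mapping.keys c"
      then have "fst p \<in> A" "snd p \<in> A'" using c(1) by auto
      from hom[OF this] show "of_int (Poly_Mapping.lookup c p) * \<phi> p z = \<phi> (?s p) z" by simp
    qed
    then show ?thesis by (simp add: sum_list_distinct_conv_sum_set ps(2) o_def)
  qed
  moreover have "set (map ?s ps) \<subseteq> A \<times> A'" using c(1) ps(1) by (auto intro!: cmult_A)
  ultimately show "f \<in> {\<lambda>z. \<Sum>p\<leftarrow>L. \<phi> p z | L. set L \<subseteq> A \<times> A'}" by blast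
next
  fix f assume "f \<in> {\<lambda>z. \<Sum>p\<leftarrow>L. \<phi> p z | L. set L \<subseteq> A \<times> A'}"
  then obtain L where L: "set L \<subseteq> A \<times> A'" "f = (\<lambda>z. \<Sum>p\<leftarrow>L. \<phi> p z)" by blast
  have "\<exists>c. Poly_Mapping.keys c \<subseteq> A \<times> A' \<and> frag_eval \<phi> c = (\<lambda>z. \<Sum>p\<leftarrow>L. \<phi> p z)"
    using L(1)
  proof (induction L)
    case Nil
    show ?case by (intro exI[of _ 0]) (simp add: frag_eval_def)
  next
    case (Cons p L)
    then obtain c where c: "Poly_Mapping.keys c \<subseteq> A \<times> A'" "frag_eval \<phi> c = (\<lambda>z. \<Sum>p\<leftarrow>L. \<phi> p z)" by auto
    have "Poly_Mapping.keys (frag_of p + c) \<subseteq> A \<times> A'"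
      using keys_add[of "frag_of p" c] c(1) Cons.prems by auto
    moreover have "frag_eval \<phi> (frag_of p + c) = (\<lambda>z. \<Sum>p\<leftarrow>p # L. \<phi> p z)"
      by (rule ext) (simp add: frag_eval_add frag_eval_of c(2))
    ultimately show ?case by blast
  qed
  then obtain c where c: "Poly_Mapping.keys c \<subseteq> A \<times> A'" "frag_eval \<phi> c = f" unfolding L(2) by blast
  have "tensor_lift \<phi> (cls c) = f" unfolding lift_cls by (rule c(2))
  moreover have "cls c \<in> carrier TP" unfolding carrier_TP using c(1) by blast
  ultimately show "f \<in> tensor_lift \<phi> ` carrier TP" by blast
qed

lemma lift_smult:
  assumes r: "r \<in> carrier R" and t: "t \<in> carrier TP"
    and scale: "\<And>m n z. m \<in> A \<Longrightarrow> n \<in> A' \<Longrightarrow> \<phi> (\<lambda>y. sc r y * m y, n) z = \<rho> * \<phi> (m, n) z"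
  shows "tensor_lift \<phi> (r \<odot>\<^bsub>TP\<^esub> t) = (\<lambda>z. \<rho> * tensor_lift \<phi> t z)"
proof -
  let ?E = "frag_extend (\<lambda>(m, n). frag_of (\<lambda>y. sc r y * m y, n))"
  obtain c where c: "t = cls c" "Poly_Mapping.keys c \<subseteq> A \<times> A'" using t unfolding carrier_TP by blast
  have "frag_eval \<phi> (?E c) z = \<rho> * frag_eval \<phi> c z" for z
    using c(2)
  proof (induction c rule: frag_induction)
    case (one p)
    then show ?case using scale[of "fst p" "snd p" z] by (auto simp: frag_eval_of)
  next
    case (diff a b)
    then show ?case by (simp add: frag_extend_diff frag_eval_diff right_diff_distrib)
  qed (simp add: frag_eval_def)
  then show ?thesis unfolding c(1) smult_TP[OF r] lift_cls by blast
qed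

lemma lift_inj:
  assumes "\<And>c. Poly_Mapping.keys c \<subseteq> A \<times> A' \<Longrightarrow> (\<And>z. frag_eval \<phi> c z = 0) \<Longrightarrow> c \<in> K"
  shows "inj_on (tensor_lift \<phi>) (carrier TP)"
proof (rule inj_onI)
  fix s t assume "s \<in> carrier TP" "t \<in> carrier TP" and eq: "tensor_lift \<phi> s = tensor_lift \<phi> t"
  then obtain c d where cd: "s = cls c" "t = cls d" "Poly_Mapping.keys c \<subseteq> A \<times> A'" "Poly_Mapping.keys d \<subseteq> A \<times> A'"
    unfolding carrier_TP by blast
  have "frag_eval \<phi> (c - d) z = 0" for z
    using eq unfolding cd(1,2) lift_cls by (simp add: frag_eval_diff)
  moreover have "Poly_Mapping.keys (c - d) \<subseteq> A \<times> A'" using keys_diff[of c d] cd by blast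
  ultimately have "c - d \<in> K" by (intro assms)
  then show "s = t" unfolding cd(1,2) cls_eq_iff .
qed

end

section \<open>The Peter--Weyl algebra of an action\<close>

locale compact_action = compact_group G T + continuous_right_action G T X act
  for G :: "'g monoid" (structure) and T :: "'g topology"
    and X :: "'x topology" and act :: "'x \<Rightarrow> 'g \<Rightarrow> 'x" +
  assumes compact_X: "compact_space X" and Hausdorff_X: "Hausdorff_space X"
begin

abbreviation "P \<equiv> peter_weyl G T X act"
abbreviation "B \<equiv> invariant_functions G X act"

lemma act_closed: "x \<in> topspace X \<Longrightarrow> g \<in> carrier G \<Longrightarrow> act x g \<in> topspace X"
  using continuous_map_image_subset_topspace[OF continuous_act] topspace_eq by fastforce

lemma cont_act:
  "continuous_map Y X a \<Longrightarrow> continuous_map Y T b \<Longrightarrow> continuous_map Y X (\<lambda>y. act (a y) (b y))"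
  using continuous_map_comp[OF _ continuous_act, of Y "\<lambda>y. (a y, b y)"]
  by (simp add: continuous_map_pairedI)

lemma cfunI: "continuous_map X euclidean f \<Longrightarrow> (\<And>x. x \<notin> topspace X \<Longrightarrow> f x = 0) \<Longrightarrow> f \<in> cfun X"
  by (simp add: cfun_def)

lemma cfunD: "f \<in> cfun X \<Longrightarrow> continuous_map X euclidean f" "f \<in> cfun X \<Longrightarrow> x \<notin> topspace X \<Longrightarrow> f x = 0"
  by (simp_all add: cfun_def)

lemma cfun_zero: "(\<lambda>_. 0) \<in> cfun X"
  by (simp add: cfun_def)

lemma cfun_add: "f \<in> cfun X \<Longrightarrow> h \<in> cfun X \<Longrightarrow> (\<lambda>x. f x + h x) \<in> cfun X"
  by (simp add: cfun_def continuous_map_add)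

lemma cfun_mult: "f \<in> cfun X \<Longrightarrow> h \<in> cfun X \<Longrightarrow> (\<lambda>x. f x * h x) \<in> cfun X"
  by (simp add: cfun_def continuous_map_algebra_mult)

lemma cfun_cmult: "f \<in> cfun X \<Longrightarrow> (\<lambda>x. c * f x) \<in> cfun X"
  by (simp add: cfun_def continuous_map_algebra_mult)

lemma cfun_cnj: "f \<in> cfun X \<Longrightarrow> (\<lambda>x. cnj (f x)) \<in> cfun X"
  by (simp add: cfun_def continuous_map_cnj)

lemma cfun_one: "indicator (topspace X) \<in> cfun X"
  by (rule cfunI) (auto intro: continuous_map_eq[of _ _ "\<lambda>_. 1"])

lemma cfun_sum_list: "(\<And>p. p \<in> set L \<Longrightarrow> F p \<in> cfun X) \<Longrightarrow> (\<lambda>x. \<Sum>p\<leftarrow>L. F p x) \<in> cfun X"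
  by (induction L) (auto intro: cfun_zero cfun_add)

lemma subspace_cfun: "function_subspace (cfun X)"
  unfolding function_subspace_def by (simp add: cfun_zero cfun_add cfun_cmult)

lemma subspace_coeff: "function_subspace \<O>"
  unfolding function_subspace_def by (simp add: coeff_zero coeff_add coeff_cmult)

lemma cont_orbit: "f \<in> cfun X \<Longrightarrow> x \<in> topspace X \<Longrightarrow> cont (\<lambda>g. f (act x g))"
  by (rule continuous_map_comp[OF cont_act cfunD(1)]) auto

text \<open>\<open>tensor_fun\<close> is the lift of \<open>ev\<close>.\<close>

abbreviation "ev \<equiv> (\<lambda>(f, h) (x, g). f x * h g) :: ('x \<Rightarrow> complex) \<times> ('g \<Rightarrow> complex) \<Rightarrow> 'x \<times> 'g \<Rightarrow> complex"

sublocale pre: balanced_map complex_ring "topspace X" "\<lambda>c _. c" "cfun X" "carrier G" "\<lambda>c _. c" \<O> ev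
  by (intro balanced_map.intro function_tensor.intro balanced_map_axioms.intro
      module_fun_vs subspace_cfun subspace_coeff) (auto simp: balanced_def algebra_simps)

text \<open>All functions involved vanish outside the space and the group, so the equation between functions
  in the definition needs to be tested only at points \<open>(x, g)\<close>. From here on the tensor product
  behind the definition is replaced by finite sums of products.\<close>

lemma peter_weyl_iff:
  "f \<in> P \<longleftrightarrow> f \<in> cfun X \<and> (\<exists>L. set L \<subseteq> cfun X \<times> \<O> \<and>
     (\<forall>x\<in>topspace X. \<forall>g\<in>carrier G. f (act x g) = (\<Sum>(a, h)\<leftarrow>L. a x * h g)))"
proof -
  have "coaction G X act f = (\<lambda>z. \<Sum>p\<leftarrow>L. ev p z) \<longleftrightarrow>
      (\<forall>x\<in>topspace X. \<forall>g\<in>carrier G. f (act x g) = (\<Sum>(a, h)\<leftarrow>L. a x * h g))"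
    if L: "set L \<subseteq> cfun X \<times> \<O>" for L
  proof -
    have out: "(\<Sum>p\<leftarrow>L. ev p (x, g)) = 0" if "x \<notin> topspace X \<or> g \<notin> carrier G" for x g
    proof -
      have "ev p (x, g) = 0" if "p \<in> set L" for p
        using that L \<open>x \<notin> topspace X \<or> g \<notin> carrier G\<close> cfunD(2) coeff_outside by (auto split: prod.splits)
      then have "map (\<lambda>p. ev p (x, g)) L = map (\<lambda>p. 0) L" by (intro map_cong) auto
      then show ?thesis by (simp only: sum_list_triv) simp
    qed
    have "coaction G X act f = (\<lambda>z. \<Sum>p\<leftarrow>L. ev p z) \<longleftrightarrow>
        (\<forall>x g. coaction G X act f (x, g) = (\<Sum>p\<leftarrow>L. ev p (x, g)))"
      by (simp only: fun_eq_iff split_paired_All)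
    also have "\<dots> \<longleftrightarrow> (\<forall>x\<in>topspace X. \<forall>g\<in>carrier G. f (act x g) = (\<Sum>p\<leftarrow>L. ev p (x, g)))"
      using out by (auto simp: coaction_def)
    finally show ?thesis by (simp add: case_prod_unfold)
  qed
  then show ?thesis
    unfolding peter_weyl_def tensor_fun_def pre.lift_image by blast
qed

lemma peter_weyl_cfun: "f \<in> P \<Longrightarrow> f \<in> cfun X"
  by (simp add: peter_weyl_iff)

lemma peter_weyl_outside: "f \<in> P \<Longrightarrow> x \<notin> topspace X \<Longrightarrow> f x = 0"
  using peter_weyl_cfun cfunD(2) by blast

lemma peter_weylI:
  assumes "f \<in> cfun X" "set L \<subseteq> cfun X \<times> \<O>"
    "\<And>x g. x \<in> topspace X \<Longrightarrow> g \<in> carrier G \<Longrightarrow> f (act x g) = (\<Sum>(a, h)\<leftarrow>L. a x * h g)"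
  shows "f \<in> P"
  using assms unfolding peter_weyl_iff by blast

lemma invariant_iff:
  "f \<in> B \<longleftrightarrow> f \<in> cfun X \<and> (\<forall>x\<in>topspace X. \<forall>g\<in>carrier G. f (act x g) = f x)"
proof (cases "f \<in> cfun X")
  case True
  have "coaction G X act f = (\<lambda>(x, g). f x * indicator (carrier G) g) \<longleftrightarrow>
      (\<forall>x g. coaction G X act f (x, g) = f x * indicator (carrier G) g)"
    by (simp only: fun_eq_iff split_paired_All case_prod_conv)
  also have "\<dots> \<longleftrightarrow> (\<forall>x\<in>topspace X. \<forall>g\<in>carrier G. f (act x g) = f x)"
    using cfunD(2)[OF True] by (auto simp: coaction_def indicator_def)
  finally show ?thesis using True by (simp add: invariant_functions_def)
qed (simp add: invariant_functions_def)

text \<open>The summands of a product are indexed by the pairs of summands of the factors.\<close>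

lemma peter_weyl_mult:
  assumes "f \<in> P" "k \<in> P"
  shows "(\<lambda>x. f x * k x) \<in> P"
proof -
  obtain L M where L: "set L \<subseteq> cfun X \<times> \<O>" and M: "set M \<subseteq> cfun X \<times> \<O>"
    and f: "\<forall>x\<in>topspace X. \<forall>g\<in>carrier G. f (act x g) = (\<Sum>(a, h)\<leftarrow>L. a x * h g)"
    and k: "\<forall>x\<in>topspace X. \<forall>g\<in>carrier G. k (act x g) = (\<Sum>(a, h)\<leftarrow>M. a x * h g)"
    using assms unfolding peter_weyl_iff by blast
  let ?N = "map (\<lambda>((a, h), (a', h')). (\<lambda>x. a x * a' x, \<lambda>g. h g * h' g)) (List.product L M)"
  have "set ?N \<subseteq> cfun X \<times> \<O>" using L M by (auto intro!: coeff_mult cfun_mult)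
  moreover have "f (act x g) * k (act x g) = (\<Sum>(a, h)\<leftarrow>?N. a x * h g)"
    if "x \<in> topspace X" "g \<in> carrier G" for x g
  proof -
    have "f (act x g) * k (act x g) = (\<Sum>(p, q)\<leftarrow>List.product L M. (case p of (a, h) \<Rightarrow> a x * h g) * (case q of (a, h) \<Rightarrow> a x * h g))"
      using f k that by (simp add: sum_list_product)
    also have "\<dots> = (\<Sum>(a, h)\<leftarrow>?N. a x * h g)"
      unfolding map_map by (intro arg_cong[where f = sum_list] map_cong refl) (auto simp: mult_ac)
    finally show ?thesis .
  qed
  moreover have "(\<lambda>x. f x * k x) \<in> cfun X" using assms by (intro cfun_mult peter_weyl_cfun)
  ultimately show ?thesis by (intro peter_weylI)
qed

lemma peter_weyl_add:
  assumes "f \<in> P" "k \<in> P"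
  shows "(\<lambda>x. f x + k x) \<in> P"
proof -
  obtain L M where L: "set L \<subseteq> cfun X \<times> \<O>" and M: "set M \<subseteq> cfun X \<times> \<O>"
    and f: "\<forall>x\<in>topspace X. \<forall>g\<in>carrier G. f (act x g) = (\<Sum>(a, h)\<leftarrow>L. a x * h g)"
    and k: "\<forall>x\<in>topspace X. \<forall>g\<in>carrier G. k (act x g) = (\<Sum>(a, h)\<leftarrow>M. a x * h g)"
    using assms unfolding peter_weyl_iff by blast
  show ?thesis
    by (rule peter_weylI[of _ "L @ M"]) (use assms L M f k in \<open>auto intro: cfun_add peter_weyl_cfun\<close>)
qed

lemma invariant_peter_weyl: "b \<in> B \<Longrightarrow> b \<in> P"
  by (rule peter_weylI[of _ "[(b, indicator (carrier G))]"]) (auto simp: invariant_iff coeff_one)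

lemma invariant_const: "(\<lambda>x. c * indicator (topspace X) x) \<in> B"
  using cfun_cmult[OF cfun_one] by (auto simp: invariant_iff act_closed)

lemma invariant_one: "indicator (topspace X) \<in> B"
  using invariant_const[of 1] by simp

lemma peter_weyl_cmult: "f \<in> P \<Longrightarrow> (\<lambda>x. c * f x) \<in> P"
proof -
  assume f: "f \<in> P"
  have "(\<lambda>x. (c * indicator (topspace X) x) * f x) = (\<lambda>x. c * f x)"
    using peter_weyl_outside[OF f] by (auto simp: fun_eq_iff indicator_def)
  then show ?thesis using peter_weyl_mult[OF invariant_peter_weyl[OF invariant_const] f] by metis
qed

lemma peter_weyl_cnj:
  assumes "f \<in> P"
  shows "(\<lambda>x. cnj (f x)) \<in> P"
proof -
  obtain L where L: "set L \<subseteq> cfun X \<times> \<O>"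
    and f: "\<forall>x\<in>topspace X. \<forall>g\<in>carrier G. f (act x g) = (\<Sum>(a, h)\<leftarrow>L. a x * h g)"
    using assms unfolding peter_weyl_iff by blast
  let ?M = "map (\<lambda>(a, h). (\<lambda>x. cnj (a x), \<lambda>g. cnj (h g))) L"
  have cnj_list: "cnj (\<Sum>(a, h)\<leftarrow>L. a x * h g) = (\<Sum>(a, h)\<leftarrow>map (\<lambda>(a, h). (\<lambda>x. cnj (a x), \<lambda>g. cnj (h g))) L. a x * h g)" for x g
    by (induction L) auto
  show ?thesis
    by (rule peter_weylI[of _ ?M])
      (use assms L f cnj_list in \<open>auto intro: cfun_cnj peter_weyl_cfun coeff_cnj\<close>)
qed

lemma peter_weyl_zero: "(\<lambda>_. 0) \<in> P"
  using peter_weyl_cmult[OF invariant_peter_weyl[OF invariant_one], of 0] by simp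

lemma peter_weyl_sum: "finite I \<Longrightarrow> (\<And>i. i \<in> I \<Longrightarrow> f i \<in> P) \<Longrightarrow> (\<lambda>x. \<Sum>i\<in>I. f i x) \<in> P"
  by (induction I rule: finite_induct) (auto intro: peter_weyl_zero peter_weyl_add)

lemma invariant_add: "b \<in> B \<Longrightarrow> b' \<in> B \<Longrightarrow> (\<lambda>x. b x + b' x) \<in> B"
  by (simp add: invariant_iff cfun_add)

lemma invariant_mult: "b \<in> B \<Longrightarrow> b' \<in> B \<Longrightarrow> (\<lambda>x. b x * b' x) \<in> B"
  by (simp add: invariant_iff cfun_mult)

lemma invariant_cmult: "b \<in> B \<Longrightarrow> (\<lambda>x. c * b x) \<in> B"
  by (simp add: invariant_iff cfun_cmult)

lemma subspace_peter_weyl: "function_subspace P"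
  unfolding function_subspace_def by (simp add: peter_weyl_zero peter_weyl_add peter_weyl_cmult)

lemma subspace_invariant: "function_subspace B"
  unfolding function_subspace_def using invariant_const[of 0] by (simp add: invariant_add invariant_cmult)

lemma ip_sum_list:
  "(\<And>p. p \<in> set L \<Longrightarrow> cont (F p)) \<Longrightarrow> cont h \<Longrightarrow> ip (\<lambda>x. \<Sum>p\<leftarrow>L. F p x) h = (\<Sum>p\<leftarrow>L. ip (F p) h)"
proof (induction L)
  case Nil
  then show ?case by (simp add: ip_def)
next
  case (Cons p L)
  have "ip (\<lambda>x. F p x + (\<Sum>p\<leftarrow>L. F p x)) h = ip (F p) h + ip (\<lambda>x. \<Sum>p\<leftarrow>L. F p x) h"
    by (intro ip_add cont_sum_list Cons.prems) simp_all
  with Cons show ?case by simp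
qed

text \<open>Expand \<open>q (x g)\<close> in orthonormal coefficients \<open>u s (g)\<close>. The left factors are then integrals
  of \<open>q (x g)\<close> against the \<open>u s\<close>, and translating \<open>x\<close> amounts to translating the \<open>u s\<close>, which
  the coproduct of the coefficient algebra describes.\<close>

lemma peter_weyl_coaction:
  assumes q: "q \<in> P"
  shows "\<exists>L. set L \<subseteq> P \<times> \<O> \<and>
    (\<forall>x\<in>topspace X. \<forall>g\<in>carrier G. q (act x g) = (\<Sum>(a, h)\<leftarrow>L. a x * h g))"
proof -
  obtain L where L: "set L \<subseteq> cfun X \<times> \<O>"
    and qL: "\<And>x g. x \<in> topspace X \<Longrightarrow> g \<in> carrier G \<Longrightarrow> q (act x g) = (\<Sum>(a, h)\<leftarrow>L. a x * h g)"
    using q unfolding peter_weyl_iff by blast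
  have "set (map snd L) \<subseteq> \<O>" using L by auto
  from orthonormal_basis_of_list[OF coeff_fun_space this] obtain n u where on: "orthonormal n u" and u: "\<And>i. i < n \<Longrightarrow> u i \<in> \<O>"
    and span: "\<And>p x. p \<in> set L \<Longrightarrow> x \<in> carrier G \<Longrightarrow> snd p x = proj n u (snd p) x"
    by (elim exE conjE) auto
  have cu: "cont (u i)" if "i < n" for i using u[OF that] coeff_cont by blast
  define b where "b s = (\<lambda>x. \<Sum>(a, h)\<leftarrow>L. ip h (u s) * a x)" for s
  have bC: "b s \<in> cfun X" for s
    unfolding b_def case_prod_unfold using L by (intro cfun_sum_list cfun_cmult) auto
  have qb: "q (act x g) = (\<Sum>s<n. b s x * u s g)" if x: "x \<in> topspace X" and g: "g \<in> carrier G" for x g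
  proof -
    have "q (act x g) = (\<Sum>p\<leftarrow>L. fst p x * (\<Sum>s<n. ip (snd p) (u s) * u s g))"
      unfolding qL[OF x g] case_prod_unfold
      using span[OF _ g] by (intro arg_cong[where f = sum_list] map_cong refl) (simp add: proj_def)
    also have "\<dots> = (\<Sum>s<n. b s x * u s g)"
      unfolding b_def case_prod_unfold
      by (induction L) (simp_all add: sum.distrib sum_distrib_left distrib_left distrib_right mult_ac)
    finally show ?thesis .
  qed
  obtain M where M: "\<And>r. r < n \<Longrightarrow> set (M r) \<subseteq> \<O> \<times> \<O> \<and>
      (\<forall>x\<in>carrier G. \<forall>y\<in>carrier G. u r (x \<otimes> y) = (\<Sum>(a, b)\<leftarrow>M r. a x * b y))"
    using coeff_coproduct[OF u] by metis
  define w where "w r s = (\<lambda>t. \<Sum>(\<alpha>, \<beta>)\<leftarrow>M r. ip \<beta> (u s) * \<alpha> t)" for r s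
  have w: "w r s \<in> \<O>" if "r < n" for r s
    unfolding w_def case_prod_unfold using M[OF that] by (intro coeff_sum_list coeff_cmult) auto
  have "b s \<in> P" if s: "s < n" for s
  proof (rule peter_weylI[OF bC, of "map (\<lambda>r. (b r, w r s)) [0..<n]"])
    show "set (map (\<lambda>r. (b r, w r s)) [0..<n]) \<subseteq> cfun X \<times> \<O>" using bC w by auto
    fix x t assume x: "x \<in> topspace X" and t: "t \<in> carrier G"
    have b_ip: "b s y = ip (\<lambda>g. q (act y g)) (u s)" if y: "y \<in> topspace X" for y
    proof -
      have "ip (\<lambda>g. q (act y g)) (u s) = ip (\<lambda>g. \<Sum>r<n. b r y * u r g) (u s)"
        using qb[OF y] by (intro ip_cong) auto
      then show ?thesis using ip_lincomb[OF on s] by simp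
    qed
    have "b s (act x t) = ip (\<lambda>g. q (act (act x t) g)) (u s)" using x t by (intro b_ip act_closed)
    also have "\<dots> = ip (\<lambda>g. \<Sum>r<n. b r x * u r (t \<otimes> g)) (u s)"
      using x t by (intro ip_cong refl) (simp add: qb flip: act_mult)
    also have "\<dots> = (\<Sum>r<n. b r x * ip (\<lambda>g. u r (t \<otimes> g)) (u s))"
      using cu s t by (subst ip_sum) (auto simp: ip_cmult cont_ltrans intro!: cont_intros cont_ltrans)
    also have "\<dots> = (\<Sum>r<n. b r x * w r s t)"
    proof (intro sum.cong refl)
      fix r assume "r \<in> {..<n}"
      then have r: "r < n" by simp
      have c: "cont (snd p)" if "p \<in> set (M r)" for p
        using M[OF r] that by (intro coeff_cont) auto
      have "ip (\<lambda>g. u r (t \<otimes> g)) (u s) = ip (\<lambda>g. \<Sum>p\<leftarrow>M r. fst p t * snd p g) (u s)"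
        using M[OF r] t by (intro ip_cong) (auto simp: case_prod_unfold)
      also have "\<dots> = (\<Sum>p\<leftarrow>M r. ip (\<lambda>g. fst p t * snd p g) (u s))"
        by (intro ip_sum_list cont_intros c cu s)
      also have "\<dots> = w r s t"
        unfolding w_def case_prod_unfold
        by (intro arg_cong[where f = sum_list] map_cong refl) (simp add: ip_cmult c cu s mult.commute)
      finally show "b r x * ip (\<lambda>g. u r (t \<otimes> g)) (u s) = b r x * w r s t" by simp
    qed
    finally show "b s (act x t) = (\<Sum>(a, h)\<leftarrow>map (\<lambda>r. (b r, w r s)) [0..<n]. a x * h t)"
      by (simp add: o_def sum_list_distinct_conv_sum_set lessThan_atLeast0)
  qed
  then show ?thesis
    using qb u by (intro exI[of _ "map (\<lambda>s. (b s, u s)) [0..<n]"])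
      (auto simp: o_def sum_list_distinct_conv_sum_set lessThan_atLeast0)
qed

lemma continuous_map_average:
  assumes "continuous_map (prod_topology X T) euclidean (\<lambda>(x, g). F x g)"
  shows "(\<lambda>x. if x \<in> topspace X then haar (F x) else 0) \<in> cfun X"
  by (rule cfunI) (auto intro: continuous_map_eq[OF continuous_map_haar[OF assms]])

text \<open>The conditional expectation of the continuous functions onto the invariant ones.\<close>

definition expect :: "('x \<Rightarrow> complex) \<Rightarrow> 'x \<Rightarrow> complex" where
  "expect f x = (if x \<in> topspace X then haar (\<lambda>g. f (act x g)) else 0)"

lemma expect_invariant:
  assumes f: "f \<in> cfun X"
  shows "expect f \<in> B"
proof -
  have "continuous_map (prod_topology X T) euclidean (\<lambda>(x, g). f (act x g))"
    unfolding case_prod_unfold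
    by (rule continuous_map_comp[OF cont_act cfunD(1)[OF f]]) (auto intro: continuous_intros)
  from continuous_map_average[OF this] have "expect f \<in> cfun X" by (simp add: expect_def[abs_def])
  moreover have "expect f (act x t) = expect f x" if "x \<in> topspace X" "t \<in> carrier G" for x t
  proof -
    have "haar (\<lambda>g. f (act (act x t) g)) = haar (\<lambda>g. f (act x (t \<otimes> g)))"
      using that by (intro haar_cong) (simp add: act_mult)
    also have "\<dots> = haar (\<lambda>g. f (act x g))"
      using haar_ltrans[OF cont_orbit[OF f that(1)] that(2)] .
    finally show ?thesis using that by (simp add: expect_def act_closed)
  qed
  ultimately show ?thesis by (simp add: invariant_iff)
qed

section \<open>The canonical map\<close>

abbreviation "can_pair \<equiv> \<lambda>(p, q) (x, g). p x * indicator (carrier G) g * coaction G X act q (x, g)"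

lemma cring_invariant: "cring (fun_module (topspace X) sc B)"
  by (rule cring_fun_module)
    (use subspace_invariant invariant_one invariant_mult in \<open>auto simp: invariant_iff cfun_def\<close>)

lemma module_peter_weyl:
  "module (fun_module (topspace X) (\<lambda>b. b) B) (fun_module (topspace X) (\<lambda>b. b) P)"
  by (rule module_fun_module[OF cring_invariant subspace_peter_weyl])
    (auto intro: peter_weyl_mult invariant_peter_weyl peter_weyl_outside)

sublocale dom: balanced_map "fun_module (topspace X) (\<lambda>b. b) B" "topspace X" "\<lambda>b. b" P "topspace X" "\<lambda>b. b" P can_pair
proof (intro balanced_map.intro function_tensor.intro balanced_map_axioms.intro
    module_peter_weyl subspace_peter_weyl)
  show "balanced (fun_module (topspace X) (\<lambda>b. b) B) (fun_module (topspace X) (\<lambda>b. b) P)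
      (fun_module (topspace X) (\<lambda>b. b) P) can_pair"
    unfolding balanced_def by (auto simp: coaction_def algebra_simps invariant_iff)
qed auto

sublocale cod: balanced_map complex_ring "topspace X" "\<lambda>c _. c" P "carrier G" "\<lambda>c _. c" \<O> ev
  by (intro balanced_map.intro function_tensor.intro balanced_map_axioms.intro
      module_fun_vs subspace_peter_weyl subspace_coeff) (auto simp: balanced_def algebra_simps)

lemma can_domain_eq: "can_domain G T X act = dom.TP"
  by (simp add: can_domain_def Let_def)

lemma can_codomain_eq: "can_codomain G T X act = cod.TP"
  by (simp add: can_codomain_def)

abbreviation "lift_can \<equiv> tensor_lift can_pair"

text \<open>Rewriting the right factors in an orthonormal family makes the left coefficients inner products
  of the function with the family.\<close>

lemma tensor_fun_inj: "inj_on tensor_fun (carrier cod.TP)"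
  unfolding tensor_fun_def
proof (rule cod.lift_inj)
  fix c assume keys: "Poly_Mapping.keys c \<subseteq> P \<times> \<O>" and zero: "\<And>z. frag_eval ev c z = 0"
  obtain ps where ps: "set ps = Poly_Mapping.keys c"
    using finite_list[OF finite_keys[of c]] by (elim exE)
  have "set (map snd ps) \<subseteq> \<O>" using keys ps by auto
  from orthonormal_basis_of_list[OF coeff_fun_space this] obtain n u where on: "orthonormal n u" and u: "\<And>i. i < n \<Longrightarrow> u i \<in> \<O>"
    and span: "\<And>p x. p \<in> Poly_Mapping.keys c \<Longrightarrow> x \<in> carrier G \<Longrightarrow> snd p x = proj n u (snd p) x"
    unfolding set_map ps by (elim exE conjE) auto
  show "c \<in> cod.K"
  proof (rule cod.kernel_criterion[OF keys, where z = u and r = "\<lambda>p k. ip (snd p) (u k)" and n = n])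
    show "u k \<in> \<O>" if "k < n" for k using u[OF that] .
    show "ip (snd p) (u k) \<in> carrier complex_ring" for p k by (simp add: complex_ring_def)
    show "snd p = (\<lambda>y. \<Sum>k<n. ip (snd p) (u k) * u k y)" if p: "p \<in> Poly_Mapping.keys c" for p
    proof
      fix y show "snd p y = (\<Sum>k<n. ip (snd p) (u k) * u k y)"
      proof (cases "y \<in> carrier G")
        case True
        then show ?thesis using span[of p y] p by (simp add: proj_def)
      next
        case False
        then show ?thesis using coeff_outside[OF u False] coeff_outside[of "snd p" y] keys p by auto
      qed
    qed
    fix k x assume k: "k < n"
    have c: "cont (snd p)" if "p \<in> Poly_Mapping.keys c" for p
      using keys that by (intro coeff_cont) auto
    have ck: "cont (u k)" using u[OF k] coeff_cont by blast
    have "(\<Sum>p\<in>Poly_Mapping.keys c. of_int (Poly_Mapping.lookup c p) * (ip (snd p) (u k) * fst p x))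
        = (\<Sum>p\<in>Poly_Mapping.keys c. ip (\<lambda>g. (of_int (Poly_Mapping.lookup c p) * fst p x) * snd p g) (u k))"
      by (intro sum.cong refl) (simp add: ip_cmult c ck)
    also have "\<dots> = ip (\<lambda>g. \<Sum>p\<in>Poly_Mapping.keys c. (of_int (Poly_Mapping.lookup c p) * fst p x) * snd p g) (u k)"
      by (subst ip_sum) (auto intro!: cont_intros c ck)
    also have "\<dots> = ip (\<lambda>_. 0) (u k)"
      using zero[of "(x, _)"] by (intro ip_cong) (simp_all add: frag_eval_def case_prod_unfold mult.assoc)
    finally show "(\<Sum>p\<in>Poly_Mapping.keys c. of_int (Poly_Mapping.lookup c p) * (ip (snd p) (u k) * fst p x)) = 0"
      by (simp add: ip_def)
  qed
qed

lemma tensor_fun_image: "tensor_fun ` carrier cod.TP = {\<lambda>z. \<Sum>p\<leftarrow>L. ev p z | L. set L \<subseteq> P \<times> \<O>}"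
  unfolding tensor_fun_def by (rule cod.lift_image)

text \<open>By \<open>peter_weyl_coaction\<close> the left factors stay in the Peter--Weyl algebra. The canonical map is
  therefore well defined: the inverse of \<open>tensor_fun\<close> is applied to elements of its image only.\<close>

lemma lift_can_image_subset: "lift_can ` carrier dom.TP \<subseteq> tensor_fun ` carrier cod.TP"
proof -
  have "\<exists>M. set M \<subseteq> P \<times> \<O> \<and> (\<lambda>z. \<Sum>p\<leftarrow>L. can_pair p z) = (\<lambda>z. \<Sum>p\<leftarrow>M. ev p z)" if "set L \<subseteq> P \<times> P" for L
    using that
  proof (induction L)
    case Nil
    show ?case by (intro exI[of _ "[]"]) simp
  next
    case (Cons pq L)
    obtain p q where pq: "pq = (p, q)" "p \<in> P" "q \<in> P" using Cons.prems by (cases pq) auto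
    obtain M where M: "set M \<subseteq> P \<times> \<O>" "(\<lambda>z. \<Sum>p\<leftarrow>L. can_pair p z) = (\<lambda>z. \<Sum>p\<leftarrow>M. ev p z)"
      using Cons by auto
    obtain N where N: "set N \<subseteq> P \<times> \<O>"
      "\<And>x g. x \<in> topspace X \<Longrightarrow> g \<in> carrier G \<Longrightarrow> q (act x g) = (\<Sum>(a, h)\<leftarrow>N. a x * h g)"
      using peter_weyl_coaction[OF pq(3)] by blast
    let ?N = "map (\<lambda>(a, h). (\<lambda>x. p x * a x, h)) N"
    have "set ?N \<subseteq> P \<times> \<O>" using N(1) pq(2) by (auto intro!: peter_weyl_mult)
    moreover have "can_pair pq (x, g) = (\<Sum>r\<leftarrow>?N. ev r (x, g))" for x g
    proof -
      have sum: "(\<Sum>r\<leftarrow>?N. ev r (x, g)) = p x * (\<Sum>(a, h)\<leftarrow>N. a x * h g)"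
        by (simp add: o_def case_prod_unfold mult.assoc sum_list_const_mult)
      show ?thesis
      proof (cases "x \<in> topspace X \<and> g \<in> carrier G")
        case True
        then show ?thesis unfolding sum using N(2)[of x g] by (simp add: pq(1) coaction_def)
      next
        case False
        moreover have "(\<Sum>(a, h)\<leftarrow>N. a x * h g) = 0" if "g \<notin> carrier G"
        proof -
          have "map (\<lambda>(a, h). a x * h g) N = map (\<lambda>_. 0) N"
            using N(1) coeff_outside[OF _ that] by (intro map_cong) auto
          then show ?thesis by (simp only: sum_list_triv) simp
        qed
        ultimately show ?thesis
          unfolding sum using peter_weyl_outside[OF pq(2), of x] by (auto simp: pq(1) coaction_def)
      qed
    qed
    ultimately show ?case
      using M by (intro exI[of _ "?N @ M"]) (auto simp: fun_eq_iff)
  qed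
  then show ?thesis unfolding dom.lift_image tensor_fun_image by blast
qed

lemma canonical_map_eqI:
  assumes "s \<in> carrier cod.TP" "tensor_fun s = lift_can t"
  shows "canonical_map G T X act t = s"
  unfolding canonical_map_def can_codomain_eq
  by (rule inv_into_f_eq[OF tensor_fun_inj]) (use assms in auto)

lemma canonical_map_lift:
  assumes "t \<in> carrier dom.TP"
  shows "canonical_map G T X act t \<in> carrier cod.TP" "tensor_fun (canonical_map G T X act t) = lift_can t"
proof -
  have "lift_can t \<in> tensor_fun ` carrier cod.TP"
    by (rule subsetD[OF lift_can_image_subset imageI[OF assms]])
  then obtain s where s: "lift_can t = tensor_fun s" "s \<in> carrier cod.TP" by (rule imageE)
  have "canonical_map G T X act t = s" by (rule canonical_map_eqI[OF s(2) s(1)[symmetric]])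
  with s show "canonical_map G T X act t \<in> carrier cod.TP"
    "tensor_fun (canonical_map G T X act t) = lift_can t" by simp_all
qed

lemma canonical_map_hom:
  "canonical_map G T X act \<in> hom (add_monoid (can_domain G T X act)) (add_monoid (can_codomain G T X act))"
  unfolding can_domain_eq can_codomain_eq
proof (rule homI)
  fix s t assume "s \<in> carrier (add_monoid dom.TP)" "t \<in> carrier (add_monoid dom.TP)"
  then have st: "s \<in> carrier dom.TP" "t \<in> carrier dom.TP" by simp_all
  note s' = canonical_map_lift[OF st(1)] and t' = canonical_map_lift[OF st(2)]
  have "canonical_map G T X act (s \<oplus>\<^bsub>dom.TP\<^esub> t) = canonical_map G T X act s \<oplus>\<^bsub>cod.TP\<^esub> canonical_map G T X act t"
  proof (rule canonical_map_eqI)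
    show "canonical_map G T X act s \<oplus>\<^bsub>cod.TP\<^esub> canonical_map G T X act t \<in> carrier cod.TP"
      by (rule cod.TP_add_closed[OF s'(1) t'(1)])
    show "tensor_fun (canonical_map G T X act s \<oplus>\<^bsub>cod.TP\<^esub> canonical_map G T X act t) = lift_can (s \<oplus>\<^bsub>dom.TP\<^esub> t)"
      using cod.lift_add[OF s'(1) t'(1)] dom.lift_add[OF st] s'(2) t'(2) unfolding tensor_fun_def by simp
  qed
  then show "canonical_map G T X act (s \<otimes>\<^bsub>add_monoid dom.TP\<^esub> t)
      = canonical_map G T X act s \<otimes>\<^bsub>add_monoid cod.TP\<^esub> canonical_map G T X act t" by simp
qed (simp add: canonical_map_lift)

lemma canonical_map_linear:
  assumes t: "t \<in> carrier (can_domain G T X act)"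
  shows "canonical_map G T X act ((\<lambda>x. c * indicator (topspace X) x) \<odot>\<^bsub>can_domain G T X act\<^esub> t)
    = c \<odot>\<^bsub>can_codomain G T X act\<^esub> canonical_map G T X act t"
  unfolding can_domain_eq can_codomain_eq
proof (rule canonical_map_eqI)
  have t: "t \<in> carrier dom.TP" using t by (simp add: can_domain_eq)
  note t' = canonical_map_lift[OF t]
  have c: "c \<in> carrier complex_ring" by (simp add: complex_ring_def)
  show "c \<odot>\<^bsub>cod.TP\<^esub> canonical_map G T X act t \<in> carrier cod.TP"
    by (rule cod.TP_smult_closed[OF c t'(1)])
  have "tensor_fun (c \<odot>\<^bsub>cod.TP\<^esub> canonical_map G T X act t) = (\<lambda>z. c * lift_can t z)"
    using cod.lift_smult[OF c t'(1), of c] t'(2) unfolding tensor_fun_def by (simp add: case_prod_unfold)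
  also have "\<dots> = lift_can ((\<lambda>x. c * indicator (topspace X) x) \<odot>\<^bsub>dom.TP\<^esub> t)"
    by (rule dom.lift_smult[OF _ t, symmetric]) (auto simp: invariant_const coaction_def)
  finally show "tensor_fun (c \<odot>\<^bsub>cod.TP\<^esub> canonical_map G T X act t)
      = lift_can ((\<lambda>x. c * indicator (topspace X) x) \<odot>\<^bsub>dom.TP\<^esub> t)" .
qed

section \<open>Injectivity of the canonical map\<close>

text \<open>This says that \<open>1 \<otimes> h\<close> is in the image of the canonical map.\<close>

definition reached :: "('g \<Rightarrow> complex) \<Rightarrow> bool" where
  "reached h \<longleftrightarrow> (\<exists>L. set L \<subseteq> P \<times> P \<and>
     (\<forall>x\<in>topspace X. \<forall>g\<in>carrier G. (\<Sum>(p, q)\<leftarrow>L. p x * q (act x g)) = h g))"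

text \<open>Let \<open>e\<close> represent evaluation at the identity on the finitely many coefficients that occur in the
  right factors \<open>q\<close>. If \<open>e (g)\<close> is a sum of products \<open>z (x) w (x g)\<close>, then
  \<open>q (x) = \<integral> q (x g) e (g) dg\<close> is the sum of the \<open>z (x)\<close> with coefficients
  \<open>expect (q w) (x)\<close>, which are invariant and can be moved to the left factors. There they sum
  up to an integral of the function to which the tensor is mapped.\<close>

lemma lift_can_inj:
  assumes reached: "\<And>h. h \<in> \<O> \<Longrightarrow> reached h"
  shows "inj_on lift_can (carrier dom.TP)"
proof (rule dom.lift_inj)
  fix c assume keys: "Poly_Mapping.keys c \<subseteq> P \<times> P" and zero: "\<And>z. frag_eval can_pair c z = 0"
  have "\<exists>L. set L \<subseteq> P \<times> \<O> \<and> (\<forall>x\<in>topspace X. \<forall>g\<in>carrier G. snd p (act x g) = (\<Sum>(a, h)\<leftarrow>L. a x * h g))"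
    if "p \<in> Poly_Mapping.keys c" for p
    using keys that by (intro peter_weyl_coaction) auto
  then obtain L where L: "\<And>p. p \<in> Poly_Mapping.keys c \<Longrightarrow> set (L p) \<subseteq> P \<times> \<O> \<and>
      (\<forall>x\<in>topspace X. \<forall>g\<in>carrier G. snd p (act x g) = (\<Sum>(a, h)\<leftarrow>L p. a x * h g))" by metis
  obtain ps where ps: "set ps = Poly_Mapping.keys c"
    using finite_list[OF finite_keys[of c]] by (elim exE)
  have "set (map snd (concat (map L ps))) \<subseteq> \<O>" using L ps by fastforce
  then obtain e where e: "e \<in> \<O>"
    and eval': "\<And>h. h \<in> set (map snd (concat (map L ps))) \<Longrightarrow> haar (\<lambda>x. h x * e x) = h \<one>"
    by (rule evaluation_kernel) blast
  have eval: "haar (\<lambda>x. snd r x * e x) = snd r \<one>" if "p \<in> Poly_Mapping.keys c" "r \<in> set (L p)" for p r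
    using that ps by (intro eval') auto
  from reached[OF e] obtain M where M: "set M \<subseteq> P \<times> P"
    and eM: "\<And>x g. x \<in> topspace X \<Longrightarrow> g \<in> carrier G \<Longrightarrow> (\<Sum>(p, q)\<leftarrow>M. p x * q (act x g)) = e g"
    unfolding reached_def by blast
  define z where "z k = fst (M ! k)" for k
  define w where "w k = snd (M ! k)" for k
  have zw: "z k \<in> P" "w k \<in> P" if "k < length M" for k
    using subsetD[OF M nth_mem[OF that]] by (simp_all add: z_def w_def mem_Times_iff)
  have eM': "e g = (\<Sum>k<length M. z k x * w k (act x g))" if "x \<in> topspace X" "g \<in> carrier G" for x g
    unfolding eM[OF that, symmetric] z_def w_def
    by (simp add: sum_list_sum_nth lessThan_atLeast0 case_prod_unfold)
  have ce: "cont e" using e by (rule coeff_cont)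
  have qc: "snd p \<in> P" "snd p \<in> cfun X" if "p \<in> Poly_Mapping.keys c" for p
    using keys that peter_weyl_cfun by auto
  have reproduce: "snd p x = (\<Sum>k<length M. expect (\<lambda>y. snd p y * w k y) x * z k x)"
    if p: "p \<in> Poly_Mapping.keys c" for p x
  proof (cases "x \<in> topspace X")
    case x: True
    have ch: "cont (snd r)" if "r \<in> set (L p)" for r using L[OF p] that by (intro coeff_cont) auto
    have "snd p x = snd p (act x \<one>)" using x by (simp add: act_one)
    also have "\<dots> = (\<Sum>r\<leftarrow>L p. fst r x * snd r \<one>)" using L[OF p] x by (simp add: case_prod_unfold)
    also have "\<dots> = (\<Sum>r\<leftarrow>L p. haar (\<lambda>g. fst r x * (snd r g * e g)))"
    proof (intro arg_cong[where f = sum_list] map_cong refl)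
      fix r assume r: "r \<in> set (L p)"
      have "cont (\<lambda>g. snd r g * e g)" by (intro cont_intros ch r ce)
      from haar_cmult[OF this] eval[OF p r]
      show "fst r x * snd r \<one> = haar (\<lambda>g. fst r x * (snd r g * e g))" by simp
    qed
    also have "\<dots> = haar (\<lambda>g. \<Sum>r\<leftarrow>L p. fst r x * (snd r g * e g))"
      by (rule haar_sum_list[symmetric]) (intro cont_intros ch ce)
    also have "\<dots> = haar (\<lambda>g. snd p (act x g) * e g)"
      using L[OF p] x by (intro haar_cong)
        (simp add: case_prod_unfold sum_list_mult_const[symmetric] mult.assoc)
    also have "\<dots> = haar (\<lambda>g. \<Sum>k<length M. z k x * (snd p (act x g) * w k (act x g)))"
      using x by (intro haar_cong) (simp add: eM' sum_distrib_left mult.left_commute)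
    also have "\<dots> = (\<Sum>k<length M. haar (\<lambda>g. z k x * (snd p (act x g) * w k (act x g))))"
      using x by (intro haar_sum cont_intros cont_orbit qc[OF p] peter_weyl_cfun zw) auto
    also have "\<dots> = (\<Sum>k<length M. expect (\<lambda>y. snd p y * w k y) x * z k x)"
      using x by (intro sum.cong refl)
        (simp add: expect_def haar_cmult cont_intros cont_orbit qc[OF p] peter_weyl_cfun zw)
    finally show ?thesis .
  next
    case False
    then show ?thesis using peter_weyl_outside[OF qc(1)[OF p]] by (simp add: expect_def)
  qed
  show "c \<in> dom.K"
  proof (rule dom.kernel_criterion[OF keys, where n = "length M" and z = z
        and r = "\<lambda>p k. expect (\<lambda>y. snd p y * w k y)"])
    show "z k \<in> P" if "k < length M" for k using zw[OF that] by simp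
    show "expect (\<lambda>y. snd p y * w k y) \<in> carrier (fun_module (topspace X) (\<lambda>b. b) B)"
      if "p \<in> Poly_Mapping.keys c" "k < length M" for p k
      using that by (simp add: expect_invariant cfun_mult qc peter_weyl_cfun zw)
    show "snd p = (\<lambda>y. \<Sum>k<length M. expect (\<lambda>y. snd p y * w k y) y * z k y)"
      if "p \<in> Poly_Mapping.keys c" for p
      using reproduce[OF that] by blast
    fix k x assume k: "k < length M"
    show "(\<Sum>p\<in>Poly_Mapping.keys c. of_int (Poly_Mapping.lookup c p) * (expect (\<lambda>y. snd p y * w k y) x * fst p x)) = 0"
    proof (cases "x \<in> topspace X")
      case x: True
      let ?F = "\<lambda>p g. (of_int (Poly_Mapping.lookup c p) * fst p x) * (snd p (act x g) * w k (act x g))"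
      have cF: "cont (\<lambda>g. snd p (act x g) * w k (act x g))" if "p \<in> Poly_Mapping.keys c" for p
        using x k that by (intro cont_intros cont_orbit qc peter_weyl_cfun zw)
      have "(\<Sum>p\<in>Poly_Mapping.keys c. of_int (Poly_Mapping.lookup c p) * (expect (\<lambda>y. snd p y * w k y) x * fst p x))
          = (\<Sum>p\<in>Poly_Mapping.keys c. haar (?F p))"
        using x by (intro sum.cong refl) (simp add: expect_def haar_cmult cF)
      also have "\<dots> = haar (\<lambda>g. \<Sum>p\<in>Poly_Mapping.keys c. ?F p g)"
        by (rule haar_sum[symmetric]) (auto intro!: cont_intros cF)
      also have "\<dots> = haar (\<lambda>_. 0)"
      proof (rule haar_cong)
        fix g assume g: "g \<in> carrier G"
        have "(\<Sum>p\<in>Poly_Mapping.keys c. ?F p g)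
            = (\<Sum>p\<in>Poly_Mapping.keys c. of_int (Poly_Mapping.lookup c p) * can_pair p (x, g)) * w k (act x g)"
          unfolding sum_distrib_right using x g
          by (intro sum.cong refl) (simp add: coaction_def case_prod_unfold mult.assoc)
        then show "(\<Sum>p\<in>Poly_Mapping.keys c. ?F p g) = 0"
          using zero[of "(x, g)"] by (simp add: frag_eval_def)
      qed
      finally show ?thesis by simp
    qed (simp add: expect_def)
  qed
qed

section \<open>Surjectivity of the canonical map for a free action\<close>

lemma reached_one: "reached (indicator (carrier G))"
  unfolding reached_def
  by (intro exI[of _ "[(indicator (topspace X), indicator (topspace X))]"])
    (simp add: invariant_peter_weyl invariant_one act_closed)

lemma reached_add:
  assumes "reached h" "reached k"
  shows "reached (\<lambda>g. h g + k g)"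
proof -
  obtain L M where "set L \<subseteq> P \<times> P" "set M \<subseteq> P \<times> P"
    "\<forall>x\<in>topspace X. \<forall>g\<in>carrier G. (\<Sum>(p, q)\<leftarrow>L. p x * q (act x g)) = h g"
    "\<forall>x\<in>topspace X. \<forall>g\<in>carrier G. (\<Sum>(p, q)\<leftarrow>M. p x * q (act x g)) = k g"
    using assms unfolding reached_def by blast
  then show ?thesis unfolding reached_def by (intro exI[of _ "L @ M"]) simp
qed

lemma reached_mult:
  assumes "reached h" "reached k"
  shows "reached (\<lambda>g. h g * k g)"
proof -
  obtain L M where L: "set L \<subseteq> P \<times> P" and M: "set M \<subseteq> P \<times> P"
    and h: "\<forall>x\<in>topspace X. \<forall>g\<in>carrier G. (\<Sum>(p, q)\<leftarrow>L. p x * q (act x g)) = h g"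
    and k: "\<forall>x\<in>topspace X. \<forall>g\<in>carrier G. (\<Sum>(p, q)\<leftarrow>M. p x * q (act x g)) = k g"
    using assms unfolding reached_def by blast
  let ?N = "map (\<lambda>((p, q), (p', q')). (\<lambda>x. p x * p' x, \<lambda>x. q x * q' x)) (List.product L M)"
  have "set ?N \<subseteq> P \<times> P" using L M by (auto intro!: peter_weyl_mult)
  moreover have "(\<Sum>(p, q)\<leftarrow>?N. p x * q (act x g)) = h g * k g"
    if "x \<in> topspace X" "g \<in> carrier G" for x g
  proof -
    have "h g * k g = (\<Sum>(r, s)\<leftarrow>List.product L M.
        (case r of (p, q) \<Rightarrow> p x * q (act x g)) * (case s of (p, q) \<Rightarrow> p x * q (act x g)))"
      using h k that by (simp flip: sum_list_product)
    also have "\<dots> = (\<Sum>(p, q)\<leftarrow>?N. p x * q (act x g))"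
      unfolding map_map by (intro arg_cong[where f = sum_list] map_cong refl) (auto simp: mult_ac)
    finally show ?thesis by simp
  qed
  ultimately show ?thesis unfolding reached_def by blast
qed

lemma reached_cmult:
  assumes "reached h"
  shows "reached (\<lambda>g. c * h g)"
proof -
  obtain L where L: "set L \<subseteq> P \<times> P"
    and h: "\<forall>x\<in>topspace X. \<forall>g\<in>carrier G. (\<Sum>(p, q)\<leftarrow>L. p x * q (act x g)) = h g"
    using assms unfolding reached_def by blast
  have "set (map (\<lambda>(p, q). (\<lambda>x. c * p x, q)) L) \<subseteq> P \<times> P" using L by (auto intro: peter_weyl_cmult)
  moreover have "(\<Sum>(p, q)\<leftarrow>map (\<lambda>(p, q). (\<lambda>x. c * p x, q)) L. p x * q (act x g)) = c * h g"
    if "x \<in> topspace X" "g \<in> carrier G" for x g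
    using h that by (simp add: o_def case_prod_unfold mult.assoc sum_list_const_mult)
  ultimately show ?thesis unfolding reached_def by blast
qed

text \<open>By freeness and compactness the orbit is a closed copy of the group, so a function on the group
  is a function on the orbit, which Tietze's theorem extends.\<close>

lemma extend_from_orbit:
  assumes free: "free_action G X act" and x0: "x0 \<in> topspace X" and c: "cont c"
  shows "\<exists>f\<in>cfun X. \<forall>g\<in>carrier G. f (act x0 g) = c g"
proof -
  have o: "continuous_map T X (act x0)" using x0 by (intro cont_act) auto
  have inj: "inj_on (act x0) (topspace T)"
  proof (rule inj_onI)
    fix g h assume "g \<in> topspace T" "h \<in> topspace T" and eq: "act x0 g = act x0 h"
    then have gh: "g \<in> carrier G" "h \<in> carrier G" by (auto simp: topspace_eq)
    have "act x0 (g \<otimes> inv h) = act (act x0 h) (inv h)" using gh x0 eq by (simp add: act_mult)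
    also have "\<dots> = x0" using gh x0 by (simp add: act_one flip: act_mult)
    finally have "g \<otimes> inv h = \<one>" using free gh x0 unfolding free_action_def by simp
    then have "g = inv (inv h)" using gh inv_equality[of g "inv h"] by simp
    then show "g = h" using gh by simp
  qed
  have "closed_map T X (act x0)"
    using compact Hausdorff_X o by (intro continuous_imp_closed_map)
  then have emb: "homeomorphic_map T (subtopology X (act x0 ` topspace T)) (act x0)"
    and closed: "closedin X (act x0 ` topspace T)"
    using injective_closed_imp_embedding_map[OF o _ inj] closed_map_def[of T X "act x0"]
    by (auto simp: embedding_map_def)
  obtain r where r: "homeomorphic_maps T (subtopology X (act x0 ` topspace T)) (act x0) r"
    using emb unfolding homeomorphic_map_maps by blast
  have cr: "continuous_map (subtopology X (act x0 ` topspace T)) T r"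
    and ra: "\<And>g. g \<in> carrier G \<Longrightarrow> r (act x0 g) = g"
    using r unfolding homeomorphic_maps_def by (auto simp: topspace_eq)
  have k: "continuous_map (subtopology X (act x0 ` topspace T)) euclidean (\<lambda>x. c (r x))"
    by (rule continuous_map_comp[OF cr c])
  have normal: "normal_space X"
    using compact_X Hausdorff_X compact_Hausdorff_or_regular_imp_normal_space by blast
  have ext: "\<exists>u. continuous_map X euclideanreal u \<and> (\<forall>x\<in>act x0 ` topspace T. u x = v x)"
    if "continuous_map (subtopology X (act x0 ` topspace T)) euclideanreal v" for v
    by (rule Tietze_extension_realinterval[OF normal closed is_interval_univ UNIV_not_empty that]) auto
  obtain u where u: "continuous_map X euclideanreal u" "\<And>x. x \<in> act x0 ` topspace T \<Longrightarrow> u x = Re (c (r x))"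
    using ext[OF continuous_map_Re[OF k]] by blast
  obtain v where v: "continuous_map X euclideanreal v" "\<And>x. x \<in> act x0 ` topspace T \<Longrightarrow> v x = Im (c (r x))"
    using ext[OF continuous_map_Im[OF k]] by blast
  define f where "f = (\<lambda>x. indicator (topspace X) x * (complex_of_real (u x) + \<i> * complex_of_real (v x)))"
  have "continuous_map X euclidean (\<lambda>x. complex_of_real (u x) + \<i> * complex_of_real (v x))"
    by (intro cont_intros continuous_map_of_real u(1) v(1))
  then have "continuous_map X euclidean f"
    by (rule continuous_map_eq) (simp add: f_def)
  then have "f \<in> cfun X"
    by (rule cfunI) (simp add: f_def)
  moreover have "f (act x0 g) = c g" if g: "g \<in> carrier G" for g
    using u(2)[of "act x0 g"] v(2)[of "act x0 g"] g ra[OF g] act_closed[OF x0 g]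
    by (simp add: f_def topspace_eq complex_eq_iff)
  ultimately show ?thesis by blast
qed

text \<open>Averaging \<open>f (x g) \<pi> (g\<^sup>-\<^sup>1)\<close> over the group makes a row vector \<open>f\<close> of functions
  equivariant. On the orbit of \<open>x0\<close> the row vector below is equivariant already, so its value
  there does not change.\<close>

lemma equivariant_vector:
  assumes free: "free_action G X act" and x0: "x0 \<in> topspace X"
    and \<pi>: "unitary_rep G T n \<pi>" "irreducible_rep G n \<pi>"
  shows "\<exists>\<phi>. (\<forall>i<n. \<phi> i \<in> P \<and> \<phi> i x0 = v i) \<and>
    (\<forall>i<n. \<forall>x\<in>topspace X. \<forall>h\<in>carrier G. \<phi> i (act x h) = (\<Sum>l<n. \<phi> l x * \<pi> h $$ (l, i)))"
proof -
  have c\<pi>: "cont (\<lambda>g. \<pi> g $$ (i, j))" if "i < n" "j < n" for i j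
    using \<pi>(1) that by (simp add: unitary_rep_def)
  have \<pi>c: "\<pi> g \<in> carrier_mat n n" if "g \<in> carrier G" for g using \<pi>(1) that by (simp add: unitary_rep_def)
  have \<pi>m: "\<pi> (g \<otimes> h) $$ (i, j) = (\<Sum>l<n. \<pi> g $$ (i, l) * \<pi> h $$ (l, j))"
    if "g \<in> carrier G" "h \<in> carrier G" "i < n" "j < n" for g h i j
  proof -
    have "\<pi> (g \<otimes> h) = \<pi> g * \<pi> h" using \<pi>(1) that by (simp add: unitary_rep_def)
    then show ?thesis using \<pi>c[OF that(1)] \<pi>c[OF that(2)] that by (simp add: scalar_prod_def lessThan_atLeast0)
  qed
  have \<pi>1: "\<pi> \<one> = 1\<^sub>m n"
  proof -
    let ?A = "\<pi> \<one>" and ?B = "map_mat cnj (transpose_mat (\<pi> \<one>))"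
    have A: "?A \<in> carrier_mat n n" "?B \<in> carrier_mat n n" using \<pi>c[OF one_closed] by auto
    have AB: "?A * ?B = 1\<^sub>m n" and AA: "?A * ?A = ?A"
      using \<pi>(1) one_closed unfolding unitary_rep_def by (auto, metis l_one one_closed)
    have "?A = ?A * (?A * ?B)" using A AB by simp
    also have "\<dots> = (?A * ?A) * ?B" using A by (intro assoc_mult_mat[symmetric]) auto
    finally show ?thesis using AA AB by simp
  qed
  have "\<forall>l\<in>{..<n}. \<exists>f. f \<in> cfun X \<and> (\<forall>g\<in>carrier G. f (act x0 g) = (\<Sum>m<n. v m * \<pi> g $$ (m, l)))"
  proof
    fix l assume "l \<in> {..<n}"
    then have "cont (\<lambda>g. \<Sum>m<n. v m * \<pi> g $$ (m, l))" by (intro cont_intros c\<pi>) auto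
    from extend_from_orbit[OF free x0 this]
    show "\<exists>f. f \<in> cfun X \<and> (\<forall>g\<in>carrier G. f (act x0 g) = (\<Sum>m<n. v m * \<pi> g $$ (m, l)))"
      by (simp only: Bex_def)
  qed
  from bchoice[OF this] obtain f where f: "\<And>l. l < n \<Longrightarrow> f l \<in> cfun X"
    and f0: "\<And>l g. l < n \<Longrightarrow> g \<in> carrier G \<Longrightarrow> f l (act x0 g) = (\<Sum>m<n. v m * \<pi> g $$ (m, l))"
    by auto
  define F where "F i x g = (\<Sum>l<n. f l (act x g) * \<pi> (inv g) $$ (l, i))" for i x g
  define \<phi> where "\<phi> i x = (if x \<in> topspace X then haar (F i x) else 0)" for i x
  have \<phi>C: "\<phi> i \<in> cfun X" if i: "i < n" for i
  proof -
    have "continuous_map (prod_topology X T) euclidean (\<lambda>(x, g). F i x g)"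
      unfolding F_def case_prod_unfold
    proof (intro cont_intros)
      fix l assume "l \<in> {..<n}"
      then have l: "l < n" by simp
      show "continuous_map (prod_topology X T) euclidean (\<lambda>p. f l (act (fst p) (snd p)))"
        by (rule continuous_map_comp[OF cont_act cfunD(1)[OF f[OF l]]]) (auto intro: continuous_intros)
      show "continuous_map (prod_topology X T) euclidean (\<lambda>p. \<pi> (inv (snd p)) $$ (l, i))"
        by (rule continuous_map_comp[OF cont_inv c\<pi>[OF l i]]) (auto intro: continuous_intros)
    qed simp
    from continuous_map_average[OF this] show ?thesis by (simp add: \<phi>_def[abs_def])
  qed
  have cF: "cont (F i x)" if "i < n" "x \<in> topspace X" for i x
    unfolding F_def using that
    by (intro cont_intros cont_orbit f continuous_map_comp[OF cont_inv[OF cont_id] c\<pi>]) auto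
  have equi: "\<phi> i (act x h) = (\<Sum>l<n. \<phi> l x * \<pi> h $$ (l, i))"
    if i: "i < n" and x: "x \<in> topspace X" and h: "h \<in> carrier G" for i x h
  proof -
    have xh: "act x h \<in> topspace X" using x h by (rule act_closed)
    have "\<phi> i (act x h) = haar (F i (act x h))" using xh by (simp add: \<phi>_def)
    also have "\<dots> = haar (\<lambda>g. F i (act x h) (inv h \<otimes> g))"
      using haar_ltrans[OF cF[OF i xh], of "inv h"] h by simp
    also have "\<dots> = haar (\<lambda>g. \<Sum>m<n. F m x g * \<pi> h $$ (m, i))"
    proof (rule haar_cong)
      fix g assume g: "g \<in> carrier G"
      have "F i (act x h) (inv h \<otimes> g) = (\<Sum>l<n. f l (act x g) * \<pi> (inv g \<otimes> h) $$ (l, i))"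
        unfolding F_def using x g h by (simp add: inv_mult_group flip: act_mult m_assoc)
      also have "\<dots> = (\<Sum>l<n. \<Sum>m<n. f l (act x g) * (\<pi> (inv g) $$ (l, m) * \<pi> h $$ (m, i)))"
        using g h i by (simp add: \<pi>m sum_distrib_left)
      also have "\<dots> = (\<Sum>m<n. \<Sum>l<n. f l (act x g) * (\<pi> (inv g) $$ (l, m) * \<pi> h $$ (m, i)))"
        by (rule sum.swap)
      also have "\<dots> = (\<Sum>m<n. F m x g * \<pi> h $$ (m, i))"
        by (simp add: F_def sum_distrib_right mult.assoc)
      finally show "F i (act x h) (inv h \<otimes> g) = (\<Sum>m<n. F m x g * \<pi> h $$ (m, i))" .
    qed
    also have "\<dots> = (\<Sum>m<n. haar (\<lambda>g. F m x g * \<pi> h $$ (m, i)))"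
      using x by (intro haar_sum cont_intros cF) auto
    also have "\<dots> = (\<Sum>m<n. \<phi> m x * \<pi> h $$ (m, i))"
      using x by (intro sum.cong refl) (simp add: \<phi>_def haar_multc cF)
    finally show ?thesis .
  qed
  have "\<phi> i \<in> P" if i: "i < n" for i
  proof (rule peter_weylI[OF \<phi>C[OF i]])
    let ?c = "\<lambda>l i g. if g \<in> carrier G then \<pi> g $$ (l, i) else 0"
    show "set (map (\<lambda>l. (\<phi> l, ?c l i)) [0..<n]) \<subseteq> cfun X \<times> \<O>"
      using \<pi> i by (auto intro!: \<phi>C coeff_matrix simp: matrix_coefficients_def) blast
    show "\<phi> i (act x g) = (\<Sum>(a, h)\<leftarrow>map (\<lambda>l. (\<phi> l, ?c l i)) [0..<n]. a x * h g)"
      if "x \<in> topspace X" "g \<in> carrier G" for x g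
      using equi[OF i that] that by (simp add: o_def sum_list_distinct_conv_sum_set lessThan_atLeast0)
  qed
  moreover have "\<phi> i x0 = v i" if i: "i < n" for i
  proof -
    have "F i x0 g = v i" if g: "g \<in> carrier G" for g
    proof -
      have "F i x0 g = (\<Sum>l<n. \<Sum>m<n. v m * (\<pi> g $$ (m, l) * \<pi> (inv g) $$ (l, i)))"
        unfolding F_def using f0 g by (simp add: sum_distrib_right mult.assoc)
      also have "\<dots> = (\<Sum>m<n. v m * (\<Sum>l<n. \<pi> g $$ (m, l) * \<pi> (inv g) $$ (l, i)))"
        unfolding sum_distrib_left by (rule sum.swap)
      also have "\<dots> = (\<Sum>m<n. v m * \<pi> \<one> $$ (m, i))"
        using g i by (intro sum.cong refl) (simp flip: \<pi>m)
      also have "\<dots> = (\<Sum>m<n. if m = i then v m else 0)"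
        using i by (intro sum.cong refl) (simp add: \<pi>1)
      finally show ?thesis using i by simp
    qed
    then have "haar (F i x0) = haar (\<lambda>_. v i)" by (rule haar_cong)
    then show ?thesis using x0 by (simp add: \<phi>_def)
  qed
  ultimately show ?thesis using equi by blast
qed

lemma peter_weyl_prod:
  "finite I \<Longrightarrow> (\<And>i. i \<in> I \<Longrightarrow> f i \<in> P) \<Longrightarrow> (\<lambda>x. indicator (topspace X) x * (\<Prod>i\<in>I. f i x)) \<in> P"
proof (induction I rule: finite_induct)
  case empty
  then show ?case using invariant_peter_weyl[OF invariant_one] by simp
next
  case (insert i I)
  have "(\<lambda>x. f i x * (indicator (topspace X) x * (\<Prod>i\<in>I. f i x))) \<in> P"
    by (rule peter_weyl_mult) (use insert in auto)
  then show ?case using insert by (simp add: mult.left_commute)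
qed

text \<open>The indicator function is there because an empty product, and thus a determinant of size \<open>0\<close>, is
  the constant \<open>1\<close>, which does not vanish outside the space.\<close>

lemma peter_weyl_det:
  assumes "\<And>i j. i < m \<Longrightarrow> j < m \<Longrightarrow> e i j \<in> P"
  shows "(\<lambda>x. indicator (topspace X) x * det (mat m m (\<lambda>(i, j). e i j x))) \<in> P"
proof -
  have less: "p i < m" if "p permutes {0..<m}" "i < m" for p i
    using permutes_in_image[OF that(1), of i] that(2) by simp
  have "(\<lambda>x. \<Sum>p | p permutes {0..<m}. signof p * (indicator (topspace X) x * (\<Prod>i = 0..<m. e i (p i) x))) \<in> P"
    by (intro peter_weyl_sum peter_weyl_cmult peter_weyl_prod assms)
      (auto simp: finite_permutations less)
  also have "(\<lambda>x. \<Sum>p | p permutes {0..<m}. signof p * (indicator (topspace X) x * (\<Prod>i = 0..<m. e i (p i) x)))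
      = (\<lambda>x. indicator (topspace X) x * det (mat m m (\<lambda>(i, j). e i j x)))"
    unfolding det_def sum_distrib_left
    by (auto simp: sum_distrib_left less mult.left_commute intro!: ext sum.cong prod.cong)
  finally show ?thesis .
qed

text \<open>Near a point where the rows \<open>\<phi> k\<close> form the identity matrix, Cramer's rule inverts the matrix
  \<open>\<Phi>\<close> with these rows. Since \<open>\<Phi> (x g) = \<Phi> (x) \<pi> (g)\<close>, the product of the adjugate of
  \<open>\<Phi> (x)\<close> and \<open>\<Phi> (x g)\<close> is \<open>det \<Phi> (x) \<pi> (g)\<close>. The factor \<open>cnj (det \<Phi> (x))\<close> makes the
  scalar nonnegative and invariant, because \<open>det \<pi> (g)\<close> has modulus one.\<close>

lemma locally_reached:
  assumes free: "free_action G X act" and x0: "x0 \<in> topspace X"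
    and \<pi>: "unitary_rep G T n \<pi>" "irreducible_rep G n \<pi>" and ij: "i < n" "j < n"
  shows "\<exists>\<beta> L. (\<lambda>x. indicator (topspace X) x * complex_of_real (\<beta> x)) \<in> B \<and> (\<forall>x. \<beta> x \<ge> 0) \<and> \<beta> x0 > 0 \<and>
    set L \<subseteq> P \<times> P \<and>
    (\<forall>x\<in>topspace X. \<forall>g\<in>carrier G. (\<Sum>(p, q)\<leftarrow>L. p x * q (act x g)) = complex_of_real (\<beta> x) * \<pi> g $$ (i, j))"
proof -
  have \<pi>c: "\<pi> g \<in> carrier_mat n n" if "g \<in> carrier G" for g using \<pi>(1) that by (simp add: unitary_rep_def)
  have "\<forall>k. \<exists>\<phi>. (\<forall>i<n. \<phi> i \<in> P \<and> \<phi> i x0 = (if i = k then 1 else 0)) \<and>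
    (\<forall>i<n. \<forall>x\<in>topspace X. \<forall>h\<in>carrier G. \<phi> i (act x h) = (\<Sum>l<n. \<phi> l x * \<pi> h $$ (l, i)))"
    (is "\<forall>k. \<exists>\<phi>. ?Q k \<phi>")
    by (intro allI equivariant_vector[OF free x0 \<pi>])
  from choice[OF this] obtain \<phi> where \<phi>: "\<forall>k. ?Q k (\<phi> k)" by (elim exE)
  have \<phi>P: "\<phi> k i \<in> P" and \<phi>0: "\<phi> k i x0 = (if i = k then 1 else 0)"
    and equi: "x \<in> topspace X \<Longrightarrow> h \<in> carrier G \<Longrightarrow> \<phi> k i (act x h) = (\<Sum>l<n. \<phi> k l x * \<pi> h $$ (l, i))"
    if "i < n" for k i x h
    using \<phi> that by simp_all
  define \<Phi> where "\<Phi> x = mat n n (\<lambda>(k, i). \<phi> k i x)" for x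
  have \<Phi>c: "\<Phi> x \<in> carrier_mat n n" for x by (simp add: \<Phi>_def)
  have \<Phi>_equi: "\<Phi> (act x h) = \<Phi> x * \<pi> h" if "x \<in> topspace X" "h \<in> carrier G" for x h
    using \<pi>c[OF that(2)] that
    by (intro eq_matI) (auto simp: \<Phi>_def equi scalar_prod_def lessThan_atLeast0)
  have \<Phi>0: "\<Phi> x0 = 1\<^sub>m n" by (intro eq_matI) (auto simp: \<Phi>_def \<phi>0)
  let ?I = "indicator (topspace X) :: 'x \<Rightarrow> complex"
  define d where "d x = ?I x * det (\<Phi> x)" for x
  have d: "d \<in> P" unfolding d_def[abs_def] \<Phi>_def by (intro peter_weyl_det \<phi>P)
  have adj: "(\<lambda>x. ?I x * adj_mat (\<Phi> x) $$ (i, k)) \<in> P" if k: "k < n" for k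
  proof -
    let ?s = "\<lambda>k a. if a < k then a else Suc a"
    have "(\<lambda>x. (-1) ^ (k + i) * (?I x * det (mat (n - 1) (n - 1) (\<lambda>(a, b). \<phi> (?s k a) (?s i b) x)))) \<in> P"
      by (intro peter_weyl_cmult peter_weyl_det \<phi>P) auto
    also have "(\<lambda>x. (-1) ^ (k + i) * (?I x * det (mat (n - 1) (n - 1) (\<lambda>(a, b). \<phi> (?s k a) (?s i b) x))))
        = (\<lambda>x. ?I x * adj_mat (\<Phi> x) $$ (i, k))"
    proof
      fix x
      have "mat_delete (\<Phi> x) k i = mat (n - 1) (n - 1) (\<lambda>(a, b). \<phi> (?s k a) (?s i b) x)"
        using k ij by (intro eq_matI) (auto simp: mat_delete_def \<Phi>_def)
      then show "(-1) ^ (k + i) * (?I x * det (mat (n - 1) (n - 1) (\<lambda>(a, b). \<phi> (?s k a) (?s i b) x)))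
          = ?I x * adj_mat (\<Phi> x) $$ (i, k)"
        using k ij \<Phi>c[of x] by (simp add: adj_mat_def cofactor_def)
    qed
    finally show ?thesis .
  qed
  define \<beta> where "\<beta> x = (norm (det (\<Phi> x)))\<^sup>2" for x
  define L where "L = map (\<lambda>k. (\<lambda>x. cnj (d x) * (?I x * adj_mat (\<Phi> x) $$ (i, k)), \<phi> k j)) [0..<n]"
  have "set L \<subseteq> P \<times> P" unfolding L_def using ij by (auto intro!: peter_weyl_mult peter_weyl_cnj d adj \<phi>P)
  moreover have "(\<Sum>(p, q)\<leftarrow>L. p x * q (act x g)) = complex_of_real (\<beta> x) * \<pi> g $$ (i, j)"
    if x: "x \<in> topspace X" and g: "g \<in> carrier G" for x g
  proof -
    have A: "adj_mat (\<Phi> x) \<in> carrier_mat n n" "adj_mat (\<Phi> x) * \<Phi> x = det (\<Phi> x) \<cdot>\<^sub>m 1\<^sub>m n"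
      using adj_mat[OF \<Phi>c] by auto
    have "(\<Sum>(p, q)\<leftarrow>L. p x * q (act x g)) = cnj (det (\<Phi> x)) * (\<Sum>k<n. adj_mat (\<Phi> x) $$ (i, k) * \<phi> k j (act x g))"
      using x by (simp add: L_def d_def o_def sum_list_distinct_conv_sum_set lessThan_atLeast0 sum_distrib_left mult.assoc)
    also have "(\<Sum>k<n. adj_mat (\<Phi> x) $$ (i, k) * \<phi> k j (act x g)) = (adj_mat (\<Phi> x) * \<Phi> (act x g)) $$ (i, j)"
      using A(1) ij by (simp add: scalar_prod_def lessThan_atLeast0 \<Phi>_def)
    also have "adj_mat (\<Phi> x) * \<Phi> (act x g) = (adj_mat (\<Phi> x) * \<Phi> x) * \<pi> g"
      unfolding \<Phi>_equi[OF x g] using A(1) \<Phi>c \<pi>c[OF g] by (intro assoc_mult_mat[symmetric])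
    also have "\<dots> $$ (i, j) = det (\<Phi> x) * \<pi> g $$ (i, j)"
      unfolding A(2) using \<pi>c[OF g] ij by simp
    finally show ?thesis
      by (simp add: \<beta>_def complex_norm_square mult_ac del: of_real_power)
  qed
  moreover have "(\<lambda>x. ?I x * complex_of_real (\<beta> x)) \<in> B"
  proof -
    have eq: "(\<lambda>x. ?I x * complex_of_real (\<beta> x)) = (\<lambda>x. cnj (d x) * d x)"
      by (auto simp: \<beta>_def d_def complex_norm_square fun_eq_iff indicator_def mult.commute simp del: of_real_power)
    have "\<beta> (act x g) = \<beta> x" if x: "x \<in> topspace X" and g: "g \<in> carrier G" for x g
    proof -
      let ?h = "map_mat cnj (transpose_mat (\<pi> g))"
      have h: "?h \<in> carrier_mat n n" using \<pi>c[OF g] by simp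
      have "det ?h = cnj (det (\<pi> g))"
      proof -
        interpret cnj: comm_ring_hom cnj by unfold_locales auto
        have "det ?h = cnj (det (transpose_mat (\<pi> g)))" by (rule cnj.hom_det)
        also have "det (transpose_mat (\<pi> g)) = det (\<pi> g)" by (rule det_transpose[OF \<pi>c[OF g]])
        finally show ?thesis .
      qed
      moreover have "det (\<pi> g * ?h) = 1" using \<pi>(1) g by (simp add: unitary_rep_def)
      ultimately have "det (\<pi> g) * cnj (det (\<pi> g)) = 1" using det_mult[OF \<pi>c[OF g] h] by simp
      then have "complex_of_real ((norm (det (\<pi> g)))\<^sup>2) = complex_of_real 1"
        by (simp add: complex_norm_square del: of_real_power)
      then have "(norm (det (\<pi> g)))\<^sup>2 = 1" by (simp only: of_real_eq_iff)
      then show ?thesis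
        unfolding \<beta>_def \<Phi>_equi[OF x g] det_mult[OF \<Phi>c \<pi>c[OF g]] by (simp add: norm_mult power_mult_distrib)
    qed
    moreover have "(\<lambda>x. ?I x * complex_of_real (\<beta> x)) \<in> P"
      unfolding eq by (intro peter_weyl_mult peter_weyl_cnj d)
    ultimately show ?thesis
      unfolding invariant_iff using peter_weyl_cfun by (auto simp: act_closed)
  qed
  moreover have "\<beta> x0 > 0" by (simp add: \<beta>_def \<Phi>0)
  moreover have "\<beta> x \<ge> 0" for x by (simp add: \<beta>_def)
  ultimately show ?thesis by blast
qed

text \<open>Add up finitely many of the local solutions whose factors \<open>\<beta>\<close> are positive on an open cover of
  the space, and divide by the sum \<open>b\<close> of the factors. The quotient \<open>r = 1 / b\<close> is continuous
  and invariant, so multiplying the left factors by \<open>r\<close> keeps them in the Peter--Weyl algebra.\<close>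

lemma reached_matrix_coefficient:
  assumes free: "free_action G X act" and h: "h \<in> matrix_coefficients G T"
  shows "reached h"
proof -
  obtain n \<pi> i j where h: "h = (\<lambda>g. if g \<in> carrier G then \<pi> g $$ (i, j) else 0)"
    and \<pi>: "unitary_rep G T n \<pi>" "irreducible_rep G n \<pi>" and ij: "i < n" "j < n"
    using h unfolding matrix_coefficients_def by blast
  let ?I = "indicator (topspace X) :: 'x \<Rightarrow> complex"
  define good where "good \<beta> L \<longleftrightarrow> (\<lambda>x. ?I x * complex_of_real (\<beta> x)) \<in> B \<and> (\<forall>x. \<beta> x \<ge> 0) \<and> set L \<subseteq> P \<times> P \<and>
    (\<forall>x\<in>topspace X. \<forall>g\<in>carrier G. (\<Sum>(p, q)\<leftarrow>L. p x * q (act x g)) = complex_of_real (\<beta> x) * \<pi> g $$ (i, j))"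
    for \<beta> :: "'x \<Rightarrow> real" and L
  have "\<forall>y\<in>topspace X. \<exists>\<beta> L. good \<beta> L \<and> \<beta> y > 0"
    using locally_reached[OF free _ \<pi> ij] unfolding good_def by blast
  then obtain \<beta> L where loc: "\<And>y. y \<in> topspace X \<Longrightarrow> good (\<beta> y) (L y) \<and> \<beta> y y > 0" by metis
  let ?U = "\<lambda>y. {x \<in> topspace X. Re (?I x * complex_of_real (\<beta> y x)) \<in> {0<..}}"
  have U: "openin X (?U y)" if "y \<in> topspace X" for y
  proof (rule openin_continuous_map_preimage)
    show "continuous_map X euclideanreal (\<lambda>x. Re (?I x * complex_of_real (\<beta> y x)))"
      using loc[OF that] unfolding good_def invariant_iff by (intro continuous_map_Re cfunD(1)) auto
  qed simp
  have "\<exists>\<F>. finite \<F> \<and> \<F> \<subseteq> ?U ` topspace X \<and> topspace X \<subseteq> \<Union>\<F>"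
    using compact_X unfolding compact_space_def
    by (rule compactinD) (use U loc in auto)
  then obtain \<F> where F0: "finite \<F>" "\<F> \<subseteq> ?U ` topspace X" "topspace X \<subseteq> \<Union>\<F>" by blast
  obtain D where D: "D \<subseteq> topspace X" "finite D" "\<F> = ?U ` D"
    using finite_subset_image[OF F0(1,2)] by blast
  have good_add: "good (\<lambda>x. \<beta> x + \<beta>' x) (L @ L')" if "good \<beta> L" "good \<beta>' L'" for \<beta> \<beta>' L L'
    using that invariant_add unfolding good_def by (auto simp: distrib_left distrib_right)
  have "\<exists>M. good (\<lambda>x. \<Sum>y\<in>D. \<beta> y x) M"
    using D(2,1)
  proof (induction D rule: finite_induct)
    case empty
    show ?case using invariant_const[of 0] by (intro exI[of _ "[]"]) (simp add: good_def)
  next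
    case (insert y D)
    then obtain M where M: "good (\<lambda>x. \<Sum>y\<in>D. \<beta> y x) M" by auto
    have "good (\<beta> y) (L y)" using loc insert by simp
    from good_add[OF this M] insert show ?case by auto
  qed
  then obtain M where M: "good (\<lambda>x. \<Sum>y\<in>D. \<beta> y x) M" by blast
  define b where "b x = (\<Sum>y\<in>D. \<beta> y x)" for x
  have bpos: "b x > 0" if x: "x \<in> topspace X" for x
  proof -
    obtain y where y: "y \<in> D" "\<beta> y x > 0" using F0(3) D(3) x by auto
    have "\<beta> y x \<le> b x"
      unfolding b_def using D loc y(1) by (intro member_le_sum) (auto simp: good_def subset_iff)
    with y show ?thesis by simp
  qed
  have bB: "(\<lambda>x. ?I x * complex_of_real (b x)) \<in> B" using M by (simp add: good_def b_def)
  define r where "r = (\<lambda>x. ?I x * inverse (complex_of_real (b x)))"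
  have "r \<in> B"
  proof -
    have "continuous_map X euclidean (\<lambda>x. inverse (?I x * complex_of_real (b x)))"
      using bB bpos by (intro continuous_map_complex_inverse cfunD(1)) (auto simp: invariant_iff less_imp_neq[symmetric])
    then have "continuous_map X euclidean r" by (rule continuous_map_eq) (simp add: r_def)
    then have "r \<in> cfun X" by (rule cfunI) (simp add: r_def)
    moreover have "b (act x g) = b x" if "x \<in> topspace X" "g \<in> carrier G" for x g
    proof -
      have "?I (act x g) * complex_of_real (b (act x g)) = ?I x * complex_of_real (b x)"
        using bB that unfolding invariant_iff by blast
      then show ?thesis using that act_closed[OF that] by simp
    qed
    ultimately show ?thesis by (auto simp: invariant_iff r_def act_closed)
  qed
  then have r: "r \<in> P" by (rule invariant_peter_weyl)
  let ?M = "map (\<lambda>(p, q). (\<lambda>x. r x * p x, q)) M"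
  have "set ?M \<subseteq> P \<times> P" using M r by (auto simp: good_def intro!: peter_weyl_mult)
  moreover have "(\<Sum>(p, q)\<leftarrow>?M. p x * q (act x g)) = h g" if "x \<in> topspace X" "g \<in> carrier G" for x g
  proof -
    have "(\<Sum>(p, q)\<leftarrow>?M. p x * q (act x g)) = r x * (\<Sum>(p, q)\<leftarrow>M. p x * q (act x g))"
      by (simp add: o_def case_prod_unfold mult.assoc sum_list_const_mult)
    also have "\<dots> = r x * (complex_of_real (b x) * \<pi> g $$ (i, j))"
      using M that by (simp add: good_def b_def)
    also have "\<dots> = h g" using that bpos[OF that(1)] by (simp add: r_def h)
    finally show ?thesis .
  qed
  ultimately show ?thesis unfolding reached_def by blast
qed

lemma reached_coeff:
  assumes "free_action G X act" "h \<in> \<O>"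
  shows "reached h"
  using assms(2)
proof (induction rule: coeff_induct)
  case (matrix f)
  then show ?case by (rule reached_matrix_coefficient[OF assms(1)])
qed (auto intro: reached_one reached_add reached_mult reached_cmult)

lemma lift_can_image:
  assumes reached: "\<And>h. h \<in> \<O> \<Longrightarrow> reached h"
  shows "lift_can ` carrier dom.TP = tensor_fun ` carrier cod.TP"
proof (rule equalityI[OF lift_can_image_subset])
  have "\<exists>M. set M \<subseteq> P \<times> P \<and> (\<lambda>z. \<Sum>p\<leftarrow>L. ev p z) = (\<lambda>z. \<Sum>p\<leftarrow>M. can_pair p z)" if "set L \<subseteq> P \<times> \<O>" for L
    using that
  proof (induction L)
    case Nil
    show ?case by (intro exI[of _ "[]"]) simp
  next
    case (Cons ah L)
    obtain a h where ah: "ah = (a, h)" "a \<in> P" "h \<in> \<O>" using Cons.prems by (cases ah) auto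
    obtain M where M: "set M \<subseteq> P \<times> P" "(\<lambda>z. \<Sum>p\<leftarrow>L. ev p z) = (\<lambda>z. \<Sum>p\<leftarrow>M. can_pair p z)"
      using Cons by auto
    obtain N where N: "set N \<subseteq> P \<times> P"
      "\<And>x g. x \<in> topspace X \<Longrightarrow> g \<in> carrier G \<Longrightarrow> (\<Sum>(p, q)\<leftarrow>N. p x * q (act x g)) = h g"
      using reached[OF ah(3)] unfolding reached_def by blast
    let ?N = "map (\<lambda>(p, q). (\<lambda>x. a x * p x, q)) N"
    have "set ?N \<subseteq> P \<times> P" using N(1) ah(2) by (auto intro!: peter_weyl_mult)
    moreover have "ev ah (x, g) = (\<Sum>r\<leftarrow>?N. can_pair r (x, g))" for x g
    proof (cases "x \<in> topspace X \<and> g \<in> carrier G")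
      case True
      then have "(\<Sum>r\<leftarrow>?N. can_pair r (x, g)) = a x * (\<Sum>(p, q)\<leftarrow>N. p x * q (act x g))"
        by (simp add: o_def case_prod_unfold mult.assoc sum_list_const_mult coaction_def)
      then show ?thesis using N(2) True by (simp add: ah(1))
    next
      case False
      then have "ev ah (x, g) = 0"
        using peter_weyl_outside[OF ah(2)] coeff_outside[OF ah(3)] by (auto simp: ah(1))
      moreover have "map (\<lambda>r. can_pair r (x, g)) ?N = map (\<lambda>_. 0) ?N"
        using False by (intro map_cong refl) (auto simp: coaction_def)
      ultimately show ?thesis by (simp only: sum_list_triv) simp
    qed
    ultimately show ?case
      using M by (intro exI[of _ "?N @ M"]) (auto simp: fun_eq_iff)
  qed
  then show "tensor_fun ` carrier cod.TP \<subseteq> lift_can ` carrier dom.TP"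
    unfolding dom.lift_image tensor_fun_image by blast
qed

lemma canonical_map_iso:
  assumes free: "free_action G X act"
  shows "canonical_map G T X act
    \<in> iso (add_monoid (can_domain G T X act)) (add_monoid (can_codomain G T X act))"
proof -
  let ?c = "canonical_map G T X act"
  have inj: "inj_on lift_can (carrier dom.TP)"
    and image: "lift_can ` carrier dom.TP = tensor_fun ` carrier cod.TP"
    by (rule lift_can_inj lift_can_image, rule reached_coeff[OF free], assumption)+
  have "bij_betw ?c (carrier dom.TP) (carrier cod.TP)"
  proof (rule bij_betwI')
    show "?c s = ?c t \<longleftrightarrow> s = t" if "s \<in> carrier dom.TP" "t \<in> carrier dom.TP" for s t
      using canonical_map_lift(2)[OF that(1)] canonical_map_lift(2)[OF that(2)]
        inj_onD[OF inj _ that] by auto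
    show "?c s \<in> carrier cod.TP" if "s \<in> carrier dom.TP" for s
      by (rule canonical_map_lift(1)[OF that])
    show "\<exists>t\<in>carrier dom.TP. s = ?c t" if s: "s \<in> carrier cod.TP" for s
    proof -
      have "tensor_fun s \<in> lift_can ` carrier dom.TP"
        unfolding image using s by (rule imageI)
      then obtain t where t: "tensor_fun s = lift_can t" "t \<in> carrier dom.TP" by (rule imageE)
      then show ?thesis using canonical_map_eqI[OF s t(1)] by (intro bexI[of _ t]) auto
    qed
  qed
  then show ?thesis
    using canonical_map_hom by (simp add: iso_def can_domain_eq can_codomain_eq)
qed

section \<open>Freeness and the canonical map\<close>

text \<open>If \<open>x g = x\<close>, then every function in the image of the canonical map takes the same value at
  \<open>(x, g)\<close> and \<open>(x, \<one>)\<close>. The image contains \<open>1 \<otimes> h\<close> for all matrix coefficients \<open>h\<close>, and these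
  separate the points of the group.\<close>

lemma free_if_iso:
  assumes iso: "canonical_map G T X act
    \<in> iso (add_monoid (can_domain G T X act)) (add_monoid (can_codomain G T X act))"
  shows "free_action G X act"
  unfolding free_action_def
proof (intro ballI impI)
  fix x g assume x: "x \<in> topspace X" and g: "g \<in> carrier G" and fixed: "act x g = x"
  show "g = \<one>"
  proof (rule ccontr)
    assume "g \<noteq> \<one>"
    then obtain h where h: "h \<in> matrix_coefficients G T" "h g \<noteq> h \<one>"
      using matrix_coefficients_separate[OF g] by blast
    let ?f = "\<lambda>z. \<Sum>p\<leftarrow>[(indicator (topspace X), h)]. ev p z"
    have "set [(indicator (topspace X), h)] \<subseteq> P \<times> \<O>"
      using coeff_matrix[OF h(1)] by (simp add: invariant_peter_weyl invariant_one)
    then have "?f \<in> tensor_fun ` carrier cod.TP" unfolding tensor_fun_image by blast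
    then obtain s where s: "?f = tensor_fun s" "s \<in> carrier cod.TP" by (rule imageE)
    have "canonical_map G T X act ` carrier dom.TP = carrier cod.TP"
      using iso by (simp add: iso_def can_domain_eq can_codomain_eq bij_betw_def)
    then obtain t where t: "t \<in> carrier dom.TP" "s = canonical_map G T X act t" using s(2) by blast
    have "?f = lift_can t" using s(1) t(2) canonical_map_lift(2)[OF t(1)] by simp
    also have "\<dots> \<in> lift_can ` carrier dom.TP" using t(1) by (rule imageI)
    finally obtain L where L: "?f = (\<lambda>z. \<Sum>p\<leftarrow>L. can_pair p z)" unfolding dom.lift_image by blast
    have "can_pair p (x, g) = can_pair p (x, \<one>)" for p
      using x g fixed by (simp add: case_prod_unfold coaction_def act_one)
    then have "(\<Sum>p\<leftarrow>L. can_pair p (x, g)) = (\<Sum>p\<leftarrow>L. can_pair p (x, \<one>))" by simp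
    then have "?f (x, g) = ?f (x, \<one>)"
      using fun_cong[OF L, of "(x, g)"] fun_cong[OF L, of "(x, \<one>)"] by (simp only:)
    with h(2) x show False by simp
  qed
qed

end

theorem theorem0p5:
  fixes G :: "'g monoid" and T :: "'g topology"
    and X :: "'x topology" and act :: "'x \<Rightarrow> 'g \<Rightarrow> 'x"
  assumes "topological_group G T" and "compact_space T" and "Hausdorff_space T"
    and "compact_space X" and "Hausdorff_space X"
    and "continuous_right_action G T X act"
  shows "free_action G X act \<longleftrightarrow>
    canonical_map G T X act
      \<in> iso (add_monoid (can_domain G T X act)) (add_monoid (can_codomain G T X act)) \<and>
    (\<forall>c. \<forall>t\<in>carrier (can_domain G T X act).
       canonical_map G T X act ((\<lambda>x. c * indicator (topspace X) x) \<odot>\<^bsub>can_domain G T X act\<^esub> t)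
         = c \<odot>\<^bsub>can_codomain G T X act\<^esub> canonical_map G T X act t)"
proof -
  interpret compact_action G T X act
    using assms by (intro compact_action.intro compact_group.intro compact_group_axioms.intro
        compact_action_axioms.intro)
  show ?thesis
    using canonical_map_iso free_if_iso canonical_map_linear by blast
qed

end
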